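(* Let $p$ be a prime and let $\alpha,\beta,\gamma$ be partitions; put $e=\alpha_1$ (the exponent of a group of type $\alpha$). Then $$g_{\alpha,\gamma}^\beta(p)\;=\;\sum_{\Pi}\;\prod_{\ell=2}^{e+1}\frac{\#\mathrm{Aut}_{\mathcal S}\,E(\Pi|_1^\ell;p)}{\#\mathrm{Aut}_{\mathcal S}\,E(\Pi|_2^\ell;p)},$$ where the sum runs over all Klein tableaux $\Pi=[\gamma^0,\ldots,\gamma^e;\varphi^2,\ldots,\varphi^e]$ of type $(\alpha,\beta,\gamma)$.
   Context: Finite abelian $p$-groups. For a partition $\lambda$ put $M(\lambda)=\bigoplus_i\mathbb Z/(p^{\lambda_i})$. The type of a finite abelian $p$-group $B$ is the partition $\beta$ with $B\cong M(\beta)$; equivalently $\beta'_i=\dim_{\mathbb Z/(p)}p^{i-1}B/p^iB$, where $\lambda'$ denotes the conjugate partition. The classical Hall number $g_{\alpha,\gamma}^\beta(p)$ is the number of subgroups $U\subseteq M(\beta)$ with $U\cong M(\alpha)$ and $M(\beta)/U\cong M(\gamma)$. The category $\mathcal S$: objects are embeddings $(A\subset B)$ of a subgroup $A$ in a finite abelian $p$-group $B$ (equivalently short exact sequences $0\to A\to B\to B/A\to 0$); a morphism $(A\subset B)\to(A'\subset B')$ is a homomorphism $f:B\to B'$ with $f(A)\subseteq A'$. $\mathrm{Aut}_{\mathcal S}$ denotes the automorphism group in $\mathcal S$. Diagrams. A partition $\lambda$ is drawn with its $i$-th column consisting of $\lambda_i$ boxes; rows are numbered $1,2,\dots$ from the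 top, so row $m$ has $\lambda'_m$ boxes. Klein tableaux. A Klein tableau $\Pi=[\gamma^0,\ldots,\gamma^e;\varphi^2,\ldots,\varphi^e]$ consists of partitions with $\gamma^{\ell-1}_i\le\gamma^\ell_i\le\gamma^{\ell-1}_i+1$ for all $1\le\ell\le e$ and all $i$, satisfying for all $2\le\ell\le e$ and $k\ge1$: $\sum_{i\ge k}(\gamma^\ell_i-\gamma^{\ell-1}_i)\le\sum_{i\ge k}(\gamma^{\ell-1}_i-\gamma^{\ell-2}_i)$; and of maps $\varphi^\ell$ ($2\le\ell\le e$) from the set of boxes of the skew diagram $\gamma^\ell\setminus\gamma^{\ell-1}$ to the positive integers such that: (i) $\varphi^\ell$ is weakly increasing from left to right within each row; (ii) if the box $b$ lies in row $m$ then $\varphi^\ell(b)<m$; (iii) if $b$ lies in row $m$ and the box directly above $b$ (row $m-1$, same column) belongs to $\gamma^{\ell-1}\setminus\gamma^{\ell-2}$, then $\varphi^\ell(b)=m-1$; (iv) for each $r$, the number of boxes $b$ with $\varphi^\ell(b)=r$ is at most the number of boxes of $\gamma^{\ell-1}\setminus\gamma^{\ell-2}$ in row $r$. Boxes of $\gamma^0$ are called empty, boxes of $\gamma^\ell\setminus\gamma^{\ell-1}$ are labelled $\ell$, and a box $b$ labelled $\ell\ge2$ with $\varphi^\ell(b)=r$ is a symbol $\ell_r$. The type of $\Pi$ is $(\alpha,\beta,\gamma)$ where $\beta=\gamma^e$, $\gamma=\gamma^0$ and $\alpha'_\ell=|\gamma^\ell\setminus\gamma^{\ell-1}|$ for $1\le\ell\le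 e$. Klein tableau of an embedding $E=(A\subset B)$, with $e$ the exponent of $A$: $\gamma^i=\mathrm{type}(B/p^iA)$, and $\varphi^\ell$ is the unique row-wise weakly increasing assignment such that for $r\ge1$ the number of boxes of $\gamma^\ell\setminus\gamma^{\ell-1}$ in row $m$ with subscript $r$ equals $(\gamma^{\ell,r})'_m-(\gamma^{\ell,r-1})'_m$, where $\gamma^{\ell,r}=\mathrm{type}\big(B/(p^\ell A+p(p^{\ell-2}A\cap p^rB))\big)$. This is a Klein tableau $\Pi(E)$, and every Klein tableau arises this way. Restrictions. For $u\le\ell$, $\Pi|_u^\ell=[\gamma^{\ell-u},\ldots,\gamma^\ell;\varphi^{\ell-u+2},\ldots,\varphi^\ell]$, regarded as a Klein tableau in which the stripe $\gamma^{\ell-u+j}\setminus\gamma^{\ell-u+j-1}$ is labelled $j$ (subscripts retained); here $\gamma^j:=\gamma^e$ for $j>e$ (with empty subscript functions for these stripes). For a Klein tableau $\Pi$ with $e\le2$, $E(\Pi;p)$ denotes the embedding of finite abelian $p$-groups with Klein tableau $\Pi$; it is unique up to isomorphism in $\mathcal S$. *)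

theory Defs
  imports "HOL-Algebra.Algebra" "HOL-Computational_Algebra.Primes"
begin

definition is_partition :: "nat list \<Rightarrow> bool" where
  "is_partition la \<longleftrightarrow> sorted_wrt (\<ge>) la \<and> 0 \<notin> set la"

definition part :: "nat list \<Rightarrow> nat \<Rightarrow> nat" where
  "part la i = (if 1 \<le> i \<and> i \<le> length la then la ! (i - 1) else 0)"

definition conjp :: "nat list \<Rightarrow> nat \<Rightarrow> nat" where
  "conjp la m = length (filter (\<lambda>x. m \<le> x) la)"

text \<open>Boxes of the skew diagram mu minus la: pairs (column i, row m), rows numbered
  from the top; column i of a partition consists of its boxes in rows 1..part i.\<close>

definition skew :: "nat list \<Rightarrow> nat list \<Rightarrow> (nat \<times> nat) set" where
  "skew mu la = {(i, m). 1 \<le> i \<and> part la i < m \<and> m \<le> part mu i}"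

definition Mgrp :: "nat \<Rightarrow> nat list \<Rightarrow> (nat \<Rightarrow> int) monoid" where
  "Mgrp p la = product_group {..<length la} (\<lambda>i. integer_mod_group (p ^ (la ! i)))"

definition grp_type :: "nat \<Rightarrow> ('a, 'b) monoid_scheme \<Rightarrow> nat list" where
  "grp_type p G = (THE la. is_partition la \<and> G \<cong> Mgrp p la)"

definition hall_number :: "nat \<Rightarrow> nat list \<Rightarrow> nat list \<Rightarrow> nat list \<Rightarrow> nat" where
  "hall_number p al be ga =
     card {U. subgroup U (Mgrp p be)
            \<and> (Mgrp p be)\<lparr>carrier := U\<rparr> \<cong> Mgrp p al
            \<and> (Mgrp p be Mod U) \<cong> Mgrp p ga}"

definition pmul :: "('a, 'b) monoid_scheme \<Rightarrow> nat \<Rightarrow> 'a set \<Rightarrow> 'a set" where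
  "pmul G k S = (\<lambda>a. a [^]\<^bsub>G\<^esub> k) ` S"

definition autS :: "('a, 'b) monoid_scheme \<Rightarrow> 'a set \<Rightarrow> ('a \<Rightarrow> 'a) set" where
  "autS B A = {f. f \<in> iso B B \<and> f \<in> extensional (carrier B) \<and> f ` A = A}"

text \<open>A tableau is a pair (gs, phs): gs = [gamma^0, ..., gamma^e] and
  phs = [phi^2, ..., phi^e]; phi^l is a function on boxes (column, row),
  required to vanish outside the stripe gamma^l minus gamma^(l-1).\<close>

type_synonym tableau = "nat list list \<times> (nat \<times> nat \<Rightarrow> nat) list"

definition tab_e :: "tableau \<Rightarrow> nat" where
  "tab_e T = length (fst T) - 1"

definition klein_tableau :: "tableau \<Rightarrow> bool" where
  "klein_tableau T \<longleftrightarrow>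
    (let gs = fst T; phs = snd T; e = length gs - 1 in
     gs \<noteq> [] \<and> length phs = e - 1 \<and> (\<forall>la\<in>set gs. is_partition la) \<and>
     (\<forall>l\<in>{1..e}. \<forall>i. part (gs ! (l - 1)) i \<le> part (gs ! l) i
                    \<and> part (gs ! l) i \<le> part (gs ! (l - 1)) i + 1) \<and>
     (\<forall>l\<in>{2..e}. \<forall>k\<ge>1.
        (\<Sum>i\<in>{k..length (gs ! e)}. int (part (gs ! l) i) - int (part (gs ! (l - 1)) i))
        \<le> (\<Sum>i\<in>{k..length (gs ! e)}. int (part (gs ! (l - 1)) i) - int (part (gs ! (l - 2)) i))) \<and>
     (\<forall>l\<in>{2..e}.
        let ph = phs ! (l - 2);
            S = skew (gs ! l) (gs ! (l - 1));
            Sp = skew (gs ! (l - 1)) (gs ! (l - 2)) in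
        (\<forall>b. b \<notin> S \<longrightarrow> ph b = 0) \<and>
        (\<forall>b\<in>S. 1 \<le> ph b) \<and>
        (\<forall>i j m. (i, m) \<in> S \<and> (j, m) \<in> S \<and> i < j \<longrightarrow> ph (i, m) \<le> ph (j, m)) \<and>
        (\<forall>i m. (i, m) \<in> S \<longrightarrow> ph (i, m) < m) \<and>
        (\<forall>i m. (i, m) \<in> S \<and> (i, m - 1) \<in> Sp \<longrightarrow> ph (i, m) = m - 1) \<and>
        (\<forall>r. card {b \<in> S. ph b = r} \<le> card {b \<in> Sp. snd b = r})))"

definition has_type :: "tableau \<Rightarrow> nat list \<Rightarrow> nat list \<Rightarrow> nat list \<Rightarrow> bool" where
  "has_type T al be ga \<longleftrightarrow> (let gs = fst T; e = length gs - 1 in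
     gs ! e = be \<and> gs ! 0 = ga \<and>
     (\<forall>l\<in>{1..e}. conjp al l = card (skew (gs ! l) (gs ! (l - 1)))))"

definition restr :: "tableau \<Rightarrow> nat \<Rightarrow> nat \<Rightarrow> tableau" where
  "restr T u l = (let gs = fst T; phs = snd T; e = length gs - 1;
       gx = (\<lambda>j. if j \<le> e then gs ! j else gs ! e);
       px = (\<lambda>j. if 2 \<le> j \<and> j \<le> e then phs ! (j - 2) else (\<lambda>_. 0)) in
     (map (\<lambda>j. gx (l - u + j)) [0..<u + 1], map (\<lambda>j. px (l - u + j)) [2..<u + 1]))"

text \<open>gamma^i = type(B / p^i A) for i = 0..n, where n is at least the exponent of A
  (so that trailing stripes are empty).\<close>

definition emb_gamma :: "nat \<Rightarrow> ('a, 'b) monoid_scheme \<Rightarrow> 'a set \<Rightarrow> nat \<Rightarrow> nat list" where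
  "emb_gamma p B A i = grp_type p (B Mod pmul B (p ^ i) A)"

definition emb_gamma2 :: "nat \<Rightarrow> ('a, 'b) monoid_scheme \<Rightarrow> 'a set \<Rightarrow> nat \<Rightarrow> nat \<Rightarrow> nat list" where
  "emb_gamma2 p B A l r = grp_type p
     (B Mod (pmul B (p ^ l) A <#>\<^bsub>B\<^esub>
             pmul B p (pmul B (p ^ (l - 2)) A \<inter> pmul B (p ^ r) (carrier B))))"

definition emb_phi :: "nat \<Rightarrow> ('a, 'b) monoid_scheme \<Rightarrow> 'a set \<Rightarrow> nat \<Rightarrow> nat \<times> nat \<Rightarrow> nat" where
  "emb_phi p B A l = (THE ph.
     let S = skew (emb_gamma p B A l) (emb_gamma p B A (l - 1)) in
     (\<forall>b. b \<notin> S \<longrightarrow> ph b = 0) \<and> (\<forall>b\<in>S. 1 \<le> ph b) \<and>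
     (\<forall>i j m. (i, m) \<in> S \<and> (j, m) \<in> S \<and> i < j \<longrightarrow> ph (i, m) \<le> ph (j, m)) \<and>
     (\<forall>m r. 1 \<le> m \<and> 1 \<le> r \<longrightarrow>
        int (card {b \<in> S. snd b = m \<and> ph b = r})
        = int (conjp (emb_gamma2 p B A l r) m) - int (conjp (emb_gamma2 p B A l (r - 1)) m)))"

definition emb_tableau :: "nat \<Rightarrow> nat \<Rightarrow> ('a, 'b) monoid_scheme \<Rightarrow> 'a set \<Rightarrow> tableau" where
  "emb_tableau p n B A =
     (map (emb_gamma p B A) [0..<n + 1], map (emb_phi p B A) [2..<n + 1])"

text \<open>#Aut_S E(Pi; p): the number of S-automorphisms of an embedding (A subset M(beta))
  whose Klein tableau is Pi (beta the last partition of Pi); well defined since such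
  embeddings are unique up to isomorphism in S.\<close>

definition E_aut :: "nat \<Rightarrow> tableau \<Rightarrow> nat" where
  "E_aut p T = (let B = Mgrp p (last (fst T));
                    A = (SOME A. subgroup A B \<and> emb_tableau p (tab_e T) B A = T) in
                card (autS B A))"

end

theory Submission
  imports Defs
begin

text \<open>
  Write \<open>B = M(\<beta>)\<close> and fix a Klein tableau. The subgroups \<open>U\<close> with this tableau are counted by choosing
  successively \<open>p\<^sup>e\<^sup>-\<^sup>1U, \<dots>, pU, U\<close>. Given \<open>Y = pX\<close>, the choices for \<open>X\<close> correspond by Nakayama's lemma
  to the subgroups \<open>X'\<close> of \<open>B/pY\<close> with \<open>pX' = Y/pY\<close>, and both \<open>X'\<close> and \<open>pX'\<close> have their tableaux
  prescribed: they are the two restrictions in the statement. Embeddings of subgroups killed by \<open>p\<^sup>2\<close>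
  are determined up to isomorphism by their tableau, so the automorphism group of \<open>B/pY\<close> acts
  transitively on the possible \<open>X'\<close> and on the possible \<open>pX'\<close>, and the number of \<open>X'\<close> over a given
  \<open>pX'\<close> is the quotient of the orders of the two stabilizers.

  For the uniqueness, the cardinalities of the groups \<open>A \<inter> p\<^sup>kB\<close> and \<open>p(A \<inter> p\<^sup>sB) \<inter> p\<^sup>kB\<close> are read off the
  tableau, and an isomorphism that respects all these subgroups is built upwards along the chain
  \<open>p\<^sup>rB\<close>. The same construction with \<open>A\<close> trivial classifies the finite abelian p-groups.
  Conversely, every tableau with two stripes is realized by a direct sum of embeddings of cyclic
  groups.
\<close>

section \<open>Subgroups of finite abelian p-groups\<close>

text \<open>The construction of isomorphisms rests on a count: if M, N and also pM, pN have equal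
  orders, then the socles of M and N have equal orders, and this lets a partial isomorphism grow one
  element at a time. So every subgroup adjoined on the way needs its order, and the order of its
  multiple by p, prescribed by the tableau. The groups p(A \<inter> p^s B) qualify because the types
  of the quotients by them are the very partitions that define the subscripts when p^2 A = 0.

  Existence of embeddings with two stripes enters in three ways. \<open>E_aut\<close> picks an
  embedding by \<open>SOME\<close> and is meaningful only for realized tableaux; the denominators
  must be positive; and the index set of the sum is shown to be finite by realizing each of its
  tableaux by a subgroup.

  The product runs up to l = e + 1 because the last factor, whose upper stripe is empty, counts the
  choices of p^(e-1) U over the trivial group p^e U.\<close>

definition plog :: "nat \<Rightarrow> 'a set \<Rightarrow> nat" where
  "plog p S = (THE n. card S = p ^ n)"

lemma plog_eqI: "Factorial_Ring.prime p \<Longrightarrow> card S = p ^ n \<Longrightarrow> plog p S = n"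
  unfolding plog_def using prime_gt_1_nat power_inject_exp by (intro the_equality) auto

lemma (in group_hom) card_subgroup_image:
  assumes "subgroup K G" "finite K"
  shows "card K = card (h ` K) * card {x \<in> K. h x = \<one>\<^bsub>H\<^esub>}"
proof -
  have "card {x \<in> K. h x = y} = card {x \<in> K. h x = \<one>\<^bsub>H\<^esub>}" if "y \<in> h ` K" for y
  proof -
    obtain z where z: "z \<in> K" "y = h z" using \<open>y \<in> h ` K\<close> by auto
    note zK = subgroup.mem_carrier[OF assms(1)] 
    have "bij_betw (\<lambda>x. x \<otimes> z) {x \<in> K. h x = \<one>\<^bsub>H\<^esub>} {x \<in> K. h x = y}"
    proof (rule bij_betw_byWitness[where f' = "\<lambda>x. x \<otimes> inv z"])
      show "\<forall>a\<in>{x \<in> K. h x = \<one>\<^bsub>H\<^esub>}. a \<otimes> z \<otimes> inv z = a"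
        using z zK by (simp add: G.m_assoc)
      show "\<forall>a\<in>{x \<in> K. h x = y}. a \<otimes> inv z \<otimes> z = a"
        using z zK by (simp add: G.m_assoc)
    qed (use z zK in \<open>auto simp: subgroup.m_closed[OF assms(1)] subgroup.m_inv_closed[OF assms(1)]\<close>)
    then show ?thesis by (simp add: bij_betw_same_card)
  qed
  then have "(\<Sum>y\<in>h ` K. card {x \<in> K. h x = y}) = card (h ` K) * card {x \<in> K. h x = \<one>\<^bsub>H\<^esub>}"
    by simp
  moreover have "card K = (\<Sum>y\<in>h ` K. card {x \<in> K. h x = y})"
    using assms(2) card_eq_sum[of K] sum.image_gen[OF assms(2), of "\<lambda>_. 1::nat" h] by simp
  ultimately show ?thesis by simp
qed

lemma (in group) subgroup_nat_pow_closed: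
  "subgroup H G \<Longrightarrow> x \<in> H \<Longrightarrow> x [^] (n::nat) \<in> H"
  by (induction n) (auto simp: subgroup.one_closed subgroup.m_closed)

lemma pmul_mono: "S \<subseteq> T \<Longrightarrow> pmul G n S \<subseteq> pmul G n T"
  unfolding pmul_def by auto

lemma (in group) pmul_subset: "subgroup H G \<Longrightarrow> pmul G n H \<subseteq> H"
  unfolding pmul_def using subgroup_nat_pow_closed by auto

lemma (in group) pmul_pmul: "S \<subseteq> carrier G \<Longrightarrow> pmul G m (pmul G n S) = pmul G (n * m) S"
  unfolding pmul_def image_image by (intro image_cong) (auto simp: nat_pow_pow)

lemma (in group) pmul_1 [simp]: "S \<subseteq> carrier G \<Longrightarrow> pmul G (Suc 0) S = S"
  unfolding pmul_def by (auto simp: image_iff subset_iff)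

lemma (in comm_group) pow_group_hom: "group_hom G G (\<lambda>x. x [^] (n::nat))"
  by unfold_locales (auto simp: hom_def nat_pow_distrib)

lemma (in comm_group) pmul_subgroup: "subgroup H G \<Longrightarrow> subgroup (pmul G n H) G"
  unfolding pmul_def using group_hom.subgroup_img_is_subgroup[OF pow_group_hom] .

lemma (in group_hom) image_pmul:
  "S \<subseteq> carrier G \<Longrightarrow> h ` pmul G n S = pmul H n (h ` S)"
  unfolding pmul_def image_image by (intro image_cong) (auto simp: hom_nat_pow)

lemma (in comm_group) pmul_set_mult:
  "S \<subseteq> carrier G \<Longrightarrow> T \<subseteq> carrier G \<Longrightarrow> pmul G n (S <#> T) = pmul G n S <#> pmul G n T"
  unfolding pmul_def using set_mult_hom[OF group_hom.homh[OF pow_group_hom]] by simp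

lemma (in group) set_mult_memI: "x \<in> S \<Longrightarrow> y \<in> T \<Longrightarrow> x \<otimes> y \<in> S <#> T"
  unfolding set_mult_def by auto

lemma (in group) set_mult_memE: "z \<in> S <#> T \<Longrightarrow> (\<And>x y. x \<in> S \<Longrightarrow> y \<in> T \<Longrightarrow> z = x \<otimes> y \<Longrightarrow> P) \<Longrightarrow> P"
  unfolding set_mult_def by auto

lemma (in group) set_mult_left_subset: "subgroup T G \<Longrightarrow> S \<subseteq> carrier G \<Longrightarrow> S \<subseteq> S <#> T"
  unfolding set_mult_def using subgroup.one_closed[of T G] by (force simp: subset_iff)

lemma (in group) set_mult_right_subset: "subgroup S G \<Longrightarrow> T \<subseteq> carrier G \<Longrightarrow> T \<subseteq> S <#> T"
  unfolding set_mult_def using subgroup.one_closed[of S G] by (force simp: subset_iff)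

lemma (in group) set_mult_least:
  "subgroup U G \<Longrightarrow> S \<subseteq> U \<Longrightarrow> T \<subseteq> U \<Longrightarrow> S <#> T \<subseteq> U"
  unfolding set_mult_def using subgroup.m_closed[of U G] by auto

lemma (in group) set_mult_absorb:
  assumes "subgroup U G" "subgroup S G" "S \<subseteq> U" shows "S <#> U = U" 
  using set_mult_least[OF assms(1,3) order_refl] set_mult_right_subset[OF assms(2)] subgroup.subset[OF assms(1)] by blast

locale fin_p_group = comm_group G for G (structure) +
  fixes p :: nat
  assumes prime: "Factorial_Ring.prime p"
    and finite_carrier: "finite (carrier G)"
    and order_power: "\<exists>n. order G = p ^ n"
begin

abbreviation "P k \<equiv> pmul G (p ^ k) (carrier G)"
abbreviation "lg H \<equiv> plog p H"

lemma finite_subgroup: "subgroup H G \<Longrightarrow> finite H"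
  using finite_subset[OF subgroup.subset finite_carrier] .

lemma card_subgroup: assumes "subgroup H G" shows "card H = p ^ lg H"
proof -
  obtain n where n: "order G = p ^ n" using order_power by auto
  have "card H dvd p ^ n" using lagrange[OF assms] n by (metis dvd_triv_right)
  then obtain i where "card H = p ^ i" using divides_primepow_nat[OF prime] by auto
  with plog_eqI[OF prime this] show ?thesis by simp
qed

lemma lg_mono: "subgroup H G \<Longrightarrow> subgroup K G \<Longrightarrow> H \<subseteq> K \<Longrightarrow> lg H \<le> lg K"
  using card_mono[OF finite_subgroup[of K], of H] prime_gt_1_nat[OF prime]
  by (simp add: card_subgroup)

lemma lg_eq_imp_eq: "subgroup H G \<Longrightarrow> subgroup K G \<Longrightarrow> H \<subseteq> K \<Longrightarrow> lg H = lg K \<Longrightarrow> H = K"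
  using card_subset_eq[OF finite_subgroup[of K], of H] by (simp add: card_subgroup)

lemma subgroup_P: "subgroup (P k) G"
  by (simp add: pmul_subgroup subgroup_self)

lemma P_0 [simp]: "P 0 = carrier G" by simp

lemma pmul_P: "pmul G p (P k) = P (Suc k)"
  by (simp add: pmul_pmul mult.commute)

lemma pmul_pow_Suc: "subgroup A G \<Longrightarrow> pmul G p (pmul G (p ^ k) A) = pmul G (p ^ Suc k) A"
  by (simp add: pmul_pmul mult.commute subgroup.subset)

lemma P_Suc_subset: "P (Suc k) \<subseteq> P k"
  using pmul_subset[OF subgroup_P, of p k] by (simp only: pmul_P)

lemma P_antimono: "j \<le> k \<Longrightarrow> P k \<subseteq> P j"
  using P_Suc_subset lift_Suc_antimono_le[of P] by blast

lemma pmul_order: "\<exists>n. \<forall>k\<ge>n. \<forall>H. subgroup H G \<longrightarrow> pmul G (p ^ k) H = {\<one>}"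
proof -
  obtain n where n: "order G = p ^ n" using order_power by auto
  have "x [^] (p ^ k) = \<one>" if "k \<ge> n" "x \<in> carrier G" for k x
  proof -
    have "p ^ k = order G * p ^ (k - n)" using n \<open>k \<ge> n\<close> by (simp add: power_add[symmetric])
    then show ?thesis using nat_pow_pow[OF \<open>x \<in> carrier G\<close>, of "order G" "p ^ (k - n)"] that(2)
        pow_order_eq_1[OF that(2)] by simp
  qed
  then have "pmul G (p ^ k) H = {\<one>}" if "k \<ge> n" "subgroup H G" for k H
    using that subgroup.one_closed[OF that(2)] subgroup.mem_carrier[OF that(2)] unfolding pmul_def
    by (auto simp: image_iff)
  then show ?thesis by blast
qed

lemma lg_one [simp]: "lg {\<one>} = 0"
  using plog_eqI[OF prime, of "{\<one>}" 0] by simp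

lemma lg_eq_0_iff: "subgroup H G \<Longrightarrow> lg H = 0 \<longleftrightarrow> H = {\<one>}"
  using lg_eq_imp_eq[OF triv_subgroup, of H] subgroup.one_closed[of H G] by auto

lemma subgroup_soc: "subgroup H G \<Longrightarrow> subgroup {x \<in> H. x [^] p = \<one>} G"
proof -
  assume H: "subgroup H G"
  have "subgroup (kernel G G (\<lambda>x. x [^] p)) G" by (rule group_hom.subgroup_kernel[OF pow_group_hom])
  moreover have "{x \<in> H. x [^] p = \<one>} = H \<inter> kernel G G (\<lambda>x. x [^] p)"
    using subgroup.subset[OF H] by (auto simp: kernel_def)
  ultimately show ?thesis using subgroups_Inter_pair[OF H] by simp
qed

text \<open>Multiplication by p maps H onto pH, and its kernel on H is the socle of H.\<close>

lemma lg_soc: assumes "subgroup H G" shows "lg H = lg (pmul G p H) + lg {x \<in> H. x [^] p = \<one>}"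
proof -
  have "card H = card (pmul G p H) * card {x \<in> H. x [^] p = \<one>}"
    unfolding pmul_def using group_hom.card_subgroup_image[OF pow_group_hom assms finite_subgroup[OF assms]] .
  also have "\<dots> = p ^ (lg (pmul G p H) + lg {x \<in> H. x [^] p = \<one>})"
    using card_subgroup[OF pmul_subgroup[OF assms]] card_subgroup[OF subgroup_soc[OF assms]]
    by (simp add: power_add)
  finally show ?thesis using plog_eqI[OF prime] by blast
qed

text \<open>The product map from the direct product of H and K onto HK has as kernel an antidiagonal
  copy of H \<inter> K.\<close>

lemma lg_set_mult: assumes H: "subgroup H G" and K: "subgroup K G"
  shows "lg (H <#> K) + lg (H \<inter> K) = lg H + lg K"
proof -
  have hom: "group_hom (G \<times>\<times> G) G (\<lambda>(x, y). x \<otimes> y)"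
  proof (intro group_hom.intro group_hom_axioms.intro)
    show "(\<lambda>(x, y). x \<otimes> y) \<in> hom (G \<times>\<times> G) G" by (auto simp: hom_def m_ac)
  qed (auto simp: DirProd_group is_group)
  have sub: "subgroup (H \<times> K) (G \<times>\<times> G)"
    using DirProd_subgroups[OF is_group H is_group K] .
  note Hc = subgroup.mem_carrier[OF H] and Kc = subgroup.mem_carrier[OF K]
  have "card (H \<times> K) = card ((\<lambda>(x, y). x \<otimes> y) ` (H \<times> K)) * card {z \<in> H \<times> K. (\<lambda>(x, y). x \<otimes> y) z = \<one>}"
    using group_hom.card_subgroup_image[OF hom sub] finite_subgroup[OF H] finite_subgroup[OF K] by simp
  moreover have "(\<lambda>(x, y). x \<otimes> y) ` (H \<times> K) = H <#> K" unfolding set_mult_def by auto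
  moreover have "card {z \<in> H \<times> K. (\<lambda>(x, y). x \<otimes> y) z = \<one>} = card (H \<inter> K)"
  proof -
    have "bij_betw (\<lambda>x. (x, inv x)) (H \<inter> K) {z \<in> H \<times> K. (\<lambda>(x, y). x \<otimes> y) z = \<one>}"
    proof (rule bij_betw_byWitness[where f' = fst])
      have inv_b: "inv a = b" if "a \<in> H" "b \<in> K" "a \<otimes> b = \<one>" for a b
        using that Hc[of a] Kc[of b] m_comm[of a b] inv_equality[of b a] by simp
      show "\<forall>a\<in>{z \<in> H \<times> K. (case z of (x, y) \<Rightarrow> x \<otimes> y) = \<one>}. (fst a, inv fst a) = a"
        using inv_b by auto
      show "(\<lambda>x. (x, inv x)) ` (H \<inter> K) \<subseteq> {z \<in> H \<times> K. (case z of (x, y) \<Rightarrow> x \<otimes> y) = \<one>}"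
        using Hc subgroup.m_inv_closed[OF K] by auto
      have "a \<in> K" if "a \<in> H" "b \<in> K" "a \<otimes> b = \<one>" for a b
        using inv_b[OF that] subgroup.m_inv_closed[OF K that(2)] inv_inv[OF Hc[OF that(1)]] by simp
      then show "fst ` {z \<in> H \<times> K. (case z of (x, y) \<Rightarrow> x \<otimes> y) = \<one>} \<subseteq> H \<inter> K" by auto
    qed auto
    then show ?thesis by (simp add: bij_betw_same_card)
  qed
  ultimately have "card (H <#> K) * card (H \<inter> K) = card H * card K"
    by (metis card_cartesian_product)
  then have "p ^ (lg (H <#> K) + lg (H \<inter> K)) = p ^ (lg H + lg K)"
    using card_subgroup[OF H] card_subgroup[OF K] card_subgroup[OF mult_subgroups[OF H K]]
      card_subgroup[OF subgroups_Inter_pair[OF H K]] by (simp add: power_add)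
  then show ?thesis using prime_gt_1_nat[OF prime] power_inject_exp[of p] by simp
qed

text \<open>The socle of H lies in that of K, so by \<open>lg_soc\<close> the index of pH in pK is
  at most the index of H in K. The inequalities \<open>conjp_qt_interlace\<close>,
  \<open>conjp_hW_le\<close> and \<open>lg_hW_le\<close>, and the monotonicity of the row lengths in
  \<open>ex_type\<close>, are instances of this for suitable H.\<close>

lemma lg_pmul_le:
  assumes H: "subgroup H G" and K: "subgroup K G" and "H \<subseteq> K"
  shows "lg (pmul G p K) + lg H \<le> lg K + lg (pmul G p H)"
proof -
  have "lg {x \<in> H. x [^] p = \<one>} \<le> lg {x \<in> K. x [^] p = \<one>}"
    using lg_mono[OF subgroup_soc[OF H] subgroup_soc[OF K]] \<open>H \<subseteq> K\<close> by blast
  then show ?thesis using lg_soc[OF H] lg_soc[OF K] by linarith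
qed

text \<open>Substituting Y = M + pY into itself gives Y = M + p^k Y for every k, and p^k Y is
  trivial for large k.\<close>

lemma nakayama:
  assumes M: "subgroup M G" and Y: "subgroup Y G" and eq: "M <#> pmul G p Y = Y"
  shows "M = Y"
proof -
  have "M <#> pmul G (p ^ k) Y = Y" for k
  proof (induction k)
    case 0
    have "M \<subseteq> Y" using set_mult_left_subset[OF pmul_subgroup[OF Y]] subgroup.subset[OF M] eq by blast
    then show ?case using set_mult_absorb[OF Y M] subgroup.subset[OF Y] by simp
  next
    case (Suc k)
    have c: "M \<subseteq> carrier G" "Y \<subseteq> carrier G" using M Y subgroup.subset by auto
    have c': "pmul G n M \<subseteq> carrier G" "pmul G n Y \<subseteq> carrier G" for n
      using pmul_subgroup M Y subgroup.subset by blast+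
    have "Y = M <#> pmul G p (M <#> pmul G (p ^ k) Y)" using eq Suc by simp
    also have "\<dots> = (M <#> pmul G p M) <#> pmul G (p ^ Suc k) Y"
      using c c' by (simp only: pmul_set_mult set_mult_assoc pmul_pow_Suc[OF Y])
    also have "M <#> pmul G p M = M"
      by (intro equalityI set_mult_left_subset[OF pmul_subgroup[OF M] c(1)] set_mult_least[OF M order_refl pmul_subset[OF M]])
    finally show ?case by simp
  qed
  moreover obtain n where "\<forall>k\<ge>n. \<forall>H. subgroup H G \<longrightarrow> pmul G (p ^ k) H = {\<one>}"
    using pmul_order by blast
  then have "pmul G (p ^ n) Y = {\<one>}" using Y by blast
  ultimately have "M <#> {\<one>} = Y" by metis
  moreover have "M <#> {\<one>} = M"
    using set_mult_least[OF M order_refl, of "{\<one>}"] subgroup.one_closed[OF M]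
      set_mult_left_subset[OF triv_subgroup subgroup.subset[OF M]] by (intro equalityI) auto
  ultimately show ?thesis by simp
qed

end

section \<open>Extending isomorphisms between subgroups\<close>

lemma (in group) subgroup_mult_right_cancel:
  assumes "subgroup Z G" "a \<in> carrier G" "b \<in> Z" shows "a \<otimes> b \<in> Z \<longleftrightarrow> a \<in> Z"
proof
  assume "a \<otimes> b \<in> Z"
  then have "a \<otimes> b \<otimes> inv b \<in> Z" using assms subgroup.m_closed subgroup.m_inv_closed by metis
  moreover have "a \<otimes> b \<otimes> inv b = a" using assms subgroup.mem_carrier[OF assms(1,3)] by (simp add: m_assoc)
  ultimately show "a \<in> Z" by simp
qed (use assms subgroup.m_closed in metis)

lemma comm_group_DirProd: 
  assumes "comm_group G" "comm_group H" shows "comm_group (G \<times>\<times> H)"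
proof -
  interpret G: comm_group G by fact
  interpret H: comm_group H by fact
  show ?thesis by (rule group.group_comm_groupI[OF DirProd_group]) (auto simp: G.m_comm H.m_comm G.is_group H.is_group)
qed

locale fin_p_group_pair = G: fin_p_group G p + H: fin_p_group H p for G (structure) and H (structure) and p
begin

text \<open>Isomorphisms between subgroups of \<open>G\<close> and \<open>H\<close> are represented by their graphs: extending
  an isomorphism by one element then amounts to a product of two subgroups of \<open>G \<times>\<times> H\<close>.\<close>

definition pgraph :: "('a \<times> 'c) set \<Rightarrow> bool" where
  "pgraph R \<longleftrightarrow> subgroup R (G \<times>\<times> H) \<and> (\<forall>(x, y)\<in>R. x = \<one>\<^bsub>G\<^esub> \<longleftrightarrow> y = \<one>\<^bsub>H\<^esub>)"

text \<open>The condition is two-sided, so the partial isomorphism maps the part of Z in its domain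
  onto the part of Z' in its range. A one-sided condition would not survive the comparison of
  orders.\<close>

definition resp :: "('a \<times> 'c) set \<Rightarrow> 'a set \<Rightarrow> 'c set \<Rightarrow> bool" where
  "resp R Z Z' \<longleftrightarrow> (\<forall>(x, y)\<in>R. x \<in> Z \<longleftrightarrow> y \<in> Z')"

sublocale D: comm_group "G \<times>\<times> H"
  by (intro comm_group_DirProd G.comm_group_axioms H.comm_group_axioms)

sublocale fst: group_hom "G \<times>\<times> H" G fst
  by unfold_locales (auto simp: hom_def)

sublocale snd: group_hom "G \<times>\<times> H" H snd
  by unfold_locales (auto simp: hom_def)

lemma pgraph_fst_eq:
  assumes "pgraph R" "(a, b) \<in> R" "(a, c) \<in> R" shows "b = c"
proof -
  have R: "subgroup R (G \<times>\<times> H)" using assms(1) pgraph_def by simp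
  have c: "a \<in> carrier G" "b \<in> carrier H" "c \<in> carrier H" using subgroup.mem_carrier[OF R] assms by auto
  have "(a, b) \<otimes>\<^bsub>G \<times>\<times> H\<^esub> inv\<^bsub>G \<times>\<times> H\<^esub> (a, c) \<in> R"
    using assms R subgroup.m_closed subgroup.m_inv_closed by metis
  then have "(\<one>\<^bsub>G\<^esub>, b \<otimes>\<^bsub>H\<^esub> inv\<^bsub>H\<^esub> c) \<in> R" using c by (simp add: inv_DirProd G.is_group H.is_group)
  then have "b \<otimes>\<^bsub>H\<^esub> inv\<^bsub>H\<^esub> c = \<one>\<^bsub>H\<^esub>" using assms(1) unfolding pgraph_def by auto
  then show ?thesis using c H.inv_solve_right[of "\<one>\<^bsub>H\<^esub>" b c] by simp
qed

lemma pgraph_snd_eq: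
  assumes "pgraph R" "(b, a) \<in> R" "(c, a) \<in> R" shows "b = c"
proof -
  have R: "subgroup R (G \<times>\<times> H)" using assms(1) pgraph_def by simp
  have c: "a \<in> carrier H" "b \<in> carrier G" "c \<in> carrier G" using subgroup.mem_carrier[OF R] assms by auto
  have "(b, a) \<otimes>\<^bsub>G \<times>\<times> H\<^esub> inv\<^bsub>G \<times>\<times> H\<^esub> (c, a) \<in> R"
    using assms R subgroup.m_closed subgroup.m_inv_closed by metis
  then have "(b \<otimes>\<^bsub>G\<^esub> inv\<^bsub>G\<^esub> c, \<one>\<^bsub>H\<^esub>) \<in> R" using c by (simp add: inv_DirProd G.is_group H.is_group)
  then have "b \<otimes>\<^bsub>G\<^esub> inv\<^bsub>G\<^esub> c = \<one>\<^bsub>G\<^esub>" using assms(1) unfolding pgraph_def by auto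
  then show ?thesis using c G.inv_solve_right[of "\<one>\<^bsub>G\<^esub>" b c] by simp
qed

text \<open>As x^p lies in the domain and x does not, a power of x lies in the domain exactly if its
  exponent is divisible by p; the same holds for y and the range. So a pair (s x^k, t y^k) with one
  trivial entry already belongs to R. If x is in Z, then s x^k is in Z exactly if s is, which gives
  the final clause about Z and Z'.\<close>

lemma pgraph_adjoin:
  assumes R: "pgraph R" and x: "x \<in> carrier G" "x \<notin> fst ` R" and y: "y \<in> carrier H" "y \<notin> snd ` R"
    and xy: "(x [^]\<^bsub>G\<^esub> p, y [^]\<^bsub>H\<^esub> p) \<in> R"
  shows "\<exists>R'. pgraph R' \<and> R \<subseteq> R' \<and> (x, y) \<in> R' \<and> 
    (\<forall>Z Z'. subgroup Z G \<longrightarrow> subgroup Z' H \<longrightarrow> x \<in> Z \<longrightarrow> y \<in> Z' \<longrightarrow>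
      (resp R Z Z' \<longrightarrow> resp R' Z Z') \<and> (R \<subseteq> Z \<times> Z' \<longrightarrow> R' \<subseteq> Z \<times> Z'))"
proof -
  let ?D = "G \<times>\<times> H"
  have sR: "subgroup R ?D" using R pgraph_def by simp
  have z: "(x, y) \<in> carrier ?D" using x y by simp
  have pw: "(x, y) [^]\<^bsub>?D\<^esub> k = (x [^]\<^bsub>G\<^esub> k, y [^]\<^bsub>H\<^esub> k)" for k :: int
    using fst.hom_int_pow[OF z, of k] snd.hom_int_pow[OF z, of k] by (simp add: prod_eq_iff)
  define R' where "R' = R <#>\<^bsub>?D\<^esub> generate ?D {(x, y)}"
  have gen: "subgroup (generate ?D {(x, y)}) ?D" using z by (intro D.generate_is_subgroup) auto
  have sR': "subgroup R' ?D" unfolding R'_def by (rule D.mult_subgroups[OF sR gen])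
  have RR': "R \<subseteq> R'" unfolding R'_def by (rule D.set_mult_left_subset[OF gen subgroup.subset[OF sR]])
  have xyR': "(x, y) \<in> R'" unfolding R'_def
    using D.set_mult_right_subset[OF sR subgroup.subset[OF gen]] generate.incl[of "(x, y)" "{(x, y)}" ?D] by blast
  have mem: "\<exists>s t. \<exists>k::int. (s, t) \<in> R \<and> u = s \<otimes>\<^bsub>G\<^esub> x [^]\<^bsub>G\<^esub> k \<and> v = t \<otimes>\<^bsub>H\<^esub> y [^]\<^bsub>H\<^esub> k" if "(u, v) \<in> R'" for u v
  proof -
    from that have "(u, v) \<in> R <#>\<^bsub>?D\<^esub> generate ?D {(x, y)}" unfolding R'_def .
    then obtain r g where rg: "r \<in> R" "g \<in> generate ?D {(x, y)}" "(u, v) = r \<otimes>\<^bsub>?D\<^esub> g"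
      by (rule D.set_mult_memE)
    then obtain k :: int where "g = (x, y) [^]\<^bsub>?D\<^esub> k" using D.generate_pow[OF z] by auto
    with rg pw show ?thesis by (cases r) auto
  qed
  \<comment> \<open>If k were prime to p, Bezout would write x as a product of a power of x^p and a
    power of x^k, and put x into the domain; likewise for y and the range.\<close>
  have pdvd: "int p dvd k" if "x [^]\<^bsub>G\<^esub> (k::int) \<in> fst ` R \<or> y [^]\<^bsub>H\<^esub> k \<in> snd ` R" for k
  proof (rule ccontr)
    assume "\<not> int p dvd k"
    then have "coprime (int p) k" using G.prime by (simp add: prime_imp_coprime)
    then obtain a b where ab: "a * int p + b * k = 1" by (metis bezout_int coprime_iff_gcd_eq_1)
    have f: "subgroup (fst ` R) G" "subgroup (snd ` R) H" 
      using fst.subgroup_img_is_subgroup[OF sR] snd.subgroup_img_is_subgroup[OF sR] by auto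
    have "x [^]\<^bsub>G\<^esub> p \<in> fst ` R" "y [^]\<^bsub>H\<^esub> p \<in> snd ` R" using xy by force+
    then have p': "x [^]\<^bsub>G\<^esub> int p \<in> fst ` R" "y [^]\<^bsub>H\<^esub> int p \<in> snd ` R" by (simp_all add: int_pow_int)
    have "x = (x [^]\<^bsub>G\<^esub> int p) [^]\<^bsub>G\<^esub> a \<otimes>\<^bsub>G\<^esub> (x [^]\<^bsub>G\<^esub> k) [^]\<^bsub>G\<^esub> b"
      using x ab by (simp add: G.int_pow_pow G.int_pow_mult[symmetric] mult.commute)
    moreover have "y = (y [^]\<^bsub>H\<^esub> int p) [^]\<^bsub>H\<^esub> a \<otimes>\<^bsub>H\<^esub> (y [^]\<^bsub>H\<^esub> k) [^]\<^bsub>H\<^esub> b"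
      using y ab by (simp add: H.int_pow_pow H.int_pow_mult[symmetric] mult.commute)
    ultimately show False
      using that p' f x(2) y(2) G.subgroup_int_pow_closed[OF f(1)] H.subgroup_int_pow_closed[OF f(2)]
        subgroup.m_closed[OF f(1)] subgroup.m_closed[OF f(2)] by metis
  qed
  have inR: "(x [^]\<^bsub>G\<^esub> k, y [^]\<^bsub>H\<^esub> k) \<in> R" if pk: "int p dvd k" for k :: int
  proof -
    obtain j where j: "k = int p * j" using pk by auto
    have "(x, y) [^]\<^bsub>?D\<^esub> int p \<in> R"
      using xy pw[of "int p"] by (simp add: int_pow_int)
    then have "((x, y) [^]\<^bsub>?D\<^esub> int p) [^]\<^bsub>?D\<^esub> j \<in> R" by (rule D.subgroup_int_pow_closed[OF sR])
    then show ?thesis unfolding j pw[symmetric] D.int_pow_pow[OF z] .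
  qed
  have one: "u = \<one>\<^bsub>G\<^esub> \<longleftrightarrow> v = \<one>\<^bsub>H\<^esub>" if uv: "(u, v) \<in> R'" for u v
  proof -
    obtain s t and k :: int where stk: "(s, t) \<in> R" "u = s \<otimes>\<^bsub>G\<^esub> x [^]\<^bsub>G\<^esub> k" "v = t \<otimes>\<^bsub>H\<^esub> y [^]\<^bsub>H\<^esub> k"
      using mem[OF uv] by blast
    have c: "s \<in> carrier G" "t \<in> carrier H" using subgroup.mem_carrier[OF sR stk(1)] by auto
    have i: "(inv\<^bsub>G\<^esub> s, inv\<^bsub>H\<^esub> t) \<in> R"
      using subgroup.m_inv_closed[OF sR stk(1)] c by (simp add: inv_DirProd G.is_group H.is_group)
    have "int p dvd k" if "u = \<one>\<^bsub>G\<^esub> \<or> v = \<one>\<^bsub>H\<^esub>"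
    proof -
      have "x [^]\<^bsub>G\<^esub> k = inv\<^bsub>G\<^esub> s \<or> y [^]\<^bsub>H\<^esub> k = inv\<^bsub>H\<^esub> t"
        using that stk c x y by (metis G.inv_equality G.inv_inv G.int_pow_closed G.m_comm H.inv_equality H.inv_inv H.int_pow_closed H.m_comm)
      then show ?thesis using i by (intro pdvd) force
    qed
    moreover have "u = \<one>\<^bsub>G\<^esub> \<longleftrightarrow> v = \<one>\<^bsub>H\<^esub>" if "int p dvd k"
    proof -
      have "(u, v) \<in> R" using subgroup.m_closed[OF sR stk(1) inR[OF that]] stk by simp
      then show ?thesis using R unfolding pgraph_def by auto
    qed
    ultimately show ?thesis by blast
  qed
  have "pgraph R'" unfolding pgraph_def using sR' one by auto
  moreover have "(resp R Z Z' \<longrightarrow> resp R' Z Z') \<and> (R \<subseteq> Z \<times> Z' \<longrightarrow> R' \<subseteq> Z \<times> Z')"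
    if Z: "subgroup Z G" "subgroup Z' H" "x \<in> Z" "y \<in> Z'" for Z Z'
  proof -
    have pow: "x [^]\<^bsub>G\<^esub> k \<in> Z" "y [^]\<^bsub>H\<^esub> k \<in> Z'" for k :: int
      using Z G.subgroup_int_pow_closed H.subgroup_int_pow_closed by auto
    have "(u \<in> Z \<longleftrightarrow> fst r \<in> Z) \<and> (v \<in> Z' \<longleftrightarrow> snd r \<in> Z')"
      if "r \<in> R" "u = fst r \<otimes>\<^bsub>G\<^esub> x [^]\<^bsub>G\<^esub> k" "v = snd r \<otimes>\<^bsub>H\<^esub> y [^]\<^bsub>H\<^esub> k" for u v r and k :: int
      using G.subgroup_mult_right_cancel[OF Z(1) _ pow(1)] H.subgroup_mult_right_cancel[OF Z(2) _ pow(2)]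
        that subgroup.mem_carrier[OF sR that(1)] by auto
    then have *: "\<exists>r\<in>R. (u \<in> Z \<longleftrightarrow> fst r \<in> Z) \<and> (v \<in> Z' \<longleftrightarrow> snd r \<in> Z')" if "(u, v) \<in> R'" for u v
      using mem[OF that] by (metis fst_conv snd_conv)
    show ?thesis unfolding resp_def
      using * by (fastforce simp: case_prod_beta)
  qed
  ultimately show ?thesis using RR' xyR' by blast
qed

text \<open>Above M the relation is the graph of an injection of M into N, and equal cardinalities
  make it onto.\<close>

lemma pgraph_fst_image_iff:
  assumes "pgraph R" "resp R M N" "subgroup M G" "subgroup N H" "card M = card N"
    and "M \<subseteq> fst ` R"
  shows "N \<subseteq> snd ` R"
proof -
  define R0 where "R0 = {r \<in> R. fst r \<in> M}"
  have "inj_on fst R0" "inj_on snd R0"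
    unfolding R0_def inj_on_def using pgraph_fst_eq[OF assms(1)] pgraph_snd_eq[OF assms(1)] by auto
  moreover have "fst ` R0 = M" unfolding R0_def using assms(6) by force
  moreover have "snd ` R0 \<subseteq> N" unfolding R0_def using assms(2) by (auto simp: resp_def)
  ultimately have "snd ` R0 = N"
    using card_subset_eq[OF H.finite_subgroup[OF assms(4)], of "snd ` R0"] assms(5) card_image by metis
  then show ?thesis unfolding R0_def by auto
qed

text \<open>If an element \<open>x\<close> of \<open>M\<close> is not yet in the domain and a candidate image \<open>y\<close> is already taken,
  then \<open>y\<close> can be moved by an element of the socle of \<open>N\<close>: the socles of \<open>M\<close> and \<open>N\<close> have the same
  size, so the one of \<open>N\<close> cannot be contained in the range.\<close>

lemma pgraph_extend:
  assumes "pgraph R" "resp R M N" "subgroup M G" "subgroup N H" "card M = card N"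
    and "card (pmul G p M) = card (pmul H p N)"
    and "\<forall>x\<in>M. \<exists>y\<in>N. (x [^]\<^bsub>G\<^esub> p, y [^]\<^bsub>H\<^esub> p) \<in> R"
  shows "\<exists>R'. pgraph R' \<and> R \<subseteq> R' \<and> M \<subseteq> fst ` R' \<and> N \<subseteq> snd ` R' \<and>
    (\<forall>Z Z'. subgroup Z G \<longrightarrow> subgroup Z' H \<longrightarrow> M \<subseteq> Z \<longrightarrow> N \<subseteq> Z' \<longrightarrow>
      (resp R Z Z' \<longrightarrow> resp R' Z Z') \<and> (R \<subseteq> Z \<times> Z' \<longrightarrow> R' \<subseteq> Z \<times> Z'))"
  using assms
proof (induction "card (M - fst ` R)" arbitrary: R rule: less_induct)
  case less
  show ?case
  proof (cases "M \<subseteq> fst ` R")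
    case True
    then show ?thesis using pgraph_fst_image_iff[OF less.prems(1-5)] less.prems(1) by blast
  next
    case False
    then obtain x where x: "x \<in> M" "x \<notin> fst ` R" by blast
    have R: "subgroup R (G \<times>\<times> H)" using less.prems(1) pgraph_def by simp
    note Mc = subgroup.mem_carrier[OF less.prems(3)] and Nc = subgroup.mem_carrier[OF less.prems(4)]
    obtain y where y: "y \<in> N" "(x [^]\<^bsub>G\<^esub> p, y [^]\<^bsub>H\<^esub> p) \<in> R" using less.prems(7) x by blast
    obtain y' where y': "y' \<in> N" "y' \<notin> snd ` R" "(x [^]\<^bsub>G\<^esub> p, y' [^]\<^bsub>H\<^esub> p) \<in> R"
    proof (cases "y \<in> snd ` R")
      case True
      then obtain z where z: "(z, y) \<in> R" by auto
      then have zM: "z \<in> M" using less.prems(2) y by (auto simp: resp_def)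
      have "(z [^]\<^bsub>G\<^esub> p, y [^]\<^bsub>H\<^esub> p) \<in> R"
        using D.subgroup_nat_pow_closed[OF R z, of p]
          fst.hom_nat_pow[of "(z, y)" p] snd.hom_nat_pow[of "(z, y)" p] Mc[OF zM] Nc[OF y(1)]
        by (metis (no_types, lifting) carrier_DirProd fst_conv mem_Sigma_iff prod.collapse snd_conv)
      then have zx: "z [^]\<^bsub>G\<^esub> p = x [^]\<^bsub>G\<^esub> p" using pgraph_snd_eq[OF less.prems(1)] y by blast
      define socM where "socM = {u \<in> M. u [^]\<^bsub>G\<^esub> p = \<one>\<^bsub>G\<^esub>}"
      define socN where "socN = {v \<in> N. v [^]\<^bsub>H\<^esub> p = \<one>\<^bsub>H\<^esub>}"
      have fin: "finite socM" unfolding socM_def using G.finite_subgroup[OF less.prems(3)] by simp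
      have "card M = card (pmul G p M) * card socM"
        unfolding pmul_def socM_def
        using group_hom.card_subgroup_image[OF G.pow_group_hom less.prems(3) G.finite_subgroup[OF less.prems(3)]] .
      moreover have "card N = card (pmul H p N) * card socN"
        unfolding pmul_def socN_def
        using group_hom.card_subgroup_image[OF H.pow_group_hom less.prems(4) H.finite_subgroup[OF less.prems(4)]] .
      moreover have "card M \<noteq> 0" using G.finite_subgroup[OF less.prems(3)] x(1) by auto
      ultimately have cs: "card socM = card socN" using less.prems(5,6) by auto
      \<comment> \<open>Otherwise the preimages of the socle of N would, by counting, exhaust the
        socle of M. That socle contains the quotient of x by z, since both have the same p-th power,
        and z is in the domain; so x would be in the domain too.\<close>
      have "\<not> socN \<subseteq> snd ` R"
      proof
        assume sub: "socN \<subseteq> snd ` R"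
        define R0 where "R0 = {r \<in> R. snd r \<in> socN}"
        have img: "snd ` R0 = socN" unfolding R0_def using sub by force
        have inj: "inj_on fst R0" "inj_on snd R0"
          unfolding R0_def inj_on_def using pgraph_fst_eq[OF less.prems(1)] pgraph_snd_eq[OF less.prems(1)] by auto
        have "u \<in> socM" if uv: "(u, v) \<in> R0" for u v
        proof -
          have v: "v \<in> N" "v [^]\<^bsub>H\<^esub> p = \<one>\<^bsub>H\<^esub>" "(u, v) \<in> R" using uv unfolding R0_def socN_def by auto
          then have u: "u \<in> M" using less.prems(2) by (auto simp: resp_def)
          have "(u, v) [^]\<^bsub>G \<times>\<times> H\<^esub> p = (u [^]\<^bsub>G\<^esub> p, v [^]\<^bsub>H\<^esub> p)"
            using fst.hom_nat_pow[of "(u, v)" p] snd.hom_nat_pow[of "(u, v)" p] Mc[OF u] Nc[OF v(1)]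
            by (simp add: prod_eq_iff)
          then have "(u [^]\<^bsub>G\<^esub> p, v [^]\<^bsub>H\<^esub> p) \<in> R" using D.subgroup_nat_pow_closed[OF R v(3), of p] by simp
          then show ?thesis using less.prems(1) u v(2) unfolding pgraph_def socM_def by auto
        qed
        then have "fst ` R0 \<subseteq> socM" by auto
        moreover have "card (fst ` R0) = card socM" using cs img inj card_image by metis
        ultimately have "fst ` R0 = socM" using card_subset_eq[OF fin] by blast
        moreover have "x \<otimes>\<^bsub>G\<^esub> inv\<^bsub>G\<^esub> z \<in> socM"
          using x(1) zM zx Mc[OF x(1)] Mc[OF zM] subgroup.m_closed[OF less.prems(3)] subgroup.m_inv_closed[OF less.prems(3)]
          unfolding socM_def by (simp add: G.nat_pow_distrib G.nat_pow_inv)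
        ultimately have "x \<otimes>\<^bsub>G\<^esub> inv\<^bsub>G\<^esub> z \<in> fst ` R" unfolding R0_def by auto
        moreover have "z \<in> fst ` R" using z by force
        ultimately have "x \<otimes>\<^bsub>G\<^esub> inv\<^bsub>G\<^esub> z \<otimes>\<^bsub>G\<^esub> z \<in> fst ` R"
          using subgroup.m_closed[OF fst.subgroup_img_is_subgroup[OF R]] by blast
        then show False using x Mc[OF x(1)] Mc[OF zM] by (simp add: G.m_assoc)
      qed
      then obtain w where w: "w \<in> N" "w [^]\<^bsub>H\<^esub> p = \<one>\<^bsub>H\<^esub>" "w \<notin> snd ` R" unfolding socN_def by blast
      have "y \<otimes>\<^bsub>H\<^esub> w \<notin> snd ` R"
      proof
        assume "y \<otimes>\<^bsub>H\<^esub> w \<in> snd ` R"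
        then have "w \<otimes>\<^bsub>H\<^esub> y \<in> snd ` R" using H.m_comm[OF Nc[OF y(1)] Nc[OF w(1)]] by simp
        then show False
          using H.subgroup_mult_right_cancel[OF snd.subgroup_img_is_subgroup[OF R] Nc[OF w(1)] True] w by simp
      qed
      moreover have "(y \<otimes>\<^bsub>H\<^esub> w) [^]\<^bsub>H\<^esub> p = y [^]\<^bsub>H\<^esub> p" using w y Nc by (simp add: H.nat_pow_distrib)
      ultimately show ?thesis using that[of "y \<otimes>\<^bsub>H\<^esub> w"] y w subgroup.m_closed[OF less.prems(4)] by simp
    next
      case False
      then show ?thesis using that y by blast
    qed
    obtain R1 where R1: "pgraph R1" "R \<subseteq> R1" "(x, y') \<in> R1"
      and R1Z: "\<And>Z Z'. subgroup Z G \<Longrightarrow> subgroup Z' H \<Longrightarrow> x \<in> Z \<Longrightarrow> y' \<in> Z' \<Longrightarrow>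
        (resp R Z Z' \<longrightarrow> resp R1 Z Z') \<and> (R \<subseteq> Z \<times> Z' \<longrightarrow> R1 \<subseteq> Z \<times> Z')"
      using pgraph_adjoin[OF less.prems(1) Mc[OF x(1)] x(2) Nc[OF y'(1)] y'(2,3)] by blast
    have "M - fst ` R1 \<subset> M - fst ` R" using x R1 by force
    then have "card (M - fst ` R1) < card (M - fst ` R)"
      using G.finite_subgroup[OF less.prems(3)] by (intro psubset_card_mono) auto
    moreover have "resp R1 M N" using R1Z[OF less.prems(3,4) x(1) y'(1)] less.prems(2) by blast
    moreover have "\<forall>x\<in>M. \<exists>y\<in>N. (x [^]\<^bsub>G\<^esub> p, y [^]\<^bsub>H\<^esub> p) \<in> R1" using less.prems(7) R1(2) by blast
    ultimately obtain R2 where R2: "pgraph R2" "R1 \<subseteq> R2" "M \<subseteq> fst ` R2" "N \<subseteq> snd ` R2" and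
      R2Z: "\<And>Z Z'. subgroup Z G \<Longrightarrow> subgroup Z' H \<Longrightarrow> M \<subseteq> Z \<Longrightarrow> N \<subseteq> Z' \<Longrightarrow>
        (resp R1 Z Z' \<longrightarrow> resp R2 Z Z') \<and> (R1 \<subseteq> Z \<times> Z' \<longrightarrow> R2 \<subseteq> Z \<times> Z')"
      using less.hyps[OF _ R1(1) _ less.prems(3-6)] by blast
    have "R \<subseteq> R2" using R1 R2 by blast
    moreover have "(resp R Z Z' \<longrightarrow> resp R2 Z Z') \<and> (R \<subseteq> Z \<times> Z' \<longrightarrow> R2 \<subseteq> Z \<times> Z')"
      if "subgroup Z G" "subgroup Z' H" "M \<subseteq> Z" "N \<subseteq> Z'" for Z Z'
    proof -
      have "x \<in> Z" "y' \<in> Z'" using that x y' by auto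
      then show ?thesis using R1Z[OF that(1,2)] R2Z[OF that] by blast
    qed
    ultimately show ?thesis using R2(1,3,4) by blast
  qed
qed

text \<open>If the parts of Z and Z' inside U and U' are already covered by R, then an extension
  that stays in the product of U and U' adds no pair with an entry in Z or Z'. In
  \<open>ex_iso_mapping\<close> this handles the subgroups too small to contain the newly adjoined
  one.\<close>

lemma resp_persist:
  assumes "pgraph R'" "R \<subseteq> R'" "R' \<subseteq> U \<times> U'" "Z \<inter> U \<subseteq> fst ` R" "Z' \<inter> U' \<subseteq> snd ` R" "resp R Z Z'"
  shows "resp R' Z Z'"
  unfolding resp_def
proof (clarify, intro iffI)
  fix a b assume ab: "(a, b) \<in> R'"
  show "b \<in> Z'" if aZ: "a \<in> Z"
  proof -
    have "a \<in> fst ` R" using assms(3,4) aZ ab by auto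
    then obtain c where "(a, c) \<in> R" by auto
    then show ?thesis using pgraph_fst_eq[OF assms(1) ab] assms(2,6) aZ unfolding resp_def by blast
  qed
  show "a \<in> Z" if bZ: "b \<in> Z'"
  proof -
    have "b \<in> snd ` R" using assms(3,5) bZ ab by auto
    then obtain c where "(c, b) \<in> R" by auto
    then show ?thesis using pgraph_snd_eq[OF assms(1) ab] assms(2,6) bZ unfolding resp_def by blast
  qed
qed


end

section \<open>The filtration by the subgroups p(A \<inter> p^s G)\<close>

lemma pmul_memI: "x \<in> S \<Longrightarrow> x [^]\<^bsub>G\<^esub> n \<in> pmul G n S"
  unfolding pmul_def by blast

lemma pmul_memE: "y \<in> pmul G n S \<Longrightarrow> \<exists>x\<in>S. y = x [^]\<^bsub>G\<^esub> n"
  unfolding pmul_def by blast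

text \<open>For p^2 A = 0 the quotient of G by this group has the type \<gamma>^{2,s} that enters
  the definition of the subscripts; see \<open>emb_gamma2\<close>.\<close>

definition hW :: "('a, 'b) monoid_scheme \<Rightarrow> nat \<Rightarrow> 'a set \<Rightarrow> nat \<Rightarrow> 'a set" where
  "hW G p A s = pmul G p (A \<inter> pmul G (p ^ s) (carrier G))"

lemma (in fin_p_group) subgroup_Int_P: "subgroup A G \<Longrightarrow> subgroup (A \<inter> P s) G"
  by (intro subgroups_Inter_pair subgroup_P)

lemma (in fin_p_group) subgroup_hW: "subgroup A G \<Longrightarrow> subgroup (hW G p A s) G"
  unfolding hW_def by (intro pmul_subgroup subgroup_Int_P)

lemma (in fin_p_group) hW_subset_P: "hW G p A s \<subseteq> P (Suc s)"
  unfolding hW_def by (subst pmul_P[symmetric]) (intro pmul_mono, simp)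

lemma (in fin_p_group) hW_antimono: "j \<le> k \<Longrightarrow> hW G p A k \<subseteq> hW G p A j"
  unfolding hW_def using P_antimono[of j k] by (intro pmul_mono) blast

lemma (in fin_p_group) hW_subset: "subgroup A G \<Longrightarrow> hW G p A s \<subseteq> A"
  unfolding hW_def using pmul_subset[of A p] pmul_mono[of "A \<inter> P s" A G p] by blast

context fin_p_group_pair
begin

lemma resp_Int:
  assumes "resp R Z Z'" "R \<subseteq> U \<times> U'" shows "resp R (Z \<inter> U) (Z' \<inter> U')"
  using assms unfolding resp_def by auto

text \<open>An isomorphism between \<open>G.P (r + 1)\<close> and \<open>H.P (r + 1)\<close> that respects the subgroups \<open>A\<close>, \<open>B\<close> and
  \<open>hW\<close> extends to \<open>G.P r\<close> in the order \<open>hW G p A j \<inter> G.P r\<close> for \<open>j = r, \<dots>, 0\<close>, then \<open>A \<inter> G.P r\<close>,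
  then \<open>G.P r\<close>. Multiplication by \<open>p\<close> maps each of these into the domain constructed before.\<close>

theorem ex_iso_mapping:
  assumes A: "subgroup A G" and B: "subgroup B H"
    and killA: "pmul G (p ^ 2) A = {\<one>\<^bsub>G\<^esub>}" and killB: "pmul H (p ^ 2) B = {\<one>\<^bsub>H\<^esub>}"
    and cP: "\<And>k. card (G.P k) = card (H.P k)"
    and cA: "\<And>k. card (A \<inter> G.P k) = card (B \<inter> H.P k)"
    and cW: "\<And>s k. card (hW G p A s \<inter> G.P k) = card (hW H p B s \<inter> H.P k)"
  shows "\<exists>f. f \<in> iso G H \<and> f ` A = B"
proof -
  let ?W = "hW G p A" and ?V = "hW H p B"
  define I where "I r R \<longleftrightarrow> pgraph R \<and> R \<subseteq> G.P r \<times> H.P r \<and> G.P r \<subseteq> fst ` R \<and> H.P r \<subseteq> snd ` R \<and>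
    resp R A B \<and> (\<forall>j. resp R (?W j) (?V j)) \<and> (\<forall>i. resp R (G.P i) (H.P i))" for r R
  have W1: "pmul G p (?W j \<inter> G.P r) = {\<one>\<^bsub>G\<^esub>}" for j r
  proof
    have "pmul G p (?W j \<inter> G.P r) \<subseteq> pmul G p (pmul G p A)" unfolding hW_def by (intro pmul_mono) (auto simp: pmul_def)
    also have "\<dots> = pmul G (p ^ 2) A" using subgroup.subset[OF A] by (simp add: G.pmul_pmul power2_eq_square)
    finally show "pmul G p (?W j \<inter> G.P r) \<subseteq> {\<one>\<^bsub>G\<^esub>}" using killA by simp
  qed (use subgroup.one_closed[OF G.pmul_subgroup[OF G.subgroup_Int_P[OF G.subgroup_hW[OF A]]]] in simp)
  have V1: "pmul H p (?V j \<inter> H.P r) = {\<one>\<^bsub>H\<^esub>}" for j r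
  proof
    have "pmul H p (?V j \<inter> H.P r) \<subseteq> pmul H p (pmul H p B)" unfolding hW_def by (intro pmul_mono) (auto simp: pmul_def)
    also have "\<dots> = pmul H (p ^ 2) B" using subgroup.subset[OF B] by (simp add: H.pmul_pmul power2_eq_square)
    finally show "pmul H p (?V j \<inter> H.P r) \<subseteq> {\<one>\<^bsub>H\<^esub>}" using killB by simp
  qed (use subgroup.one_closed[OF H.pmul_subgroup[OF H.subgroup_Int_P[OF H.subgroup_hW[OF B]]]] in simp)
  have step: "\<exists>R'. I r R'" if IR: "I (Suc r) R" for r R
  proof -
    \<comment> \<open>At stage d the groups \<open>?W i\<close> with i \<ge> r - d are covered
      inside \<open>G.P r\<close>; adding d on the left avoids truncated subtraction. At d = 0
      nothing has to be done, since \<open>?W i\<close> lies in \<open>G.P (Suc i)\<close>, which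
      for i \<ge> r is covered by R. At d = r all indices are included.\<close>
    define Q where "Q d R' \<longleftrightarrow> pgraph R' \<and> R \<subseteq> R' \<and> R' \<subseteq> G.P r \<times> H.P r \<and>
      resp R' A B \<and> (\<forall>j. resp R' (?W j) (?V j)) \<and> (\<forall>i. resp R' (G.P i) (H.P i)) \<and>
      (\<forall>i. i + d \<ge> r \<longrightarrow> ?W i \<inter> G.P r \<subseteq> fst ` R' \<and> ?V i \<inter> H.P r \<subseteq> snd ` R')" for d R'
    have Psuc: "G.P (Suc r) \<subseteq> fst ` R" "H.P (Suc r) \<subseteq> snd ` R" using IR unfolding I_def by auto
    \<comment> \<open>For i \<le> r the group \<open>G.P i\<close> contains the adjoined subgroup M,
      so the extension respects it; for i > r it is covered by R already.\<close>
    have extP: "\<forall>i. resp R2 (G.P i) (H.P i)"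
      if R1: "\<forall>i. resp R1 (G.P i) (H.P i)" "R \<subseteq> R1" "R1 \<subseteq> R2" "pgraph R2" "R2 \<subseteq> G.P r \<times> H.P r" 
        and M: "M \<subseteq> G.P r" "N \<subseteq> H.P r"
        and Z: "\<And>Z Z'. subgroup Z G \<Longrightarrow> subgroup Z' H \<Longrightarrow> M \<subseteq> Z \<Longrightarrow> N \<subseteq> Z' \<Longrightarrow> (resp R1 Z Z' \<longrightarrow> resp R2 Z Z')"
      for R1 R2 M N
    proof
      fix i
      show "resp R2 (G.P i) (H.P i)"
      proof (cases "i \<le> r")
        case True
        then show ?thesis using Z[OF G.subgroup_P H.subgroup_P] M G.P_antimono[OF True] H.P_antimono[OF True] R1(1) by blast
      next
        case False
        then have "G.P i \<subseteq> G.P (Suc r)" "H.P i \<subseteq> H.P (Suc r)" using G.P_antimono[of "Suc r" i] H.P_antimono[of "Suc r" i] by auto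
        then show ?thesis using resp_persist[OF R1(4) R1(3) R1(5), of "G.P i" "H.P i"] R1(1,2) Psuc by blast
      qed
    qed
    have "\<exists>R'. Q d R'" for d
    proof (induction d)
      case 0
      have "?W i \<inter> G.P r \<subseteq> fst ` R \<and> ?V i \<inter> H.P r \<subseteq> snd ` R" if "r \<le> i" for i
        using G.hW_subset_P[of A i] H.hW_subset_P[of B i] G.P_antimono[of "Suc r" "Suc i"] H.P_antimono[of "Suc r" "Suc i"]
          that Psuc by (auto simp del: power_Suc)
      moreover have "R \<subseteq> G.P r \<times> H.P r" using IR G.P_Suc_subset[of r] H.P_Suc_subset[of r] unfolding I_def by blast
      ultimately have "Q 0 R" using IR unfolding Q_def I_def by auto
      then show ?case by blast
    next
      case (Suc d)
      then obtain R1 where R1: "Q d R1" by blast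
      show ?case
      proof (cases "d < r")
        case False
        then have "Q (Suc d) R1" using R1 unfolding Q_def by auto
        then show ?thesis by blast
      next
        case True
        define j where "j = r - Suc d"
        let ?M = "?W j \<inter> G.P r" and ?N = "?V j \<inter> H.P r"
        have pg1: "pgraph R1" and R1P: "R1 \<subseteq> G.P r \<times> H.P r" and RR1: "R \<subseteq> R1" using R1 unfolding Q_def by auto
        have "resp R1 ?M ?N" using R1 unfolding Q_def by (intro resp_Int) auto
        moreover have "\<forall>x\<in>?M. \<exists>y\<in>?N. (x [^]\<^bsub>G\<^esub> p, y [^]\<^bsub>H\<^esub> p) \<in> R1"
        proof
          fix x assume x: "x \<in> ?M"
          have "x [^]\<^bsub>G\<^esub> p = \<one>\<^bsub>G\<^esub>" using W1[of j r] x unfolding pmul_def by blast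
          moreover have "\<one>\<^bsub>H\<^esub> \<in> ?N" using subgroup.one_closed[OF H.subgroup_Int_P[OF H.subgroup_hW[OF B]]] .
          moreover have "(\<one>\<^bsub>G\<^esub>, \<one>\<^bsub>H\<^esub>) \<in> R1" using pg1 subgroup.one_closed unfolding pgraph_def by fastforce
          ultimately show "\<exists>y\<in>?N. (x [^]\<^bsub>G\<^esub> p, y [^]\<^bsub>H\<^esub> p) \<in> R1" by (intro bexI[of _ "\<one>\<^bsub>H\<^esub>"]) auto
        qed
        ultimately obtain R2 where R2: "pgraph R2" "R1 \<subseteq> R2" "?M \<subseteq> fst ` R2" "?N \<subseteq> snd ` R2" and
          Z: "\<And>Z Z'. subgroup Z G \<Longrightarrow> subgroup Z' H \<Longrightarrow> ?M \<subseteq> Z \<Longrightarrow> ?N \<subseteq> Z' \<Longrightarrow>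
            (resp R1 Z Z' \<longrightarrow> resp R2 Z Z') \<and> (R1 \<subseteq> Z \<times> Z' \<longrightarrow> R2 \<subseteq> Z \<times> Z')"
          using pgraph_extend[OF pg1 _ G.subgroup_Int_P[OF G.subgroup_hW[OF A]] H.subgroup_Int_P[OF H.subgroup_hW[OF B]]
              cW[of j r]] W1[of j r] V1[of j r] by auto
        have R2P: "R2 \<subseteq> G.P r \<times> H.P r" using Z[OF G.subgroup_P H.subgroup_P] R1P by blast
        have fs: "fst ` R1 \<subseteq> fst ` R2" "snd ` R1 \<subseteq> snd ` R2" using R2(2) by auto
        have W: "?W i \<inter> G.P r \<subseteq> fst ` R2 \<and> ?V i \<inter> H.P r \<subseteq> snd ` R2" if "i + Suc d \<ge> r" for i
        proof (cases "i = j")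
          case True
          then show ?thesis using R2 by simp
        next
          case False
          then have "i + d \<ge> r" using that True unfolding j_def by auto
          then show ?thesis using R1 fs unfolding Q_def by blast
        qed
        \<comment> \<open>The filtration decreases: for i \<le> j the group \<open>?W i\<close>
          contains the adjoined part of \<open>?W j\<close>, and for i > j its part in
          \<open>G.P r\<close> was covered before.\<close>
        have "resp R2 (?W i) (?V i)" for i
        proof (cases "i \<le> j")
          case True
          then show ?thesis using Z[OF G.subgroup_hW[OF A, of i] H.subgroup_hW[OF B, of i]]
              G.hW_antimono[OF True, of A] H.hW_antimono[OF True, of B] R1 unfolding Q_def by blast
        next
          case False
          then have "i + d \<ge> r" using True unfolding j_def by auto
          then have "?W i \<inter> G.P r \<subseteq> fst ` R1" "?V i \<inter> H.P r \<subseteq> snd ` R1" "resp R1 (?W i) (?V i)"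
            using R1 unfolding Q_def by blast+
          then show ?thesis using resp_persist[OF R2(1,2) R2P] by blast
        qed
        moreover have "resp R2 A B" using Z[OF A B] G.hW_subset[OF A, of j] H.hW_subset[OF B, of j] R1
          unfolding Q_def by blast
        moreover have "\<forall>i. resp R2 (G.P i) (H.P i)"
          by (rule extP[of R1 R2 ?M ?N]) (use R1 R2 R2P Z in \<open>auto simp: Q_def\<close>)
        ultimately have "Q (Suc d) R2" unfolding Q_def using R2(1,2) R2P RR1 W by blast
        then show ?thesis by blast
      qed
    qed
    then obtain R1 where R1: "Q r R1" by blast
    have pg1: "pgraph R1" and R1P: "R1 \<subseteq> G.P r \<times> H.P r" and RR1: "R \<subseteq> R1" 
      and W1': "?W i \<inter> G.P r \<subseteq> fst ` R1 \<and> ?V i \<inter> H.P r \<subseteq> snd ` R1" for i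
      using R1 unfolding Q_def by auto
    let ?M = "A \<inter> G.P r" and ?N = "B \<inter> H.P r"
    \<comment> \<open>Since \<open>?W r\<close> lies in \<open>G.P (Suc r)\<close>, the intersection
      changes nothing; it brings the multiple by p into the form for which \<open>cW\<close>
      supplies equal cardinalities.\<close>
    have pA: "pmul G p ?M = ?W r \<inter> G.P (Suc r)" and pB: "pmul H p ?N = ?V r \<inter> H.P (Suc r)"
      using G.hW_subset_P[of A r] H.hW_subset_P[of B r] unfolding hW_def by blast+
    have r1: "resp R1 ?M ?N" using R1 unfolding Q_def by (intro resp_Int) auto
    have c1: "\<forall>x\<in>?M. \<exists>y\<in>?N. (x [^]\<^bsub>G\<^esub> p, y [^]\<^bsub>H\<^esub> p) \<in> R1"
    proof
      fix x assume x: "x \<in> ?M"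
      then have xW: "x [^]\<^bsub>G\<^esub> p \<in> ?W r" unfolding hW_def pmul_def by blast
      moreover have "?W r \<subseteq> fst ` R1" using G.hW_subset_P[of A r] Psuc RR1 by blast
      ultimately obtain t where t: "(x [^]\<^bsub>G\<^esub> p, t) \<in> R1" by force
      then have "t \<in> ?V r" using R1 xW unfolding Q_def resp_def by blast
      then show "\<exists>y\<in>?N. (x [^]\<^bsub>G\<^esub> p, y [^]\<^bsub>H\<^esub> p) \<in> R1" using t unfolding hW_def pmul_def by blast
    qed
    have p1: "card (pmul G p ?M) = card (pmul H p ?N)" unfolding pA pB by (rule cW)
    from pgraph_extend[OF pg1 r1 G.subgroup_Int_P[OF A] H.subgroup_Int_P[OF B] cA p1 c1]
    obtain R2 where R2: "pgraph R2" "R1 \<subseteq> R2" "?M \<subseteq> fst ` R2" "?N \<subseteq> snd ` R2" and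
      Z: "\<And>Z Z'. subgroup Z G \<Longrightarrow> subgroup Z' H \<Longrightarrow> ?M \<subseteq> Z \<Longrightarrow> ?N \<subseteq> Z' \<Longrightarrow>
        (resp R1 Z Z' \<longrightarrow> resp R2 Z Z') \<and> (R1 \<subseteq> Z \<times> Z' \<longrightarrow> R2 \<subseteq> Z \<times> Z')"
      by (elim exE conjE) simp
    have R2P: "R2 \<subseteq> G.P r \<times> H.P r" using Z[OF G.subgroup_P H.subgroup_P] R1P by blast
    have R2A: "resp R2 A B" using Z[OF A B] R1 unfolding Q_def by blast
    have R2W: "resp R2 (?W i) (?V i)" for i
      using resp_persist[OF R2(1,2) R2P] W1'[of i] R1 unfolding Q_def by blast
    have R2PP: "\<forall>i. resp R2 (G.P i) (H.P i)"
      by (rule extP[of R1 R2 ?M ?N]) (use R1 R2 R2P Z in \<open>auto simp: Q_def\<close>)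
    have c2: "\<forall>x\<in>G.P r. \<exists>y\<in>H.P r. (x [^]\<^bsub>G\<^esub> p, y [^]\<^bsub>H\<^esub> p) \<in> R2"
    proof
      fix x assume x: "x \<in> G.P r"
      then have xP: "x [^]\<^bsub>G\<^esub> p \<in> G.P (Suc r)" using pmul_memI[OF x, of G p] by (simp only: G.pmul_P)
      have "fst ` R \<subseteq> fst ` R2" using RR1 R2(2) by (intro image_mono) blast
      then have "x [^]\<^bsub>G\<^esub> p \<in> fst ` R2" using xP Psuc(1) by blast
      then obtain t where t: "(x [^]\<^bsub>G\<^esub> p, t) \<in> R2" by auto
      then have "t \<in> H.P (Suc r)" using R2PP xP unfolding resp_def by blast
      then show "\<exists>y\<in>H.P r. (x [^]\<^bsub>G\<^esub> p, y [^]\<^bsub>H\<^esub> p) \<in> R2" using t pmul_memE[of t H p "H.P r"] unfolding H.pmul_P by blast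
    qed
    have p2: "card (pmul G p (G.P r)) = card (pmul H p (H.P r))" unfolding G.pmul_P H.pmul_P by (rule cP)
    have r2: "resp R2 (G.P r) (H.P r)" using R2PP by blast
    from pgraph_extend[OF R2(1) r2 G.subgroup_P H.subgroup_P cP p2 c2]
    obtain R3 where R3: "pgraph R3" "R2 \<subseteq> R3" "G.P r \<subseteq> fst ` R3" "H.P r \<subseteq> snd ` R3" and
      Z: "\<And>Z Z'. subgroup Z G \<Longrightarrow> subgroup Z' H \<Longrightarrow> G.P r \<subseteq> Z \<Longrightarrow> H.P r \<subseteq> Z' \<Longrightarrow>
        (resp R2 Z Z' \<longrightarrow> resp R3 Z Z') \<and> (R2 \<subseteq> Z \<times> Z' \<longrightarrow> R3 \<subseteq> Z \<times> Z')"
      by (elim exE conjE) simp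
    have fs: "fst ` R1 \<subseteq> fst ` R2" "snd ` R1 \<subseteq> snd ` R2" using R2(2) by auto
    have R3P: "R3 \<subseteq> G.P r \<times> H.P r" using Z[OF G.subgroup_P H.subgroup_P] R2P by blast
    have "resp R3 A B" using resp_persist[OF R3(1,2) R3P R2(3,4) R2A] .
    moreover have "resp R3 (?W i) (?V i)" for i
      using resp_persist[OF R3(1,2) R3P _ _ R2W[of i]] W1'[of i] fs by blast
    moreover have "\<forall>i. resp R3 (G.P i) (H.P i)"
      by (rule extP[of R2 R3 "G.P r" "H.P r"]) (use R2PP R2 R3 R3P RR1 Z in auto)
    ultimately have "I r R3" unfolding I_def using R3 R3P by blast
    then show ?thesis by blast
  qed
  obtain n where n: "G.P n = {\<one>\<^bsub>G\<^esub>}" "H.P n = {\<one>\<^bsub>H\<^esub>}"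
  proof -
    obtain n1 where "\<forall>k\<ge>n1. \<forall>A. subgroup A G \<longrightarrow> pmul G (p ^ k) A = {\<one>\<^bsub>G\<^esub>}" using G.pmul_order by blast
    moreover obtain n2 where "\<forall>k\<ge>n2. \<forall>A. subgroup A H \<longrightarrow> pmul H (p ^ k) A = {\<one>\<^bsub>H\<^esub>}" using H.pmul_order by blast
    ultimately show ?thesis using that[of "max n1 n2"] G.subgroup_self H.subgroup_self by simp
  qed
  have "subgroup {(\<one>\<^bsub>G\<^esub>, \<one>\<^bsub>H\<^esub>)} (G \<times>\<times> H)" using D.triv_subgroup by simp
  then have "I n {(\<one>\<^bsub>G\<^esub>, \<one>\<^bsub>H\<^esub>)}"
    unfolding I_def pgraph_def resp_def n
    using subgroup.one_closed[OF A] subgroup.one_closed[OF B] subgroup.one_closed[OF G.subgroup_hW[OF A]]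
      subgroup.one_closed[OF H.subgroup_hW[OF B]] subgroup.one_closed[OF G.subgroup_P] subgroup.one_closed[OF H.subgroup_P]
    by auto
  then have "\<exists>R. I (n - d) R" for d
  proof (induction d)
    case (Suc d)
    then obtain R where R: "I (n - d) R" by blast
    show ?case
    proof (cases "d < n")
      case True
      then have "n - d = Suc (n - Suc d)" by simp
      then show ?thesis using R step by metis
    qed (use R in auto)
  qed auto
  from this[of n] obtain R where "I 0 R" by auto
  then have R: "pgraph R" "R \<subseteq> carrier G \<times> carrier H" "carrier G \<subseteq> fst ` R" "carrier H \<subseteq> snd ` R" "resp R A B"
    unfolding I_def G.P_0 H.P_0 by auto
  have sR: "subgroup R (G \<times>\<times> H)" using R(1) pgraph_def by simp
  define f where "f x = (THE y. (x, y) \<in> R)" for x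
  have f: "(x, f x) \<in> R" if x: "x \<in> carrier G" for x
    unfolding f_def by (rule theI') (use R(3) x pgraph_fst_eq[OF R(1)] in fastforce)
  have fe: "f x = y" if "(x, y) \<in> R" for x y
    using f[of x] R(2) that pgraph_fst_eq[OF R(1)] by blast
  have fc: "f x \<in> carrier H" if "x \<in> carrier G" for x using f[OF that] R(2) by blast
  have "f (x \<otimes>\<^bsub>G\<^esub> y) = f x \<otimes>\<^bsub>H\<^esub> f y" if "x \<in> carrier G" "y \<in> carrier G" for x y
    using subgroup.m_closed[OF sR f[OF that(1)] f[OF that(2)]] by (intro fe) simp
  then have "f \<in> hom G H" using fc by (auto simp: hom_def)
  moreover have "inj_on f (carrier G)" using f pgraph_snd_eq[OF R(1)] by (intro inj_onI) metis
  moreover have "f ` carrier G = carrier H"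
  proof
    show "carrier H \<subseteq> f ` carrier G"
    proof
      fix y assume "y \<in> carrier H"
      then obtain x where "(x, y) \<in> R" using R(4) by fastforce
      then show "y \<in> f ` carrier G" using fe R(2) by blast
    qed
  qed (use fc in auto)
  ultimately have fi: "f \<in> iso G H" by (simp add: iso_def bij_betw_def)
  have "f ` A = B"
  proof
    show "f ` A \<subseteq> B" using f R(5) subgroup.mem_carrier[OF A] unfolding resp_def by blast
    show "B \<subseteq> f ` A"
    proof
      fix y assume y: "y \<in> B"
      then obtain x where x: "(x, y) \<in> R" using R(4) subgroup.mem_carrier[OF B] by fastforce
      then show "y \<in> f ` A" using fe[OF x] R(5) y unfolding resp_def by blast
    qed
  qed
  with fi show ?thesis by blast
qed

end

section \<open>Partitions and the types of finite abelian p-groups\<close>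

text \<open>The number of boxes of la below row k. It is also the logarithm of the order of p^k
  M(la), see \<open>card_pmul_Mgrp\<close>, so partitions and groups are compared through this
  function.\<close>

definition tail :: "nat list \<Rightarrow> nat \<Rightarrow> nat" where
  "tail la k = (\<Sum>x\<leftarrow>la. x - k)"

lemma tail_Suc: "tail la k = conjp la (Suc k) + tail la (Suc k)"
  unfolding tail_def conjp_def by (induction la) auto

lemma tail_eq_0: "conjp la (Suc k) = 0 \<Longrightarrow> tail la k = 0"
  unfolding tail_def conjp_def by (induction la) (auto split: if_splits)

lemma conjp_antimono: "m \<le> n \<Longrightarrow> conjp la n \<le> conjp la m"
  unfolding conjp_def by (induction la) auto

text \<open>The vanishing of f at n forces row n + 1 of la to be empty, so \<open>tail la\<close>
  vanishes at n too; equality then spreads downwards by the common recursion, and beyond n both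
  functions are zero.\<close>

lemma tail_eqI:
  assumes "\<And>k. f k = conjp la (Suc k) + f (Suc k)" and "f n = 0"
  shows "tail la k = f k"
proof -
  have le: "f (n + j) = 0" for j
  proof (induction j)
    case (Suc j)
    then show ?case using assms(1)[of "n + j"] by simp
  qed (use assms(2) in simp)
  have "tail la (n + j) = f (n + j)" for j
    using le[of j] assms(1)[of "n + j"] tail_eq_0[of la "n + j"] by simp
  moreover have "tail la (n - j) = f (n - j)" for j
  proof (induction j)
    case 0
    then show ?case using calculation[of 0] by simp
  next
    case (Suc j)
    show ?case
    proof (cases "j < n")
      case True
      then have "Suc (n - Suc j) = n - j" by simp
      then show ?thesis using assms(1)[of "n - Suc j"] tail_Suc[of la "n - Suc j"] Suc by simp
    qed (use Suc in simp)
  qed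
  from this[of "n - k"] calculation[of "k - n"] show ?thesis by (cases "k \<le> n") auto
qed

text \<open>Both sides say that the diagram contains the box in column i and row m, once read by
  columns and once by rows.\<close>

lemma part_ge_iff:
  assumes "is_partition la" "1 \<le> m" "1 \<le> i"
  shows "m \<le> part la i \<longleftrightarrow> i \<le> conjp la m"
  using assms
proof (induction la arbitrary: i)
  case Nil
  then show ?case by (auto simp: part_def conjp_def)
next
  case (Cons x la)
  have la: "is_partition la" using Cons.prems by (auto simp: is_partition_def)
  show ?case
  proof (cases "i = 1")
    case True
    have "m \<le> x" if "y \<in> set la" "m \<le> y" for y
      using that Cons.prems(1) by (auto simp: is_partition_def)
    then have "m \<le> x \<longleftrightarrow> Suc 0 \<le> conjp (x # la) m"
      by (auto simp: conjp_def Suc_le_eq filter_empty_conv)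
    then show ?thesis using True by (simp add: part_def)
  next
    case False
    then obtain j where j: "i = Suc j" "1 \<le> j" using Cons.prems(3) by (cases i) auto
    have "part (x # la) i = part la j" using j by (auto simp: part_def nth_Cons split: nat.splits)
    moreover have "i \<le> conjp (x # la) m \<longleftrightarrow> j \<le> conjp la m"
    proof (cases "m \<le> x")
      case True
      then show ?thesis using j by (simp add: conjp_def)
    next
      case False
      then have "filter (\<lambda>x. m \<le> x) la = []"
        using Cons.prems(1) by (force simp: is_partition_def filter_empty_conv)
      then show ?thesis using j False by (simp add: conjp_def)
    qed
    ultimately show ?thesis using Cons.IH[OF la Cons.prems(2) j(2)] by simp
  qed
qed

lemma conjp_1: "is_partition la \<Longrightarrow> conjp la (Suc 0) = length la"
  unfolding conjp_def is_partition_def by (metis One_nat_def filter_True less_one linorder_le_less_linear)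

lemma partition_eqI:
  assumes la: "is_partition la" and mu: "is_partition mu" and eq: "\<And>m. 1 \<le> m \<Longrightarrow> conjp la m = conjp mu m"
  shows "la = mu"
proof (rule nth_equalityI)
  show l: "length la = length mu" using conjp_1[OF la] conjp_1[OF mu] eq[of 1] by simp
  fix i assume i: "i < length la"
  have "m \<le> part la (Suc i) \<longleftrightarrow> m \<le> part mu (Suc i)" for m
    using part_ge_iff[OF la, of m "Suc i"] part_ge_iff[OF mu, of m "Suc i"] eq[of m] by (cases "m = 0") auto
  then have "part la (Suc i) = part mu (Suc i)" by (meson order_antisym order_refl)
  then show "la ! i = mu ! i" using i l by (simp add: part_def)
qed

lemma partition_eq_tailI:
  assumes "is_partition la" "is_partition mu" "\<And>k. tail la k = tail mu k" shows "la = mu"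
proof (rule partition_eqI[OF assms(1,2)])
  fix m :: nat assume "1 \<le> m"
  then show "conjp la m = conjp mu m"
    using tail_Suc[of la "m - 1"] tail_Suc[of mu "m - 1"] assms(3)[of m] assms(3)[of "m - 1"] by simp
qed

text \<open>The entry \<open>c i\<close> is the length of column i + 1. As d is weakly decreasing,
  the rows longer than i are initial ones, whence the transposition rule: m \<le> c i exactly if i <
  d m.\<close>

lemma ex_partition_conjp:
  assumes "\<And>m. 1 \<le> m \<Longrightarrow> d (Suc m) \<le> d m" and "\<And>m. m > N \<Longrightarrow> d m = (0::nat)"
  shows "\<exists>la. is_partition la \<and> (\<forall>m\<ge>1. conjp la m = d m)"
proof -
  have anti: "d n \<le> d m" if "m \<le> n" "1 \<le> m" for m n
    using that(1) by (induction rule: dec_induct) (use assms(1) that(2) in \<open>auto intro: order_trans\<close>)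
  define c where "c i = card {m \<in> {1..N}. i < d m}" for i
  have c: "m \<le> c i \<longleftrightarrow> i < d m" if m: "1 \<le> m" for m i
  proof
    assume im: "i < d m"
    then have "m \<le> N" using assms(2)[of m] by (cases "m \<le> N") auto
    then have "{1..m} \<subseteq> {m \<in> {1..N}. i < d m}" using im anti by (fastforce intro: less_le_trans)
    then show "m \<le> c i" unfolding c_def using card_mono[of "{m \<in> {1..N}. i < d m}" "{1..m}"] by simp
  next
    assume mc: "m \<le> c i"
    show "i < d m"
    proof (rule ccontr)
      assume "\<not> i < d m"
      then have "j < m" if "i < d j" for j using that anti[of m j] m by (cases "m \<le> j") auto
      then have "{m \<in> {1..N}. i < d m} \<subseteq> {1..<m}" by auto
      then have "card {m \<in> {1..N}. i < d m} \<le> card {1..<m}" by (intro card_mono) auto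
      then have "c i \<le> m - 1" unfolding c_def by simp
      then show False using mc m by simp
    qed
  qed
  define la where "la = map c [0..<d 1]"
  have cm: "c j \<le> c i" if "i \<le> j" for i j
    unfolding c_def using that by (intro card_mono) auto
  have "sorted_wrt (\<ge>) la" unfolding la_def sorted_wrt_map
    by (rule sorted_wrt_mono_rel[OF _ sorted_wrt_upt]) (use cm in auto)
  moreover have "c i \<noteq> 0" if "i < d 1" for i using iffD2[OF c[of 1 i] that] by simp
  then have "0 \<notin> set la" unfolding la_def by force
  moreover have "conjp la m = d m" if m: "1 \<le> m" for m
  proof -
    have "conjp la m = length (filter (\<lambda>i. i < d m) [0..<d 1])"
      unfolding conjp_def la_def filter_map using c[OF m] by (simp add: comp_def)
    also have "\<dots> = card {i. i < d m \<and> i < d 1}"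
      by (subst distinct_card[symmetric]) (auto intro!: arg_cong[of _ _ card])
    also have "{i. i < d m \<and> i < d 1} = {..<d m}" using anti[of 1 m] m by auto
    finally show ?thesis by simp
  qed
  ultimately show ?thesis unfolding is_partition_def by blast
qed

section \<open>The groups M(la)\<close>

context
  fixes p :: nat and la :: "nat list"
  assumes p: "Factorial_Ring.prime p"
begin

lemma p_pos: "p > 0" using p prime_gt_0_nat by auto

lemma carrier_Mgrp: "carrier (Mgrp p la) = (\<Pi>\<^sub>E i\<in>{..<length la}. {0..<int p ^ (la ! i)})"
  unfolding Mgrp_def using p_pos by (simp add: carrier_integer_mod_group)

lemma mult_Mgrp: "x \<otimes>\<^bsub>Mgrp p la\<^esub> y = (\<lambda>i\<in>{..<length la}. (x i + y i) mod int p ^ (la ! i))"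
  unfolding Mgrp_def by simp

lemma one_Mgrp: "\<one>\<^bsub>Mgrp p la\<^esub> = (\<lambda>i\<in>{..<length la}. 0)"
  unfolding Mgrp_def by simp

lemma comm_group_Mgrp: "comm_group (Mgrp p la)"
proof (rule group.group_comm_groupI)
  show "group (Mgrp p la)" unfolding Mgrp_def by (rule product_group) simp
qed (auto simp: mult_Mgrp add.commute)

lemma inv_Mgrp: 
  assumes "x \<in> carrier (Mgrp p la)" 
  shows "inv\<^bsub>Mgrp p la\<^esub> x = (\<lambda>i\<in>{..<length la}. (- x i) mod int p ^ (la ! i))"
proof -
  have "inv\<^bsub>Mgrp p la\<^esub> x = (\<lambda>i\<in>{..<length la}. inv\<^bsub>integer_mod_group (p ^ (la ! i))\<^esub> x i)"
    using assms unfolding Mgrp_def by (subst inv_product_group) auto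
  also have "\<dots> = (\<lambda>i\<in>{..<length la}. (- x i) mod int p ^ (la ! i))"
    using assms unfolding Mgrp_def by (intro restrict_ext) (auto simp: PiE_def Pi_def)
  finally show ?thesis .
qed

lemma pow_Mgrp: 
  assumes "x \<in> carrier (Mgrp p la)" 
  shows "x [^]\<^bsub>Mgrp p la\<^esub> (n::nat) = (\<lambda>i\<in>{..<length la}. (int n * x i) mod int p ^ (la ! i))"
proof (induction n)
  case 0
  interpret comm_group "Mgrp p la" by (rule comm_group_Mgrp)
  show ?case by (simp add: one_Mgrp cong: restrict_cong)
next
  case (Suc n)
  interpret comm_group "Mgrp p la" by (rule comm_group_Mgrp)
  show ?case by (simp add: Suc mult_Mgrp mod_simps distrib_right add.commute cong: restrict_cong)
qed

text \<open>The minimum covers k > l, where zero is the only multiple left.\<close>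

lemma multiples_mod:
  "(\<lambda>x. (int p ^ k * x) mod int p ^ l) ` {0..<int p ^ l} = {y \<in> {0..<int p ^ l}. int p ^ min k l dvd y}" (is "?L = ?R")
proof
  have pl: "int p ^ l > 0" using p_pos by simp
  show "?L \<subseteq> ?R"
  proof
    fix y assume "y \<in> ?L"
    then obtain x where y: "y = (int p ^ k * x) mod int p ^ l" by auto
    have "int p ^ min k l dvd y" unfolding y
      by (intro dvd_mod dvd_mult2 le_imp_power_dvd) auto
    then show "y \<in> ?R" using y pl by simp
  qed
  show "?R \<subseteq> ?L"
  proof
    fix y assume y: "y \<in> ?R"
    show "y \<in> ?L"
    proof (cases "k \<le> l")
      case True
      then obtain c where c: "y = int p ^ k * c" using y by (auto simp: min_def)
      have pk: "int p ^ k > 0" using p_pos by simp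
      have "0 \<le> int p ^ k * c" using y c by simp
      then have "c \<ge> 0" using pk by (metis zero_le_mult_iff not_less)
      moreover have "1 * c \<le> int p ^ k * c" using pk \<open>c \<ge> 0\<close> by (intro mult_right_mono) linarith+
      then have "c \<le> y" using c by simp
      ultimately show ?thesis using y c by (intro image_eqI[of _ _ c]) auto
    next
      case False
      then have "int p ^ l dvd y" using y by (simp add: min_def split: if_splits)
      then have "\<not> 0 < y" using y zdvd_not_zless[of y "int p ^ l"] by auto
      moreover have "0 \<le> y" using y by simp
      ultimately have "y = 0" by linarith
      then show ?thesis using pl by (intro image_eqI[of _ _ 0]) auto
    qed
  qed
qed

lemma card_multiples:
  "card {y \<in> {0..<int p ^ l}. int p ^ min k l dvd y} = p ^ (l - k)"
proof -
  have pm: "int p ^ min k l > 0" using p_pos by simp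
  have pp: "int p ^ l = int p ^ min k l * int p ^ (l - k)"
    by (simp add: power_add[symmetric] min_def)
  have "bij_betw (\<lambda>c. int p ^ min k l * c) {0..<int p ^ (l - k)} {y \<in> {0..<int p ^ l}. int p ^ min k l dvd y}"
    unfolding bij_betw_def
  proof
    show "inj_on (\<lambda>c. int p ^ min k l * c) {0..<int p ^ (l - k)}" using pm by (auto simp: inj_on_def)
    show "(\<lambda>c. int p ^ min k l * c) ` {0..<int p ^ (l - k)} = {y \<in> {0..<int p ^ l}. int p ^ min k l dvd y}"
    proof (intro equalityI subsetI)
      fix y assume y: "y \<in> {y \<in> {0..<int p ^ l}. int p ^ min k l dvd y}"
      then obtain c where c: "y = int p ^ min k l * c" by auto
      have "0 \<le> int p ^ min k l * c" "int p ^ min k l * c < int p ^ min k l * int p ^ (l - k)"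
        using y unfolding c pp[symmetric] by auto
      then have "0 \<le> c" "c < int p ^ (l - k)"
        using pm by (metis zero_le_mult_iff not_less, metis mult_less_cancel_left_pos)
      then show "y \<in> (\<lambda>c. int p ^ min k l * c) ` {0..<int p ^ (l - k)}" using c by auto
    next
      fix y assume "y \<in> (\<lambda>c. int p ^ min k l * c) ` {0..<int p ^ (l - k)}"
      then obtain c where "c \<in> {0..<int p ^ (l - k)}" "y = int p ^ min k l * c" by (rule imageE)
      then have c: "y = int p ^ min k l * c" "0 \<le> c" "c < int p ^ (l - k)" by simp_all
      have "int p ^ min k l * c < int p ^ l" unfolding pp using c pm by (intro mult_strict_left_mono)
      then show "y \<in> {y \<in> {0..<int p ^ l}. int p ^ min k l dvd y}" using c pm by simp
    qed
  qed
  then have "card {y \<in> {0..<int p ^ l}. int p ^ min k l dvd y} = card {0..<int p ^ (l - k)}"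
    by (rule bij_betw_same_card[symmetric])
  also have "\<dots> = p ^ (l - k)" by (simp add: nat_power_eq)
  finally show ?thesis .
qed

lemma pmul_Mgrp:
  "pmul (Mgrp p la) (p ^ k) (carrier (Mgrp p la)) =
    (\<Pi>\<^sub>E i\<in>{..<length la}. {y \<in> {0..<int p ^ (la ! i)}. int p ^ min k (la ! i) dvd y})" (is "?L = ?R")
proof
  show "?L \<subseteq> ?R"
  proof
    fix y assume "y \<in> ?L"
    then obtain x where x: "x \<in> carrier (Mgrp p la)" "y = x [^]\<^bsub>Mgrp p la\<^esub> (p ^ k)" by (auto simp: pmul_def)
    have "y i \<in> {y \<in> {0..<int p ^ (la ! i)}. int p ^ min k (la ! i) dvd y}" if "i < length la" for i
      unfolding multiples_mod[symmetric] x(2) using pow_Mgrp[OF x(1)] x(1) that by (auto simp: carrier_Mgrp PiE_def Pi_def)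
    then show "y \<in> ?R" using x pow_Mgrp[OF x(1)] by auto
  qed
  show "?R \<subseteq> ?L"
  proof
    fix y assume y: "y \<in> ?R"
    have "\<forall>i<length la. \<exists>x\<in>{0..<int p ^ (la ! i)}. y i = (int p ^ k * x) mod int p ^ (la ! i)"
    proof (intro allI impI)
      fix i assume "i < length la"
      then have "y i \<in> (\<lambda>x. (int p ^ k * x) mod int p ^ (la ! i)) ` {0..<int p ^ (la ! i)}"
        unfolding multiples_mod using y by auto
      then show "\<exists>x\<in>{0..<int p ^ (la ! i)}. y i = (int p ^ k * x) mod int p ^ (la ! i)" by auto
    qed
    then obtain x where x: "\<And>i. i < length la \<Longrightarrow> x i \<in> {0..<int p ^ (la ! i)} \<and> y i = (int p ^ k * x i) mod int p ^ (la ! i)"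
      by metis
    define x' where "x' = restrict x {..<length la}"
    have "x' \<in> carrier (Mgrp p la)" unfolding carrier_Mgrp x'_def using x by auto
    moreover have "y = x' [^]\<^bsub>Mgrp p la\<^esub> (p ^ k)" unfolding pow_Mgrp[OF \<open>x' \<in> carrier (Mgrp p la)\<close>]
      using x y unfolding x'_def by (intro ext) (auto simp: PiE_def extensional_def)
    ultimately show "y \<in> ?L" by (auto simp: pmul_def)
  qed
qed

lemma card_pmul_Mgrp: "card (pmul (Mgrp p la) (p ^ k) (carrier (Mgrp p la))) = p ^ tail la k"
proof -
  have "card (pmul (Mgrp p la) (p ^ k) (carrier (Mgrp p la))) = (\<Prod>i<length la. p ^ (la ! i - k))"
    unfolding pmul_Mgrp card_PiE[OF finite_lessThan] card_multiples ..
  also have "\<dots> = p ^ (\<Sum>i<length la. la ! i - k)" by (simp add: power_sum)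
  also have "(\<Sum>i<length la. la ! i - k) = tail la k" unfolding tail_def
    by (simp add: sum_list_sum_nth atLeast0LessThan)
  finally show ?thesis .
qed

lemma fin_p_group_Mgrp: "fin_p_group (Mgrp p la) p"
proof (intro fin_p_group.intro fin_p_group_axioms.intro)
  show "comm_group (Mgrp p la)" by (rule comm_group_Mgrp)
  interpret comm_group "Mgrp p la" by (rule comm_group_Mgrp)
  show "finite (carrier (Mgrp p la))" unfolding carrier_Mgrp by (intro finite_PiE) auto
  show "\<exists>n. order (Mgrp p la) = p ^ n" using card_pmul_Mgrp[of 0] unfolding order_def by auto
qed (rule p)

end

section \<open>Classification of finite abelian p-groups\<close>

lemma (in fin_p_group) tail_Mgrp: "plog p (pmul (Mgrp p la) (p ^ k) (carrier (Mgrp p la))) = tail la k"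
  using plog_eqI[OF prime card_pmul_Mgrp[OF prime]] .

lemma (in fin_p_group_pair) is_iso_iff: "G \<cong> H \<longleftrightarrow> (\<forall>k. card (G.P k) = card (H.P k))"
proof
  assume "G \<cong> H"
  then obtain f where f: "f \<in> iso G H" by (auto simp: is_iso_def)
  then interpret f: group_hom G H f
    by unfold_locales (auto simp: iso_def)
  have fb: "bij_betw f (carrier G) (carrier H)" using f by (simp add: iso_def)
  show "\<forall>k. card (G.P k) = card (H.P k)"
  proof
    fix k
    have "f ` G.P k = H.P k" using f.image_pmul[OF order_refl, of "p ^ k"] fb by (simp add: bij_betw_def)
    moreover have "inj_on f (G.P k)" using fb subgroup.subset[OF G.subgroup_P] by (auto simp: bij_betw_def intro: inj_on_subset)
    ultimately show "card (G.P k) = card (H.P k)" using card_image by metis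
  qed
next
  assume cP: "\<forall>k. card (G.P k) = card (H.P k)"
  have 1: "pmul G n {\<one>\<^bsub>G\<^esub>} = {\<one>\<^bsub>G\<^esub>}" "pmul H n {\<one>\<^bsub>H\<^esub>} = {\<one>\<^bsub>H\<^esub>}" for n by (auto simp: pmul_def)
  have 2: "{\<one>\<^bsub>G\<^esub>} \<inter> G.P k = {\<one>\<^bsub>G\<^esub>}" "{\<one>\<^bsub>H\<^esub>} \<inter> H.P k = {\<one>\<^bsub>H\<^esub>}" for k
    using subgroup.one_closed[OF G.subgroup_P] subgroup.one_closed[OF H.subgroup_P] by auto
  have "\<exists>f. f \<in> iso G H \<and> f ` {\<one>\<^bsub>G\<^esub>} = {\<one>\<^bsub>H\<^esub>}"
    by (rule ex_iso_mapping[OF G.triv_subgroup H.triv_subgroup])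
       (use cP in \<open>simp_all add: 1 2 hW_def\<close>)
  then show "G \<cong> H" by (auto simp: is_iso_def)
qed

context fin_p_group
begin

lemma is_iso_Mgrp_iff: "G \<cong> Mgrp p la \<longleftrightarrow> (\<forall>k. lg (P k) = tail la k)"
proof -
  interpret M: fin_p_group "Mgrp p la" p by (rule fin_p_group_Mgrp[OF prime])
  interpret fin_p_group_pair G "Mgrp p la" p ..
  have "card (P k) = card (M.P k) \<longleftrightarrow> lg (P k) = tail la k" for k
    using card_subgroup[OF subgroup_P, of k] card_pmul_Mgrp[OF prime, of la k] prime_gt_1_nat[OF prime] power_inject_exp by simp
  then show ?thesis using is_iso_iff by simp
qed

text \<open>Row m of the type has to be the logarithm of the index of \<open>P m\<close> in
  \<open>P (m - 1)\<close>. These numbers weakly decrease by \<open>lg_pmul_le\<close>, applied to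
  \<open>P (Suc k)\<close> inside \<open>P k\<close>.\<close>

lemma ex_type: "\<exists>la. is_partition la \<and> G \<cong> Mgrp p la"
proof -
  obtain n where n: "\<forall>k\<ge>n. \<forall>H. subgroup H G \<longrightarrow> pmul G (p ^ k) H = {\<one>}" using pmul_order by blast
  have P1: "P k = {\<one>}" if "k \<ge> n" for k using n that subgroup_self by blast
  define d where "d m = lg (P (m - 1)) - lg (P m)" for m
  have le: "lg (P (Suc k)) \<le> lg (P k)" for k by (rule lg_mono[OF subgroup_P subgroup_P P_Suc_subset])
  have "d (Suc m) \<le> d m" if m1: "1 \<le> m" for m
  proof -
    obtain k where k: "m = Suc k" using m1 by (cases m) auto
    have "lg (P (Suc k)) + lg (P (Suc k)) \<le> lg (P k) + lg (P (Suc (Suc k)))"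
      using lg_pmul_le[OF subgroup_P subgroup_P P_Suc_subset, of k] unfolding pmul_P .
    then show ?thesis unfolding d_def k diff_Suc_1 by linarith
  qed
  moreover have "d m = 0" if "m > n" for m unfolding d_def using P1 that by simp
  ultimately obtain la where la: "is_partition la" "\<forall>m\<ge>1. conjp la m = d m" using ex_partition_conjp[of d n] by blast
  have "tail la k = lg (P k)" for k
  proof (rule tail_eqI[where n = n])
    show "lg (P k) = conjp la (Suc k) + lg (P (Suc k))" for k using la(2) le[of k] unfolding d_def by simp
    show "lg (P n) = 0" using P1 by simp
  qed
  then show ?thesis using la is_iso_Mgrp_iff by auto
qed

lemma grp_type: "is_partition (grp_type p G)" "lg (P k) = tail (grp_type p G) k"
  and grp_type_eqI: "is_partition la \<Longrightarrow> (\<And>k. lg (P k) = tail la k) \<Longrightarrow> grp_type p G = la"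
proof -
  have u: "la = mu" if "is_partition la" "G \<cong> Mgrp p la" "is_partition mu" "G \<cong> Mgrp p mu" for la mu
    using that partition_eq_tailI[of la mu] is_iso_Mgrp_iff by simp
  obtain la where la: "is_partition la" "G \<cong> Mgrp p la" using ex_type by blast
  have "is_partition (grp_type p G) \<and> G \<cong> Mgrp p (grp_type p G)"
    unfolding grp_type_def by (rule theI[of _ la]) (use la u in blast)+
  then show "is_partition (grp_type p G)" "lg (P k) = tail (grp_type p G) k" using is_iso_Mgrp_iff by auto
  show "grp_type p G = la" if "is_partition la" "\<And>k. lg (P k) = tail la k" for la
    unfolding grp_type_def by (rule the_equality) (use that u is_iso_Mgrp_iff in auto)
qed

end

section \<open>Types of quotients\<close>

text \<open>Stated for arbitrary surjections because it serves three kinds of maps: projections onto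
  quotients, automorphisms, and in \<open>card_extensions\<close> a projection followed by an
  isomorphism onto some \<open>Mgrp p g2\<close>.\<close>

locale fin_p_surj = fin_p_group_pair G H p for G (structure) and H (structure) and p +
  fixes h
  assumes hom: "h \<in> hom G H" and surj: "h ` carrier G = carrier H"
begin

sublocale h: group_hom G H h
  by unfold_locales (rule hom)

abbreviation "K \<equiv> kernel G H h"

lemma lg_image: 
  assumes S: "subgroup S G" and "K \<subseteq> S" shows "plog p S = plog p (h ` S) + plog p K"
proof -
  have "{x \<in> S. h x = \<one>\<^bsub>H\<^esub>} = K" using assms subgroup.subset[OF S] by (auto simp: kernel_def)
  then have "card S = card (h ` S) * card K" using h.card_subgroup_image[OF S G.finite_subgroup[OF S]] by simp
  also have "\<dots> = p ^ (plog p (h ` S) + plog p K)"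
    using H.card_subgroup[OF h.subgroup_img_is_subgroup[OF S]] G.card_subgroup[OF h.subgroup_kernel]
    by (simp add: power_add)
  finally show ?thesis using plog_eqI[OF G.prime] by blast
qed

lemma image_P: "h ` G.P k = H.P k"
  using h.image_pmul[OF order_refl] surj by simp

text \<open>Elements of S and T with the same image differ by an element of the kernel, and the
  kernel lies in S; so the one from T lies in S as well.\<close>

lemma image_Int:
  assumes S: "subgroup S G" and "K \<subseteq> S" and T: "subgroup T G"
  shows "h ` (S \<inter> T) = h ` S \<inter> h ` T"
proof
  show "h ` S \<inter> h ` T \<subseteq> h ` (S \<inter> T)"
  proof
    fix y assume "y \<in> h ` S \<inter> h ` T"
    then obtain s t where st: "s \<in> S" "t \<in> T" "y = h s" "y = h t" by auto
    have c: "s \<in> carrier G" "t \<in> carrier G" using st subgroup.mem_carrier S T by metis+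
    have "h t = h s" using st(3,4) by simp
    then have "inv\<^bsub>G\<^esub> s \<otimes>\<^bsub>G\<^esub> t \<in> K" unfolding kernel_def using c by simp
    then have "s \<otimes>\<^bsub>G\<^esub> (inv\<^bsub>G\<^esub> s \<otimes>\<^bsub>G\<^esub> t) \<in> S" using assms(2) st(1) subgroup.m_closed[OF S] by blast
    then have "t \<in> S" using c by (simp add: G.m_assoc[symmetric])
    then show "y \<in> h ` (S \<inter> T)" using st(2,4) by blast
  qed
qed auto

lemma image_set_mult: "S \<subseteq> carrier G \<Longrightarrow> T \<subseteq> carrier G \<Longrightarrow> h ` (S <#>\<^bsub>G\<^esub> T) = h ` S <#>\<^bsub>H\<^esub> h ` T"
  by (rule set_mult_hom[OF hom])

end

lemma (in fin_p_group) fin_p_group_Mod: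
  assumes N: "subgroup N G" shows "fin_p_group (G Mod N) p"
proof (intro fin_p_group.intro fin_p_group_axioms.intro prime)
  show "comm_group (G Mod N)" by (rule abelian_FactGroup[OF N])
  show "finite (carrier (G Mod N))" unfolding carrier_FactGroup using finite_carrier by simp
  obtain n where n: "order G = p ^ n" using order_power by auto
  have "order (G Mod N) dvd p ^ n" using lagrange[OF N] n unfolding order_def FactGroup_def by (metis dvd_triv_left partial_object.select_convs(1))
  then show "\<exists>n. order (G Mod N) = p ^ n" using divides_primepow_nat[OF prime] by auto
qed

lemma (in fin_p_group) fin_p_surj_Mod:
  assumes N: "subgroup N G" shows "fin_p_surj G (G Mod N) p (\<lambda>x. N #> x)"
proof -
  interpret M: fin_p_group "G Mod N" p by (rule fin_p_group_Mod[OF N])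
  interpret N: normal N G by (rule subgroup_imp_normal[OF N])
  show ?thesis
    by unfold_locales (auto simp: N.r_coset_hom_Mod carrier_FactGroup)
qed

lemma (in fin_p_group) kernel_Mod:
  assumes N: "subgroup N G" shows "kernel G (G Mod N) (\<lambda>x. N #> x) = N"
  using subgroup.subset[OF N] coset_join1[OF _ _ N] coset_join2[OF _ N] by (auto simp: kernel_def)

section \<open>Row lengths of the types of quotients\<close>

context fin_p_group
begin

abbreviation "qt N \<equiv> grp_type p (G Mod N)"

lemma qt_partition: "subgroup N G \<Longrightarrow> is_partition (qt N)"
  using fin_p_group.grp_type(1)[OF fin_p_group_Mod] .

lemma lg_P_Mod: 
  assumes N: "subgroup N G" 
  shows "lg (P k <#> N) = lg (pmul (G Mod N) (p ^ k) (carrier (G Mod N))) + lg N"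
proof -
  interpret S: fin_p_surj G "G Mod N" p "\<lambda>x. N #> x" by (rule fin_p_surj_Mod[OF N])
  have sub: "subgroup (P k <#> N) G" by (rule mult_subgroups[OF subgroup_P N])
  have "N \<subseteq> P k <#> N" by (rule set_mult_right_subset[OF subgroup_P subgroup.subset[OF N]])
  then have "lg (P k <#> N) = lg ((\<lambda>x. N #> x) ` (P k <#> N)) + lg N" using S.lg_image[OF sub] kernel_Mod[OF N] by simp
  also have "(\<lambda>x. N #> x) ` (P k <#> N) = (\<lambda>x. N #> x) ` P k <#>\<^bsub>G Mod N\<^esub> (\<lambda>x. N #> x) ` N"
    using S.image_set_mult subgroup.subset[OF N] subgroup.subset[OF subgroup_P] by blast
  also have "(\<lambda>x. N #> x) ` N = {\<one>\<^bsub>G Mod N\<^esub>}"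
    using coset_join2[OF subgroup.mem_carrier[OF N] N] subgroup.one_closed[OF N] by (auto simp: image_iff)
  also have "(\<lambda>x. N #> x) ` P k <#>\<^bsub>G Mod N\<^esub> {\<one>\<^bsub>G Mod N\<^esub>} = (\<lambda>x. N #> x) ` P k"
    using S.H.set_mult_least[OF S.h.subgroup_img_is_subgroup[OF subgroup_P[of k]] order_refl, of "{\<one>\<^bsub>G Mod N\<^esub>}"]
      S.H.set_mult_left_subset[OF S.H.triv_subgroup, of "(\<lambda>x. N #> x) ` P k"]
      subgroup.one_closed[OF S.h.subgroup_img_is_subgroup[OF subgroup_P[of k]]]
      subgroup.subset[OF S.h.subgroup_img_is_subgroup[OF subgroup_P[of k]]]
    by (intro equalityI) auto
  finally show ?thesis unfolding S.image_P .
qed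

lemma qt_tail': "subgroup N G \<Longrightarrow> lg (P k <#> N) = tail (qt N) k + lg N"
  using lg_P_Mod[of N k] fin_p_group.grp_type(2)[OF fin_p_group_Mod[of N]] by simp

text \<open>The group p^k(G/N) is isomorphic to p^k G/(N \<inter> p^k G). Hence, for given type of
  G, the type of G/N and the orders of all N \<inter> p^k G carry the same information. This is how
  orders are read off a tableau.\<close>

lemma qt_tail: "subgroup N G \<Longrightarrow> lg (P k) = tail (qt N) k + lg (N \<inter> P k)"
  using qt_tail'[of N k] lg_set_mult[OF subgroup_P[of k], of N] by (simp add: Int_commute)

lemma qt_eqI':
  assumes N: "subgroup N G" and la: "is_partition la" and eq: "\<And>k. lg (P k <#> N) = tail la k + lg N" shows "qt N = la"
  using qt_tail'[OF N] eq by (intro partition_eq_tailI qt_partition N la) simp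

lemma qt_eqI:
  assumes N: "subgroup N G" and la: "is_partition la" and eq: "\<And>k. lg (P k) = tail la k + lg (N \<inter> P k)" shows "qt N = la"
  using qt_tail[OF N] eq by (intro partition_eq_tailI qt_partition N la) simp

text \<open>The difference of two consecutive instances of \<open>qt_tail\<close>, arranged so that
  no subtraction of natural numbers occurs.\<close>

lemma conjp_qt: 
  assumes N: "subgroup N G" 
  shows "conjp (qt N) (Suc k) + lg (P (Suc k)) + lg (N \<inter> P k) = lg (P k) + lg (N \<inter> P (Suc k))"
  using qt_tail[OF N, of k] qt_tail[OF N, of "Suc k"] tail_Suc[of "qt N" k] by linarith

lemma tail_qt_0: "subgroup N G \<Longrightarrow> tail (qt N) 0 + lg N = lg (carrier G)"
  using qt_tail[of N 0] subgroup.subset[of N G] by (simp add: Int_absorb2)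

text \<open>By \<open>conjp_qt\<close> the claim compares the index of N \<inter> p^(k+1) G in N
  \<inter> p^k G with the same index for N'. The first quotient embeds into the second, because an
  element of N lying in N' \<inter> p^(k+1) G lies in N \<inter> p^(k+1) G.\<close>

lemma conjp_qt_mono:
  assumes N: "subgroup N G" and N': "subgroup N' G" and "N \<subseteq> N'" 
  shows "conjp (qt N') (Suc k) \<le> conjp (qt N) (Suc k)"
proof -
  have s: "subgroup (N \<inter> P k) G" "subgroup (N' \<inter> P (Suc k)) G" "subgroup (N' \<inter> P k) G"
    by (intro subgroup_Int_P N N')+
  have "(N \<inter> P k) <#> (N' \<inter> P (Suc k)) \<subseteq> N' \<inter> P k"
    using set_mult_least[OF s(3), of "N \<inter> P k" "N' \<inter> P (Suc k)"] \<open>N \<subseteq> N'\<close> P_Suc_subset by blast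
  then have "lg ((N \<inter> P k) <#> (N' \<inter> P (Suc k))) \<le> lg (N' \<inter> P k)"
    by (intro lg_mono mult_subgroups s)
  moreover have "(N \<inter> P k) \<inter> (N' \<inter> P (Suc k)) = N \<inter> P (Suc k)" using \<open>N \<subseteq> N'\<close> P_Suc_subset[of k] by blast
  ultimately show ?thesis using conjp_qt[OF N, of k] conjp_qt[OF N', of k] lg_set_mult[OF s(1,2)] by simp
qed

lemma set_mult_one_right: "subgroup N G \<Longrightarrow> N <#> {\<one>} = N"
  using set_mult_least[of N N "{\<one>}"] set_mult_left_subset[OF triv_subgroup, of N] subgroup.one_closed[of N G] subgroup.subset[of N G]
  by (intro equalityI) auto

lemma set_mult_one_left: "subgroup N G \<Longrightarrow> {\<one>} <#> N = N"
  using set_mult_absorb[OF _ triv_subgroup, of N] subgroup.one_closed[of N G] by simp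

text \<open>Apply \<open>lg_pmul_le\<close> to H = p^(k+1) G + (N \<inter> p^k G) inside p^k G;
  since pN is trivial, pH is p^(k+2) G. For the diagrams this means that a column gains at most one
  box in the passage from G/N to G.\<close>

lemma conjp_qt_interlace:
  assumes N: "subgroup N G" and pN: "pmul G p N = {\<one>}"
  shows "conjp (qt {\<one>}) (Suc (Suc k)) \<le> conjp (qt N) (Suc k)"
proof -
  let ?H = "P (Suc k) <#> (N \<inter> P k)"
  have s: "subgroup (N \<inter> P k) G" using N subgroup_Int_P by auto
  have H: "subgroup ?H G" by (intro mult_subgroups subgroup_P s)
  have c: "P k \<subseteq> carrier G" "N \<inter> P k \<subseteq> carrier G" for k using subgroup.subset subgroup_P by blast+
  have HP: "?H \<subseteq> P k" using set_mult_least[OF subgroup_P[of k] P_Suc_subset] by blast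
  have "pmul G p (N \<inter> P k) = {\<one>}"
    using pmul_mono[of "N \<inter> P k" N G p] pN subgroup.one_closed[OF pmul_subgroup[OF s]] by blast
  then have "pmul G p ?H = P (Suc (Suc k))"
    unfolding pmul_set_mult[OF c(1) c(2)] pmul_P by (simp only: set_mult_one_right[OF subgroup_P])
  then have "lg (P (Suc k)) + lg ?H \<le> lg (P k) + lg (P (Suc (Suc k)))"
    using lg_pmul_le[OF H subgroup_P HP] unfolding pmul_P by simp
  moreover have "P (Suc k) \<inter> (N \<inter> P k) = N \<inter> P (Suc k)" using P_Suc_subset[of k] by blast
  then have "lg ?H + lg (N \<inter> P (Suc k)) = lg (P (Suc k)) + lg (N \<inter> P k)"
    using lg_set_mult[OF subgroup_P[of "Suc k"] s] by simp
  moreover have "{\<one>} \<inter> P j = {\<one>}" for j using subgroup.one_closed[OF subgroup_P] by auto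
  ultimately show ?thesis using conjp_qt[OF N, of k] conjp_qt[OF triv_subgroup, of "Suc k"] by (simp del: power_Suc)
qed

text \<open>The subgroup lies in p^(r+1) G, so dividing by it leaves the first r + 1 rows unchanged.
  This makes the subscript of a box smaller than its row.\<close>

lemma conjp_hW_eq:
  assumes A: "subgroup A G" and "k \<le> r"
  shows "conjp (qt (hW G p A r)) (Suc k) = conjp (qt {\<one>}) (Suc k)"
proof -
  have "hW G p A r \<subseteq> P (Suc r)" by (rule hW_subset_P)
  then have "hW G p A r \<inter> P k = hW G p A r" "hW G p A r \<inter> P (Suc k) = hW G p A r"
    using P_antimono[of "Suc k" "Suc r"] P_Suc_subset[of k] \<open>k \<le> r\<close> by blast+
  moreover have "{\<one>} \<inter> P j = {\<one>}" for j using subgroup.one_closed[OF subgroup_P] by auto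
  ultimately show ?thesis using conjp_qt[OF subgroup_hW[OF A], of r k] conjp_qt[OF triv_subgroup, of k] by (simp del: power_Suc)
qed

text \<open>The argument of \<open>conjp_qt_interlace\<close> for A without pA = 0: now pH is
  p^(k+2) G + p(A \<inter> p^k G). The result is condition (iii) on subscripts, about boxes directly
  below a box of the previous stripe.\<close>

lemma conjp_hW_le:
  assumes A: "subgroup A G"
  shows "conjp (qt (hW G p A k)) (Suc (Suc k)) \<le> conjp (qt A) (Suc k)"
proof -
  let ?H = "P (Suc k) <#> (A \<inter> P k)" and ?W = "hW G p A k"
  have s: "subgroup (A \<inter> P k) G" using A subgroup_Int_P by auto
  have H: "subgroup ?H G" by (intro mult_subgroups subgroup_P s)
  have c: "P k \<subseteq> carrier G" "A \<inter> P k \<subseteq> carrier G" for k using subgroup.subset subgroup_P by blast+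
  have HP: "?H \<subseteq> P k" using set_mult_least[OF subgroup_P[of k] P_Suc_subset] by blast
  have "pmul G p ?H = P (Suc (Suc k)) <#> ?W"
    unfolding pmul_set_mult[OF c(1) c(2)] pmul_P hW_def ..
  then have 1: "lg (P (Suc k)) + lg ?H \<le> lg (P k) + lg (P (Suc (Suc k)) <#> ?W)"
    using lg_pmul_le[OF H subgroup_P HP] unfolding pmul_P by simp
  have "P (Suc k) \<inter> (A \<inter> P k) = A \<inter> P (Suc k)" using P_Suc_subset[of k] by blast
  then have 2: "lg ?H + lg (A \<inter> P (Suc k)) = lg (P (Suc k)) + lg (A \<inter> P k)"
    using lg_set_mult[OF subgroup_P[of "Suc k"] s] by simp
  have 3: "lg (P (Suc (Suc k)) <#> ?W) + lg (?W \<inter> P (Suc (Suc k))) = lg (P (Suc (Suc k))) + lg ?W"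
    using lg_set_mult[OF subgroup_P[of "Suc (Suc k)"] subgroup_hW[OF A, of k]] by (simp add: Int_commute)
  have 4: "?W \<inter> P (Suc k) = ?W" using hW_subset_P[of A k] by blast
  show ?thesis
    using conjp_qt[OF subgroup_hW[OF A], of k "Suc k"] conjp_qt[OF A, of k] 1 2 3 unfolding 4 by linarith
qed

text \<open>Apply \<open>lg_pmul_le\<close> to (A \<inter> p^(k+1) G) + (pA \<inter> p^k G) inside A
  \<inter> p^k G; as p^2 A is trivial, the second summand is killed by p. This is condition (iv):
  the difference of the orders of the two groups \<open>hW\<close> counts the boxes with subscript k
  + 1, and that of the two rows the boxes labelled 1 in row k + 1.\<close>

lemma lg_hW_le:
  assumes A: "subgroup A G" and pA: "pmul G (p ^ 2) A = {\<one>}"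
  shows "lg (hW G p A k) + conjp (qt A) (Suc k) \<le> lg (hW G p A (Suc k)) + conjp (qt (pmul G p A)) (Suc k)"
proof -
  let ?V = "pmul G p A \<inter> P k"
  have s: "subgroup (A \<inter> P k) G" "subgroup (A \<inter> P (Suc k)) G" by (rule subgroup_Int_P[OF A])+
  have V: "subgroup ?V G" using pmul_subgroup[OF A] subgroup_Int_P by auto
  let ?H = "(A \<inter> P (Suc k)) <#> ?V"
  have H: "subgroup ?H G" by (intro mult_subgroups V s)
  have c: "A \<inter> P (Suc k) \<subseteq> carrier G" "?V \<subseteq> carrier G" using subgroup.subset V s by blast+
  have HP: "?H \<subseteq> A \<inter> P k" using set_mult_least[OF s(1), of "A \<inter> P (Suc k)" ?V] P_Suc_subset pmul_subset[OF A] by blast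
  have "pmul G p ?V \<subseteq> pmul G (p ^ 2) A"
    using pmul_mono[of ?V "pmul G p A" G p] subgroup.subset[OF A] by (simp add: pmul_pmul power2_eq_square)
  then have "pmul G p ?V = {\<one>}" using pA subgroup.one_closed[OF pmul_subgroup[OF V]] by blast
  then have "pmul G p ?H = hW G p A (Suc k)"
    unfolding pmul_set_mult[OF c] hW_def using set_mult_one_right[OF pmul_subgroup[OF s(2)]] by simp
  then have 1: "lg (hW G p A k) + lg ?H \<le> lg (A \<inter> P k) + lg (hW G p A (Suc k))"
    using lg_pmul_le[OF H s(1) HP] unfolding hW_def by simp
  have "(A \<inter> P (Suc k)) \<inter> ?V = pmul G p A \<inter> P (Suc k)" using P_Suc_subset[of k] pmul_subset[OF A, of p] by blast
  then have "lg ?H + lg (pmul G p A \<inter> P (Suc k)) = lg (A \<inter> P (Suc k)) + lg ?V"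
    using lg_set_mult[OF s(2) V] by simp
  then show ?thesis using conjp_qt[OF A, of k] conjp_qt[OF pmul_subgroup[OF A, of p], of k] 1 by linarith
qed

lemma emb_gamma_qt: "emb_gamma p G A i = qt (pmul G (p ^ i) A)"
  unfolding emb_gamma_def ..

lemma emb_gamma2_qt: "subgroup A G \<Longrightarrow> emb_gamma2 p G A 2 r = qt (pmul G (p ^ 2) A <#> hW G p A r)"
  unfolding emb_gamma2_def hW_def using subgroup.subset[of A G] by simp

text \<open>Replacing A by p^j A drops the first j stripes of the tableau, which permits arguing
  with two stripes at a time.\<close>

lemma emb_gamma_shift: "subgroup A G \<Longrightarrow> emb_gamma p G (pmul G (p ^ j) A) i = emb_gamma p G A (j + i)"
  unfolding emb_gamma_def using subgroup.subset[of A G] by (simp add: pmul_pmul power_add)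

text \<open>The bound on l keeps the exponent l - 2 in \<open>emb_gamma2\<close> from being
  truncated.\<close>

lemma emb_phi_shift:
  assumes A: "subgroup A G" and "2 \<le> l" 
  shows "emb_phi p G (pmul G (p ^ j) A) l = emb_phi p G A (j + l)"
proof -
  have g2: "emb_gamma2 p G (pmul G (p ^ j) A) l r = emb_gamma2 p G A (j + l) r" for r
    unfolding emb_gamma2_def using subgroup.subset[OF A] \<open>2 \<le> l\<close> by (simp add: pmul_pmul power_add[symmetric])
  have "j + l - 1 = j + (l - 1)" using \<open>2 \<le> l\<close> by simp
  then show ?thesis unfolding emb_phi_def g2 emb_gamma_shift[OF A] by simp
qed

end

section \<open>Invariance of tableaux under surjections\<close>

context fin_p_surj
begin

text \<open>The quotients G/N and H/h(N) are isomorphic; here only the orders that determine the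
  types are compared.\<close>

lemma qt_image:
  assumes N: "subgroup N G" and "K \<subseteq> N" shows "H.qt (h ` N) = G.qt N"
proof (rule H.qt_eqI'[OF h.subgroup_img_is_subgroup[OF N] G.qt_partition[OF N]])
  fix k
  have s: "subgroup (G.P k <#>\<^bsub>G\<^esub> N) G" by (intro G.mult_subgroups G.subgroup_P N)
  have "K \<subseteq> G.P k <#>\<^bsub>G\<^esub> N" using assms(2) G.set_mult_right_subset[OF G.subgroup_P subgroup.subset[OF N]] by blast
  then have "plog p (G.P k <#>\<^bsub>G\<^esub> N) = plog p (H.P k <#>\<^bsub>H\<^esub> h ` N) + plog p K"
    using lg_image[OF s] image_set_mult[OF subgroup.subset[OF G.subgroup_P] subgroup.subset[OF N]] image_P by simp
  then show "plog p (H.P k <#>\<^bsub>H\<^esub> h ` N) = tail (G.qt N) k + plog p (h ` N)"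
    using G.qt_tail'[OF N, of k] lg_image[OF N assms(2)] by simp
qed

lemma image_hW:
  assumes A: "subgroup A G" and "K \<subseteq> A" shows "h ` hW G p A r = hW H p (h ` A) r"
proof -
  have "A \<inter> G.P r \<subseteq> carrier G" using subgroup.subset[OF A] by blast
  then show ?thesis unfolding hW_def h.image_pmul image_Int[OF A assms(2) G.subgroup_P]
    using h.image_pmul image_P image_Int[OF A assms(2) G.subgroup_P] by simp
qed

text \<open>The first n stripes depend on A only modulo p^n A, so the kernel may be divided out as
  long as it is contained there. With the kernel equal to p^2 A this reduces statements on three
  consecutive partitions to subgroups killed by p^2.\<close>

lemma emb_image:
  assumes A: "subgroup A G" and K: "K \<subseteq> pmul G (p ^ n) A" 
  shows "i \<le> n \<Longrightarrow> emb_gamma p H (h ` A) i = emb_gamma p G A i"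
    and "n = 2 \<Longrightarrow> emb_phi p H (h ` A) 2 = emb_phi p G A 2"
proof -
  show g: "emb_gamma p H (h ` A) i = emb_gamma p G A i" if "i \<le> n" for i
  proof -
    have "pmul G (p ^ n) A \<subseteq> pmul G (p ^ i) A"
    proof -
      have "pmul G (p ^ n) A = pmul G (p ^ i) (pmul G (p ^ (n - i)) A)"
        using subgroup.subset[OF A] that by (simp add: G.pmul_pmul power_add[symmetric])
      also have "\<dots> \<subseteq> pmul G (p ^ i) A" by (intro pmul_mono G.pmul_subset A)
      finally show ?thesis .
    qed
    then have "H.qt (h ` pmul G (p ^ i) A) = G.qt (pmul G (p ^ i) A)"
      using K by (intro qt_image G.pmul_subgroup A) blast
    then show ?thesis unfolding H.emb_gamma_qt G.emb_gamma_qt h.image_pmul[OF subgroup.subset[OF A]] .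
  qed
  show "emb_phi p H (h ` A) 2 = emb_phi p G A 2" if n: "n = 2"
  proof -
    have "emb_gamma2 p H (h ` A) 2 r = emb_gamma2 p G A 2 r" for r
    proof -
      let ?N = "pmul G (p ^ 2) A <#>\<^bsub>G\<^esub> hW G p A r"
      have N: "subgroup ?N G" by (intro G.mult_subgroups G.pmul_subgroup G.subgroup_hW A)
      have "K \<subseteq> ?N" using K G.set_mult_left_subset[OF G.subgroup_hW[OF A] subgroup.subset[OF G.pmul_subgroup[OF A, of "p ^ 2"]], of r]
        unfolding n by blast
      then have "H.qt (h ` ?N) = G.qt ?N" using N by (intro qt_image)
      moreover have KA: "K \<subseteq> A" using K G.pmul_subset[OF A] by blast
      have "h ` ?N = pmul H (p ^ 2) (h ` A) <#>\<^bsub>H\<^esub> hW H p (h ` A) r"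
        unfolding image_set_mult[OF subgroup.subset[OF G.pmul_subgroup[OF A]] subgroup.subset[OF G.subgroup_hW[OF A]]]
          image_hW[OF A KA] h.image_pmul[OF subgroup.subset[OF A]] ..
      ultimately show ?thesis
        unfolding H.emb_gamma2_qt[OF h.subgroup_img_is_subgroup[OF A]] G.emb_gamma2_qt[OF A] by simp
    qed
    then show ?thesis unfolding emb_phi_def using g n by simp
  qed
qed

end

section \<open>Subscripts of boxes\<close>

lemma part_antimono: assumes "is_partition la" "1 \<le> i" "i \<le> j" shows "part la j \<le> part la i"
proof (cases "part la j = 0")
  case False
  then show ?thesis
    using part_ge_iff[OF assms(1), of "part la j" j] part_ge_iff[OF assms(1), of "part la j" i] assms by simp
qed simp

lemma part_pos_iff: "is_partition la \<Longrightarrow> 1 \<le> i \<Longrightarrow> 0 < part la i \<longleftrightarrow> i \<le> length la"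
  using part_ge_iff[of la 1 i] conjp_1[of la] by (simp add: Suc_le_eq)

lemma part_le_partI:
  assumes la: "is_partition la" and mu: "is_partition mu" and le: "\<And>m. 1 \<le> m \<Longrightarrow> conjp la m \<le> conjp mu m"
  shows "part la i \<le> part mu i"
proof (cases "part la i = 0")
  case False
  then have "1 \<le> i" by (auto simp: part_def split: if_splits)
  then show ?thesis using part_ge_iff[OF la, of "part la i" i] part_ge_iff[OF mu, of "part la i" i] le[of "part la i"] False
    by simp
qed simp

lemma part_le_part_SucI:
  assumes la: "is_partition la" and mu: "is_partition mu" and le: "\<And>m. 1 \<le> m \<Longrightarrow> conjp mu (Suc m) \<le> conjp la m"
  shows "part mu i \<le> Suc (part la i)"
proof (cases "part mu i \<le> 1")
  case False
  then obtain m where m: "part mu i = Suc m" "1 \<le> m" by (cases "part mu i") auto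
  then have "1 \<le> i" by (auto simp: part_def split: if_splits)
  then show ?thesis using part_ge_iff[OF la, of m i] part_ge_iff[OF mu, of "Suc m" i] le[of m] m by simp
qed simp

lemma skew_iff:
  assumes "is_partition la" "is_partition mu"
  shows "(i, m) \<in> skew mu la \<longleftrightarrow> 1 \<le> m \<and> conjp la m < i \<and> i \<le> conjp mu m"
proof (cases "1 \<le> i \<and> 1 \<le> m")
  case True
  then show ?thesis using part_ge_iff[OF assms(1), of m i] part_ge_iff[OF assms(2), of m i] by (auto simp: skew_def)
qed (auto simp: skew_def)

lemma tail_sum: "tail la 0 = (\<Sum>m<N. conjp la (Suc m)) + tail la N"
proof (induction N)
  case (Suc N)
  then show ?case using tail_Suc[of la N] by simp
qed simp

lemma tail_large: "sum_list la \<le> N \<Longrightarrow> tail la N = 0"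
  by (induction la) (auto simp: tail_def)

lemma row_skew:
  assumes "is_partition la" "is_partition mu" "1 \<le> m"
  shows "{b \<in> skew mu la. snd b = m} = (\<lambda>i. (i, m)) ` {conjp la m<..conjp mu m}"
  using skew_iff[OF assms(1,2)] assms(3) by (auto simp: image_iff)

lemma card_row_skew:
  assumes "is_partition la" "is_partition mu" "1 \<le> m"
  shows "card {b \<in> skew mu la. snd b = m} = conjp mu m - conjp la m"
  unfolding row_skew[OF assms] by (subst card_image) (auto simp: inj_on_def)

lemma skew_Sigma:
  assumes "is_partition la" "is_partition mu" "sum_list mu \<le> N"
  shows "skew mu la = (\<Union>m\<in>{..<N}. {b \<in> skew mu la. snd b = Suc m})"
proof (intro equalityI subsetI)
  fix b assume b: "b \<in> skew mu la"
  then obtain i m where im: "b = (i, m)" "1 \<le> m" "i \<le> conjp mu m" "conjp la m < i" using skew_iff[OF assms(1,2)] by (cases b) auto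
  have "m \<le> N"
  proof (rule ccontr)
    assume "\<not> m \<le> N"
    then have "conjp mu m \<le> conjp mu (Suc N)" by (intro conjp_antimono) simp
    also have "\<dots> = 0" using tail_large[OF assms(3)] tail_Suc[of mu N] by simp
    finally show False using im by simp
  qed
  then show "b \<in> (\<Union>m\<in>{..<N}. {b \<in> skew mu la. snd b = Suc m})" using b im by (auto intro!: bexI[of _ "m - 1"])
qed auto

lemma finite_skew: "finite (skew mu la)"
proof (rule finite_subset)
  show "skew mu la \<subseteq> {..length mu} \<times> {..sum_list mu}"
  proof (clarify)
    fix i m assume "(i, m) \<in> skew mu la"
    then have i: "1 \<le> i" "m \<le> part mu i" "part mu i \<noteq> 0" by (auto simp: skew_def)
    then have "i - 1 < length mu" "part mu i = mu ! (i - 1)" by (auto simp: part_def split: if_splits)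
    then show "i \<in> {..length mu} \<and> m \<in> {..sum_list mu}"
      using i member_le_sum_list[of "mu ! (i - 1)" mu] by auto
  qed
qed simp

lemma card_skew:
  assumes la: "is_partition la" and mu: "is_partition mu" and le: "\<And>m. 1 \<le> m \<Longrightarrow> conjp la m \<le> conjp mu m"
  shows "card (skew mu la) + tail la 0 = tail mu 0"
proof -
  define N where "N = sum_list la + sum_list mu"
  have "card (skew mu la) = card (\<Union>m\<in>{..<N}. {b \<in> skew mu la. snd b = Suc m})"
    using skew_Sigma[OF la mu, of N] unfolding N_def by simp
  also have "\<dots> = (\<Sum>m<N. card {b \<in> skew mu la. snd b = Suc m})"
    by (rule card_UN_disjoint) (auto simp: finite_skew)
  also have "\<dots> = (\<Sum>m<N. conjp mu (Suc m) - conjp la (Suc m))" using card_row_skew[OF la mu] by simp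
  finally have "card (skew mu la) + (\<Sum>m<N. conjp la (Suc m)) = (\<Sum>m<N. conjp mu (Suc m))"
    using le by (simp add: sum.distrib[symmetric])
  then show ?thesis using tail_sum[of la N] tail_sum[of mu N] tail_large[of la N] tail_large[of mu N] unfolding N_def by simp
qed

text \<open>The predicate under the definite description in \<open>emb_phi\<close>, with S for the
  stripe and T for the function \<open>emb_gamma2 p B A l\<close>.\<close>

definition phi_spec :: "(nat \<times> nat) set \<Rightarrow> (nat \<Rightarrow> nat list) \<Rightarrow> (nat \<times> nat \<Rightarrow> nat) \<Rightarrow> bool" where
  "phi_spec S T ph \<longleftrightarrow> (\<forall>b. b \<notin> S \<longrightarrow> ph b = 0) \<and> (\<forall>b\<in>S. 1 \<le> ph b) \<and>
     (\<forall>i j m. (i, m) \<in> S \<and> (j, m) \<in> S \<and> i < j \<longrightarrow> ph (i, m) \<le> ph (j, m)) \<and>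
     (\<forall>m r. 1 \<le> m \<and> 1 \<le> r \<longrightarrow>
        int (card {b \<in> S. snd b = m \<and> ph b = r}) = int (conjp (T r) m) - int (conjp (T (r - 1)) m))"

lemma phi_specD:
  assumes "phi_spec S T ph"
  shows "b \<notin> S \<Longrightarrow> ph b = 0" "b \<in> S \<Longrightarrow> 1 \<le> ph b"
    "(i, m) \<in> S \<Longrightarrow> (j, m) \<in> S \<Longrightarrow> i < j \<Longrightarrow> ph (i, m) \<le> ph (j, m)"
    "1 \<le> m \<Longrightarrow> 1 \<le> r \<Longrightarrow>
      int (card {b \<in> S. snd b = m \<and> ph b = r}) = int (conjp (T r) m) - int (conjp (T (r - 1)) m)"
  using assms unfolding phi_spec_def by blast+

lemma emb_phi_the:
  "emb_phi p B A l = (THE ph. phi_spec (skew (emb_gamma p B A l) (emb_gamma p B A (l - 1))) (emb_gamma2 p B A l) ph)"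
  unfolding emb_phi_def phi_spec_def Let_def ..

text \<open>In the applications \<open>T r\<close> is the partition called \<open>\<gamma>\<close> with superscripts \<open>\<ell>,r\<close> in the definition
  of the Klein tableau of an embedding. The subscript of a box \<open>(i, m)\<close> is then the least \<open>r\<close> such
  that the box belongs to \<open>T r\<close>.\<close>

locale subscript_chain =
  fixes g1 g2 :: "nat list" and T :: "nat \<Rightarrow> nat list"
  assumes g1: "is_partition g1" and g2: "is_partition g2"
    and T0: "\<And>m. 1 \<le> m \<Longrightarrow> conjp (T 0) m = conjp g1 m"
    and Tmono: "\<And>r m. 1 \<le> m \<Longrightarrow> conjp (T r) m \<le> conjp (T (Suc r)) m"
    and Tstab: "\<And>r m. m \<le> Suc r \<Longrightarrow> 1 \<le> m \<Longrightarrow> conjp (T r) m = conjp g2 m"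
begin

lemma T_mono: "1 \<le> m \<Longrightarrow> r \<le> s \<Longrightarrow> conjp (T r) m \<le> conjp (T s) m"
  using lift_Suc_mono_le[of "\<lambda>r. conjp (T r) m"] Tmono by blast

lemma T_le: "1 \<le> m \<Longrightarrow> conjp (T r) m \<le> conjp g2 m"
  using T_mono[of m r "max r m"] Tstab[of m "max r m"] by simp

text \<open>Summing the prescribed counts over the subscripts up to r telescopes: exactly
  \<open>conjp (T r) m - conjp g1 m\<close> boxes of row m have subscript at most r. Subscripts
  increase weakly along the row, so these are its leftmost boxes.\<close>

lemma phi_spec_le_iff:
  assumes ph: "phi_spec (skew g2 g1) T ph" and im: "(i, m) \<in> skew g2 g1"
  shows "ph (i, m) \<le> r \<longleftrightarrow> i \<le> conjp (T r) m"
proof -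
  let ?S = "skew g2 g1"
  note sk = skew_iff[OF g1 g2]
  have m: "1 \<le> m" using im sk by simp
  define L where "L r = {b \<in> ?S. snd b = m \<and> ph b \<le> r}" for r
  have fin: "finite (L r)" for r unfolding L_def using finite_skew[of g2 g1] by simp
  have cardL: "card (L r) + conjp g1 m = conjp (T r) m" for r
  proof (induction r)
    case 0
    have "L 0 = {}" unfolding L_def using phi_specD(2)[OF ph] by fastforce
    then show ?case using T0[OF m] by simp
  next
    case (Suc r)
    have "L (Suc r) = L r \<union> {b \<in> ?S. snd b = m \<and> ph b = Suc r}" unfolding L_def by auto
    moreover have "L r \<inter> {b \<in> ?S. snd b = m \<and> ph b = Suc r} = {}" unfolding L_def by auto
    ultimately have "card (L (Suc r)) = card (L r) + card {b \<in> ?S. snd b = m \<and> ph b = Suc r}"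
      using fin[of r] finite_skew[of g2 g1] by (simp add: card_Un_disjoint)
    moreover have "int (card {b \<in> ?S. snd b = m \<and> ph b = Suc r}) = int (conjp (T (Suc r)) m) - int (conjp (T r) m)"
      using phi_specD(4)[OF ph m, of "Suc r"] by simp
    ultimately show ?case using Suc by simp
  qed
  show ?thesis
  proof
    assume le: "ph (i, m) \<le> r"
    have "(\<lambda>j. (j, m)) ` {conjp g1 m<..i} \<subseteq> L r"
    proof
      fix b assume "b \<in> (\<lambda>j. (j, m)) ` {conjp g1 m<..i}"
      then obtain j where j: "b = (j, m)" "conjp g1 m < j" "j \<le> i" by auto
      then have jS: "(j, m) \<in> ?S" using im sk by auto
      have "ph (j, m) \<le> ph (i, m)"
      proof (cases "j = i")
        case False
        then show ?thesis using phi_specD(3)[OF ph jS im] j by simp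
      qed simp
      then show "b \<in> L r" using jS j le unfolding L_def by auto
    qed
    then have "card ((\<lambda>j. (j, m)) ` {conjp g1 m<..i}) \<le> card (L r)" by (intro card_mono fin)
    also have "card ((\<lambda>j. (j, m)) ` {conjp g1 m<..i}) = i - conjp g1 m" by (subst card_image) (auto simp: inj_on_def)
    finally show "i \<le> conjp (T r) m" using cardL[of r] by simp
  next
    assume le: "i \<le> conjp (T r) m"
    show "ph (i, m) \<le> r"
    proof (rule ccontr)
      assume n: "\<not> ph (i, m) \<le> r"
      have "L r \<subseteq> (\<lambda>j. (j, m)) ` {conjp g1 m<..<i}"
      proof
        fix b assume b: "b \<in> L r"
        then obtain j where j: "b = (j, m)" "(j, m) \<in> ?S" "ph (j, m) \<le> r" unfolding L_def by (cases b) auto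
        have "\<not> i \<le> j"
        proof
          assume "i \<le> j"
          then have "i < j" using j n by (cases "i = j") auto
          then show False using phi_specD(3)[OF ph im j(2)] j(3) n by simp
        qed
        then show "b \<in> (\<lambda>j. (j, m)) ` {conjp g1 m<..<i}" using j sk by auto
      qed
      then have "card (L r) \<le> card ((\<lambda>j. (j, m)) ` {conjp g1 m<..<i})" by (intro card_mono) auto
      also have "\<dots> = i - Suc (conjp g1 m)" by (subst card_image) (auto simp: inj_on_def)
      finally show False using cardL[of r] le im sk by auto
    qed
  qed
qed

lemma phi_spec_unique:
  assumes "phi_spec (skew g2 g1) T ph" "phi_spec (skew g2 g1) T ph'" shows "ph = ph'"
proof
  fix b :: "nat \<times> nat"
  obtain i m where b: "b = (i, m)" by (cases b)
  show "ph b = ph' b"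
  proof (cases "b \<in> skew g2 g1")
    case True
    then have "ph (i, m) \<le> r \<longleftrightarrow> ph' (i, m) \<le> r" for r
      using phi_spec_le_iff[OF assms(1), of i m r] phi_spec_le_iff[OF assms(2), of i m r] b by simp
    then show ?thesis unfolding b by (meson order_antisym order_refl)
  next
    case False
    then show ?thesis using phi_specD(1)[OF assms(1)] phi_specD(1)[OF assms(2)] by simp
  qed
qed

lemma phi_spec_exists: "\<exists>ph. phi_spec (skew g2 g1) T ph"
proof -
  let ?S = "skew g2 g1"
  note sk = skew_iff[OF g1 g2]
  define ph where "ph b = (if b \<in> ?S then (LEAST r. fst b \<le> conjp (T r) (snd b)) else 0)" for b
  have le: "ph (i, m) \<le> r \<longleftrightarrow> i \<le> conjp (T r) m" if im: "(i, m) \<in> ?S" for i m r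
  proof
    assume "i \<le> conjp (T r) m"
    then show "ph (i, m) \<le> r" unfolding ph_def using im by (simp add: Least_le)
  next
    assume l: "ph (i, m) \<le> r"
    \<comment> \<open>Row m of \<open>T r\<close> has become row m of g2 by r = m, so the least
      number in the definition of \<open>ph\<close> exists.\<close>
    have "i \<le> conjp (T m) m" using im sk Tstab[of m m] by auto
    then have "i \<le> conjp (T (ph (i, m))) m" unfolding ph_def using im LeastI[of "\<lambda>r. i \<le> conjp (T r) m" m] by simp
    also have "\<dots> \<le> conjp (T r) m" using T_mono[OF _ l] im sk by simp
    finally show "i \<le> conjp (T r) m" .
  qed
  have "1 \<le> ph b" if "b \<in> ?S" for b
  proof (cases b)
    case (Pair i m)
    then show ?thesis using le[of i m 0] that sk T0[of m] by auto
  qed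
  moreover have "ph (i, m) \<le> ph (j, m)" if "(i, m) \<in> ?S" "(j, m) \<in> ?S" "i < j" for i j m
    using le[OF that(1), of "ph (j, m)"] le[OF that(2), of "ph (j, m)"] that(3) by simp
  moreover have "int (card {b \<in> ?S. snd b = m \<and> ph b = r}) = int (conjp (T r) m) - int (conjp (T (r - 1)) m)"
    if m: "1 \<le> m" and r: "1 \<le> r" for m r
  proof -
    obtain s where s: "r = Suc s" using r by (cases r) auto
    have "{b \<in> ?S. snd b = m \<and> ph b = r} = (\<lambda>i. (i, m)) ` {conjp (T s) m<..conjp (T r) m}"
    proof (intro equalityI subsetI)
      fix b assume b: "b \<in> {b \<in> ?S. snd b = m \<and> ph b = r}"
      then obtain i where i: "b = (i, m)" "(i, m) \<in> ?S" "ph (i, m) = r" by (cases b) auto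
      then show "b \<in> (\<lambda>i. (i, m)) ` {conjp (T s) m<..conjp (T r) m}" using le[OF i(2), of r] le[OF i(2), of s] s by auto
    next
      fix b assume "b \<in> (\<lambda>i. (i, m)) ` {conjp (T s) m<..conjp (T r) m}"
      then obtain i where i: "b = (i, m)" "conjp (T s) m < i" "i \<le> conjp (T r) m" by auto
      have iS: "(i, m) \<in> ?S" using i sk T_mono[OF m, of 0 s] T0[OF m] T_le[OF m, of r] m by auto
      have "ph (i, m) = r" using le[OF iS, of r] le[OF iS, of s] i s by linarith
      then show "b \<in> {b \<in> ?S. snd b = m \<and> ph b = r}" using i iS by simp
    qed
    then have "card {b \<in> ?S. snd b = m \<and> ph b = r} = conjp (T r) m - conjp (T s) m"
      by (simp add: card_image inj_on_def)
    then show ?thesis using T_mono[OF m, of s r] s by simp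
  qed
  ultimately have "phi_spec ?S T ph" unfolding phi_spec_def using ph_def by auto
  then show ?thesis by blast
qed

lemma phi_spec_the: "phi_spec (skew g2 g1) T (THE ph. phi_spec (skew g2 g1) T ph)"
  using phi_spec_exists phi_spec_unique by (metis theI')

end

text \<open>The conditions that \<open>klein_tableau\<close> imposes on the subscripts of a single
  stripe, as a predicate of three consecutive partitions.\<close>

definition kphi :: "nat list \<Rightarrow> nat list \<Rightarrow> nat list \<Rightarrow> (nat \<times> nat \<Rightarrow> nat) \<Rightarrow> bool" where
  "kphi g0 g1 g2 ph \<longleftrightarrow> (let S = skew g2 g1; Sp = skew g1 g0 in
        (\<forall>b. b \<notin> S \<longrightarrow> ph b = 0) \<and>
        (\<forall>b\<in>S. 1 \<le> ph b) \<and>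
        (\<forall>i j m. (i, m) \<in> S \<and> (j, m) \<in> S \<and> i < j \<longrightarrow> ph (i, m) \<le> ph (j, m)) \<and>
        (\<forall>i m. (i, m) \<in> S \<longrightarrow> ph (i, m) < m) \<and>
        (\<forall>i m. (i, m) \<in> S \<and> (i, m - 1) \<in> Sp \<longrightarrow> ph (i, m) = m - 1) \<and>
        (\<forall>r. card {b \<in> S. ph b = r} \<le> card {b \<in> Sp. snd b = r}))"

definition hstrip :: "nat list \<Rightarrow> nat list \<Rightarrow> bool" where
  "hstrip la mu \<longleftrightarrow> is_partition la \<and> is_partition mu \<and> (\<forall>i. part la i \<le> part mu i \<and> part mu i \<le> part la i + 1)"

text \<open>A box has subscript at most r exactly if it belongs to \<open>T r\<close>. Condition
  (ii) thus follows from row m being stable from r = m - 1 on. For (iii), \<open>Tle\<close> at m -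
  1 keeps a box below the previous stripe outside \<open>T (m - 2)\<close>. For (iv), the boxes with
  subscript r + 1 form the skew diagram of \<open>T (Suc r)\<close> and \<open>T r\<close>, whose
  size \<open>Tcard\<close> bounds.\<close>

lemma (in subscript_chain) kphiI:
  assumes g0: "is_partition g0" and T: "\<And>r. is_partition (T r)"
    and Tle: "\<And>m. 1 \<le> m \<Longrightarrow> conjp (T (m - 1)) (Suc m) \<le> conjp g0 m"
    and Tcard: "\<And>r. tail (T (Suc r)) 0 + conjp g0 (Suc r) \<le> tail (T r) 0 + conjp g1 (Suc r)"
    and ph: "phi_spec (skew g2 g1) T ph"
  shows "kphi g0 g1 g2 ph"
proof -
  let ?S = "skew g2 g1" and ?Sp = "skew g1 g0"
  note le = phi_spec_le_iff[OF ph]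
  note sk = skew_iff[OF g1 g2]
  have lt: "ph (i, m) < m" if im: "(i, m) \<in> ?S" for i m
  proof -
    have "1 \<le> m" "i \<le> conjp (T (m - 1)) m" using im sk Tstab[of m "m - 1"] by auto
    then show ?thesis using le[OF im, of "m - 1"] by simp
  qed
  have above: "ph (i, m) = m - 1" if im: "(i, m) \<in> ?S" and im': "(i, m - 1) \<in> ?Sp" for i m
  proof -
    have m: "1 \<le> m - 1" "conjp g0 (m - 1) < i" using im' skew_iff[OF g0 g1] by auto
    then have "conjp (T (m - 1 - 1)) m < i" using Tle[OF m(1)] by simp
    then have "\<not> ph (i, m) \<le> m - 2" using le[OF im, of "m - 2"] by (simp add: numeral_2_eq_2)
    moreover have "ph (i, m) < m" by (rule lt[OF im])
    ultimately show ?thesis by simp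
  qed
  have card_le: "card {b \<in> ?S. ph b = r} \<le> card {b \<in> ?Sp. snd b = r}" for r
  proof (cases r)
    case 0
    have "ph b \<noteq> r" if "b \<in> ?S" for b using phi_specD(2)[OF ph that] 0 by simp
    then have "{b \<in> ?S. ph b = r} = {}" by blast
    then show ?thesis by (simp only: card.empty le0)
  next
    case (Suc s)
    have "b \<in> ?S \<and> ph b = r \<longleftrightarrow> b \<in> skew (T r) (T s)" for b
    proof (cases b)
      case (Pair i m)
      have "b \<in> ?S" if "b \<in> skew (T r) (T s)"
        using that T_mono[of m 0 s] T0[of m] T_le[of m r]
        unfolding Pair sk skew_iff[OF T T] by auto
      moreover have "ph b = r \<longleftrightarrow> b \<in> skew (T r) (T s)" if "b \<in> ?S"
      proof -
        have "ph b = r \<longleftrightarrow> ph b \<le> r \<and> \<not> ph b \<le> s" using Suc by auto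
        also have "\<dots> \<longleftrightarrow> b \<in> skew (T r) (T s)"
          using le[of i m r] le[of i m s] that unfolding Pair skew_iff[OF T T] sk by auto
        finally show ?thesis .
      qed
      ultimately show ?thesis by blast
    qed
    then have "{b \<in> ?S. ph b = r} = skew (T r) (T s)" by blast
    moreover have "card (skew (T r) (T s)) + tail (T s) 0 = tail (T r) 0"
      using Tmono Suc by (intro card_skew T) auto
    ultimately show ?thesis using Tcard[of s] card_row_skew[OF g0 g1, of r] Suc by simp
  qed
  show ?thesis unfolding kphi_def Let_def
    using phi_specD(1,2)[OF ph] phi_specD(3)[OF ph] lt above card_le by blast
qed

section \<open>The Klein tableau of an embedding\<close>

definition strip_cols :: "nat list \<Rightarrow> nat list \<Rightarrow> nat set" where
  "strip_cols la mu = {i. 1 \<le> i \<and> part mu i = Suc (part la i)}"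

lemma strip_cols_subset: "strip_cols la mu \<subseteq> {1..length mu}"
  unfolding strip_cols_def part_def by auto

lemma finite_strip_cols: "finite (strip_cols la mu)"
  using finite_subset[OF strip_cols_subset] by simp

lemma skew_strip: "hstrip la mu \<Longrightarrow> (i, m) \<in> skew mu la \<longleftrightarrow> i \<in> strip_cols la mu \<and> m = part mu i"
  unfolding skew_def strip_cols_def hstrip_def by (auto dest!: spec[of _ i])

lemma hstripI:
  assumes "is_partition la" "is_partition mu" "\<And>m. 1 \<le> m \<Longrightarrow> conjp la m \<le> conjp mu m"
    "\<And>m. 1 \<le> m \<Longrightarrow> conjp mu (Suc m) \<le> conjp la m"
  shows "hstrip la mu"
  unfolding hstrip_def using part_le_partI[OF assms(1-3)] part_le_part_SucI[OF assms(1,2,4)] assms(1,2) by simp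

lemma hstrip_length: "hstrip la mu \<Longrightarrow> length la \<le> length mu"
proof (rule ccontr)
  assume h: "hstrip la mu" and n: "\<not> length la \<le> length mu"
  then have "0 < part la (length la)" using part_pos_iff[of la "length la"] unfolding hstrip_def by auto
  moreover have "part mu (length la) = 0" using n by (simp add: part_def)
  moreover have "part la (length la) \<le> part mu (length la)" using h unfolding hstrip_def by blast
  ultimately show False by simp
qed

lemma kphiD:
  assumes "kphi g0 g1 g2 ph"
  shows "b \<notin> skew g2 g1 \<Longrightarrow> ph b = 0" "b \<in> skew g2 g1 \<Longrightarrow> 1 \<le> ph b"
    "(i, m) \<in> skew g2 g1 \<Longrightarrow> (j, m) \<in> skew g2 g1 \<Longrightarrow> i < j \<Longrightarrow> ph (i, m) \<le> ph (j, m)"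
    "(i, m) \<in> skew g2 g1 \<Longrightarrow> ph (i, m) < m"
    "(i, m) \<in> skew g2 g1 \<Longrightarrow> (i, m - 1) \<in> skew g1 g0 \<Longrightarrow> ph (i, m) = m - 1"
    "card {b \<in> skew g2 g1. ph b = r} \<le> card {b \<in> skew g1 g0. snd b = r}"
  using assms unfolding kphi_def Let_def by blast+

text \<open>Condition (iv) provides, for each r, an injection from the boxes with subscript r into
  the boxes of the previous stripe in row r. Columns meeting both stripes are matched with
  themselves, as condition (iii) permits; removing them lowers both cardinalities equally, so the
  inequality survives for the rest. The injections for different r combine because the height of the
  target column recovers r.\<close>

lemma ex_matching:
  assumes h1: "hstrip g0 g1" and h2: "hstrip g1 g2" and k: "kphi g0 g1 g2 ph"
  shows "\<exists>s. inj_on s (strip_cols g1 g2) \<and> s ` strip_cols g1 g2 \<subseteq> strip_cols g0 g1 \<and>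
    (\<forall>j\<in>strip_cols g0 g1 \<inter> strip_cols g1 g2. s j = j) \<and>
    (\<forall>j\<in>strip_cols g1 g2. part g1 (s j) = ph (j, part g2 j))"
proof -
  let ?J1 = "strip_cols g0 g1" and ?J2 = "strip_cols g1 g2"
  define f where "f j = ph (j, part g2 j)" for j
  note s1 = skew_strip[OF h1] and s2 = skew_strip[OF h2]
  have both: "f j = part g1 j" if j: "j \<in> ?J1" "j \<in> ?J2" for j
  proof -
    have eq: "part g2 j - 1 = part g1 j" using j(2) unfolding strip_cols_def by simp
    then have "(j, part g2 j - 1) \<in> skew g1 g0" using s1 j by simp
    then show ?thesis using kphiD(5)[OF k, of j "part g2 j"] s2 j eq unfolding f_def by simp
  qed
  have ex: "\<exists>g. g ` {j \<in> ?J2 - ?J1. f j = r} \<subseteq> {j \<in> ?J1 - ?J2. part g1 j = r} \<and> inj_on g {j \<in> ?J2 - ?J1. f j = r}" for r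
  proof (rule card_le_inj)
    have "{b \<in> skew g2 g1. ph b = r} = (\<lambda>j. (j, part g2 j)) ` {j \<in> ?J2. f j = r}"
      using s2 unfolding f_def by auto
    then have c2: "card {b \<in> skew g2 g1. ph b = r} = card {j \<in> ?J2. f j = r}" by (simp add: card_image inj_on_def)
    have "{b \<in> skew g1 g0. snd b = r} = (\<lambda>j. (j, part g1 j)) ` {j \<in> ?J1. part g1 j = r}"
      using s1 by auto
    then have c1: "card {b \<in> skew g1 g0. snd b = r} = card {j \<in> ?J1. part g1 j = r}" by (simp add: card_image inj_on_def)
    have "{j \<in> ?J2. f j = r} = {j \<in> ?J2 - ?J1. f j = r} \<union> {j \<in> ?J1 \<inter> ?J2. f j = r}" by auto
    then have d2: "card {j \<in> ?J2. f j = r} = card {j \<in> ?J2 - ?J1. f j = r} + card {j \<in> ?J1 \<inter> ?J2. f j = r}"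
      using finite_strip_cols by (simp, subst card_Un_disjoint[symmetric]) (auto intro!: arg_cong[of _ _ card])
    have "{j \<in> ?J1. part g1 j = r} = {j \<in> ?J1 - ?J2. part g1 j = r} \<union> {j \<in> ?J1 \<inter> ?J2. f j = r}" using both by auto
    then have d1: "card {j \<in> ?J1. part g1 j = r} = card {j \<in> ?J1 - ?J2. part g1 j = r} + card {j \<in> ?J1 \<inter> ?J2. f j = r}"
      using finite_strip_cols by (simp, subst card_Un_disjoint[symmetric]) (auto intro!: arg_cong[of _ _ card])
    show "card {j \<in> ?J2 - ?J1. f j = r} \<le> card {j \<in> ?J1 - ?J2. part g1 j = r}"
      using kphiD(6)[OF k, of r] c1 c2 d1 d2 by linarith
  qed (use finite_strip_cols in auto)
  define g where "g r = (SOME g. g ` {j \<in> ?J2 - ?J1. f j = r} \<subseteq> {j \<in> ?J1 - ?J2. part g1 j = r} \<and>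
    inj_on g {j \<in> ?J2 - ?J1. f j = r})" for r
  have g: "g r ` {j \<in> ?J2 - ?J1. f j = r} \<subseteq> {j \<in> ?J1 - ?J2. part g1 j = r}"
    "inj_on (g r) {j \<in> ?J2 - ?J1. f j = r}" for r
    unfolding g_def using someI_ex[OF ex[of r]] by blast+
  define s where "s j = (if j \<in> ?J1 then j else g (f j) j)" for j
  have gs: "s j \<in> ?J1 - ?J2 \<and> part g1 (s j) = f j" if "j \<in> ?J2" "j \<notin> ?J1" for j
    using g(1)[of "f j"] that unfolding s_def by auto
  have sb: "s j = j" if "j \<in> ?J1" for j using that unfolding s_def by simp
  have sp: "part g1 (s j) = f j" if "j \<in> ?J2" for j
    using gs[OF that] both[OF _ that] sb[of j] by (cases "j \<in> ?J1") auto
  have "inj_on s ?J2"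
  proof (rule inj_onI)
    fix i j assume ij: "i \<in> ?J2" "j \<in> ?J2" "s i = s j"
    show "i = j"
    proof (cases "i \<in> ?J1 \<or> j \<in> ?J1")
      case True
      then show ?thesis using ij sb gs by (metis DiffD2)
    next
      case False
      have "f i = f j" using sp[OF ij(1)] sp[OF ij(2)] ij(3) by simp
      moreover have eq: "g (f i) i = g (f i) j" using False ij(3) calculation unfolding s_def by simp
      ultimately have "i \<in> {k \<in> ?J2 - ?J1. f k = f i}" "j \<in> {k \<in> ?J2 - ?J1. f k = f i}"
        using False ij(1,2) by auto
      then show ?thesis by (rule inj_onD[OF g(2) eq])
    qed
  qed
  moreover have "s ` ?J2 \<subseteq> ?J1" using gs sb by (metis DiffD1 image_subsetI)
  ultimately show ?thesis using sb sp unfolding f_def by blast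
qed

lemma hstrip_part_diff:
  assumes "hstrip la mu" "1 \<le> k"
  shows "(\<Sum>i\<in>{k..N}. int (part mu i) - int (part la i)) = int (card (strip_cols la mu \<inter> {k..N}))"
proof -
  have "int (part mu i) - int (part la i) = (if i \<in> strip_cols la mu then 1 else 0)" if "i \<in> {k..N}" for i
  proof -
    have "part la i \<le> part mu i" "part mu i \<le> Suc (part la i)" using assms(1) unfolding hstrip_def by auto
    then show ?thesis using that assms(2) unfolding strip_cols_def by auto
  qed
  then have "(\<Sum>i\<in>{k..N}. int (part mu i) - int (part la i)) = (\<Sum>i\<in>{k..N}. if i \<in> strip_cols la mu then 1 else 0)"
    by (rule sum.cong[OF refl])
  also have "\<dots> = int (card (strip_cols la mu \<inter> {k..N}))" by (simp add: sum.If_cases Int_commute)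
  finally show ?thesis .
qed

text \<open>The matching never moves a column to the left; this is why the lattice condition of a Klein
  tableau is a consequence of the conditions on the subscripts.\<close>

lemma kphi_lattice:
  assumes h1: "hstrip g0 g1" and h2: "hstrip g1 g2" and k: "kphi g0 g1 g2 ph" and "1 \<le> k" and N: "length g2 \<le> N"
  shows "(\<Sum>i\<in>{k..N}. int (part g2 i) - int (part g1 i)) \<le> (\<Sum>i\<in>{k..N}. int (part g1 i) - int (part g0 i))"
proof -
  let ?J1 = "strip_cols g0 g1" and ?J2 = "strip_cols g1 g2"
  obtain s where s: "inj_on s ?J2" "s ` ?J2 \<subseteq> ?J1" "\<And>j. j \<in> ?J1 \<Longrightarrow> j \<in> ?J2 \<Longrightarrow> s j = j"
    "\<And>j. j \<in> ?J2 \<Longrightarrow> part g1 (s j) = ph (j, part g2 j)" using ex_matching[OF h1 h2 k] by blast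
  have g0: "is_partition g0" and g1: "is_partition g1" using h1 unfolding hstrip_def by auto
  \<comment> \<open>If s j were left of j, the bounds on heights would make the two columns equally
    high in g1. Column s j gained its last box over g0 and column j gained none, so column j of g0
    would be higher than a column to its left.\<close>
  have ge: "j \<le> s j" if j: "j \<in> ?J2" for j
  proof (rule ccontr)
    assume n: "\<not> j \<le> s j"
    have j1: "1 \<le> s j" "s j \<in> ?J1" using s(2) j unfolding strip_cols_def by auto
    have "part g1 (s j) < part g2 j" using kphiD(4)[OF k, of j "part g2 j"] skew_strip[OF h2] j s(4)[OF j] by simp
    moreover have "part g2 j = Suc (part g1 j)" using j unfolding strip_cols_def by simp
    moreover have "part g1 j \<le> part g1 (s j)" using part_antimono[OF g1 j1(1), of j] n by simp
    ultimately have eq: "part g1 (s j) = part g1 j" by simp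
    have "j \<notin> ?J1" using s(3)[OF _ j] n by auto
    moreover have "1 \<le> j" using j unfolding strip_cols_def by simp
    moreover have "part g0 j \<le> part g1 j \<and> part g1 j \<le> part g0 j + 1" using h1 unfolding hstrip_def by blast
    ultimately have "part g0 j = part g1 j" unfolding strip_cols_def by auto
    moreover have "part g1 (s j) = Suc (part g0 (s j))" using j1 unfolding strip_cols_def by simp
    moreover have "part g0 j \<le> part g0 (s j)" using part_antimono[OF g0 j1(1), of j] n by simp
    ultimately show False using eq by simp
  qed
  have "s ` (?J2 \<inter> {k..N}) \<subseteq> ?J1 \<inter> {k..N}"
  proof
    fix x assume "x \<in> s ` (?J2 \<inter> {k..N})"
    then obtain j where j: "x = s j" "j \<in> ?J2" "k \<le> j" by auto
    have "x \<in> ?J1" using j s(2) by auto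
    moreover have "x \<le> N" using calculation strip_cols_subset[of g0 g1] hstrip_length[OF h2] N by force
    ultimately show "x \<in> ?J1 \<inter> {k..N}" using ge[OF j(2)] j by simp
  qed
  then have "card (?J2 \<inter> {k..N}) \<le> card (?J1 \<inter> {k..N})"
    using card_inj_on_le[of s "?J2 \<inter> {k..N}"] inj_on_subset[OF s(1)] by auto
  then show ?thesis unfolding hstrip_part_diff[OF h1 \<open>1 \<le> k\<close>] hstrip_part_diff[OF h2 \<open>1 \<le> k\<close>] by simp
qed

text \<open>The lattice condition is supplied by \<open>kphi_lattice\<close>, so only local
  conditions on consecutive partitions have to be checked.\<close>

lemma klein_tableauI:
  assumes ne: "gs \<noteq> []" and len: "length phs = length gs - 1 - 1" and p0: "is_partition (gs ! 0)"
    and h: "\<And>l. 1 \<le> l \<Longrightarrow> l < length gs \<Longrightarrow> hstrip (gs ! (l - 1)) (gs ! l)"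
    and k: "\<And>l. 2 \<le> l \<Longrightarrow> l < length gs \<Longrightarrow> kphi (gs ! (l - 2)) (gs ! (l - 1)) (gs ! l) (phs ! (l - 2))"
  shows "klein_tableau (gs, phs)"
proof -
  let ?e = "length gs - 1"
  have part: "\<forall>la\<in>set gs. is_partition la"
  proof
    fix la assume "la \<in> set gs"
    then obtain l where "l < length gs" "la = gs ! l" by (auto simp: in_set_conv_nth)
    then show "is_partition la" using p0 h[of l] unfolding hstrip_def by (cases "l = 0") auto
  qed
  \<comment> \<open>The sums of the lattice condition stop at the length of the last partition,
    which must therefore bound the columns of every stripe.\<close>
  have lenmono: "length (gs ! l) \<le> length (gs ! ?e)" if "l \<le> ?e" for l
    using that
  proof (induction rule: inc_induct)
    case (step n)
    have "Suc n < length gs" using step(2) by linarith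
    then show ?case using hstrip_length[OF h[of "Suc n"]] step(3) by simp
  qed simp
  have lat: "\<forall>l\<in>{2..?e}. \<forall>k\<ge>1.
        (\<Sum>i\<in>{k..length (gs ! ?e)}. int (part (gs ! l) i) - int (part (gs ! (l - 1)) i))
        \<le> (\<Sum>i\<in>{k..length (gs ! ?e)}. int (part (gs ! (l - 1)) i) - int (part (gs ! (l - 2)) i))"
  proof (intro ballI allI impI)
    fix l k :: nat assume l: "l \<in> {2..?e}" and k1: "1 \<le> k"
    have l2: "2 \<le> l" "l \<le> length gs - 1" using l by auto
    then have l3: "1 \<le> l - 1" "l - 1 < length gs" "l < length gs" "1 \<le> l" "l - 1 - 1 = l - 2" by linarith+
    have "hstrip (gs ! (l - 2)) (gs ! (l - 1))" using h[OF l3(1,2)] l3(5) by simp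
    moreover have "hstrip (gs ! (l - 1)) (gs ! l)" "kphi (gs ! (l - 2)) (gs ! (l - 1)) (gs ! l) (phs ! (l - 2))"
      using h[OF l3(4,3)] k[OF l2(1) l3(3)] by auto
    ultimately show "(\<Sum>i\<in>{k..length (gs ! ?e)}. int (part (gs ! l) i) - int (part (gs ! (l - 1)) i))
        \<le> (\<Sum>i\<in>{k..length (gs ! ?e)}. int (part (gs ! (l - 1)) i) - int (part (gs ! (l - 2)) i))"
      using kphi_lattice[OF _ _ _ k1 lenmono[OF l2(2)]] by blast
  qed
  have strip: "\<forall>l\<in>{1..?e}. \<forall>i. part (gs ! (l - 1)) i \<le> part (gs ! l) i \<and> part (gs ! l) i \<le> part (gs ! (l - 1)) i + 1"
  proof
    fix l assume "l \<in> {1..?e}"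
    then have "hstrip (gs ! (l - 1)) (gs ! l)" using h[of l] by auto
    then show "\<forall>i. part (gs ! (l - 1)) i \<le> part (gs ! l) i \<and> part (gs ! l) i \<le> part (gs ! (l - 1)) i + 1"
      unfolding hstrip_def by blast
  qed
  have phi: "\<forall>l\<in>{2..?e}. kphi (gs ! (l - 2)) (gs ! (l - 1)) (gs ! l) (phs ! (l - 2))" using k by auto
  show ?thesis
    unfolding klein_tableau_def Let_def fst_conv snd_conv
    by (intro conjI ne len part strip lat) (use phi in \<open>unfold kphi_def Let_def\<close>)
qed

lemma klein_tableauD:
  assumes "klein_tableau (gs, phs)"
  shows "gs \<noteq> []" "length phs = length gs - 1 - 1" "l < length gs \<Longrightarrow> is_partition (gs ! l)"
    "1 \<le> l \<Longrightarrow> l < length gs \<Longrightarrow> hstrip (gs ! (l - 1)) (gs ! l)"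
    "2 \<le> l \<Longrightarrow> l < length gs \<Longrightarrow> kphi (gs ! (l - 2)) (gs ! (l - 1)) (gs ! l) (phs ! (l - 2))"
proof -
  note K = assms[unfolded klein_tableau_def Let_def fst_conv snd_conv]
  show "gs \<noteq> []" "length phs = length gs - 1 - 1" using K by blast+
  show part: "is_partition (gs ! l)" if "l < length gs" for l using K that nth_mem by blast
  show "hstrip (gs ! (l - 1)) (gs ! l)" if "1 \<le> l" "l < length gs"
  proof -
    have "l \<in> {1..length gs - 1}" using that by auto
    then show ?thesis unfolding hstrip_def using K part[of l] part[of "l - 1"] that by auto
  qed
  show "kphi (gs ! (l - 2)) (gs ! (l - 1)) (gs ! l) (phs ! (l - 2))" if "2 \<le> l" "l < length gs"
  proof -
    have "l \<in> {2..length gs - 1}" using that by auto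
    then show ?thesis using K unfolding kphi_def Let_def by blast
  qed
qed

section \<open>Tableaux of embeddings satisfy the defining conditions\<close>

context fin_p_group
begin

lemma hstrip_qt:
  assumes N: "subgroup N G" and pN: "pmul G p N = {\<one>}"
  shows "hstrip (qt N) (qt {\<one>})"
proof (rule hstripI[OF qt_partition[OF N] qt_partition[OF triv_subgroup]])
  fix m :: nat assume "1 \<le> m"
  then obtain k where k: "m = Suc k" by (cases m) auto
  show "conjp (qt N) m \<le> conjp (qt {\<one>}) m" unfolding k
    using subgroup.one_closed[OF N] by (intro conjp_qt_mono triv_subgroup N) simp
  show "conjp (qt {\<one>}) (Suc m) \<le> conjp (qt N) m" unfolding k by (rule conjp_qt_interlace[OF N pN])
qed

lemma hW_0: "subgroup A G \<Longrightarrow> hW G p A 0 = pmul G p A"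
  unfolding hW_def using subgroup.subset[of A G] by (simp add: Int_absorb2)

lemma subscript_chain_hW:
  assumes A: "subgroup A G"
  shows "subscript_chain (qt (pmul G p A)) (qt {\<one>}) (\<lambda>r. qt (hW G p A r))"
proof
  show "is_partition (qt (pmul G p A))" "is_partition (qt {\<one>})"
    using qt_partition pmul_subgroup[OF A] triv_subgroup by blast+
  show "conjp (qt (hW G p A 0)) m = conjp (qt (pmul G p A)) m" for m unfolding hW_0[OF A] ..
  show "conjp (qt (hW G p A r)) m \<le> conjp (qt (hW G p A (Suc r))) m" if "1 \<le> m" for r m
    using conjp_qt_mono[OF subgroup_hW[OF A] subgroup_hW[OF A] hW_antimono, of r "Suc r" "m - 1"] that by simp
  show "conjp (qt (hW G p A r)) m = conjp (qt {\<one>}) m" if "m \<le> Suc r" "1 \<le> m" for r m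
    using conjp_hW_eq[OF A, of "m - 1" r] that by simp
qed

lemma emb_square_zero:
  assumes A: "subgroup A G" and pA: "pmul G (p ^ 2) A = {\<one>}"
  shows "emb_gamma p G A 0 = qt A" "emb_gamma p G A 1 = qt (pmul G p A)" "emb_gamma p G A 2 = qt {\<one>}"
    "emb_gamma2 p G A 2 r = qt (hW G p A r)"
    "emb_phi p G A 2 = (THE ph. phi_spec (skew (qt {\<one>}) (qt (pmul G p A))) (\<lambda>r. qt (hW G p A r)) ph)"
    "phi_spec (skew (qt {\<one>}) (qt (pmul G p A))) (\<lambda>r. qt (hW G p A r)) (emb_phi p G A 2)"
    "kphi (qt A) (qt (pmul G p A)) (qt {\<one>}) (emb_phi p G A 2)"
proof -
  interpret C: subscript_chain "qt (pmul G p A)" "qt {\<one>}" "\<lambda>r. qt (hW G p A r)" by (rule subscript_chain_hW[OF A])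
  show g: "emb_gamma p G A 0 = qt A" "emb_gamma p G A 1 = qt (pmul G p A)" "emb_gamma p G A 2 = qt {\<one>}"
    unfolding emb_gamma_qt using pA subgroup.subset[OF A] by simp_all
  show g2: "emb_gamma2 p G A 2 r = qt (hW G p A r)" for r
    unfolding emb_gamma2_qt[OF A] pA set_mult_one_left[OF subgroup_hW[OF A]] ..
  show e: "emb_phi p G A 2 = (THE ph. phi_spec (skew (qt {\<one>}) (qt (pmul G p A))) (\<lambda>r. qt (hW G p A r)) ph)"
  proof -
    have "emb_gamma2 p G A 2 = (\<lambda>r. qt (hW G p A r))" using g2 by (intro ext)
    moreover have "emb_gamma p G A (2 - 1) = qt (pmul G p A)" using g(2) by simp
    ultimately show ?thesis unfolding emb_phi_the g(3) by (simp only:)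
  qed
  show s: "phi_spec (skew (qt {\<one>}) (qt (pmul G p A))) (\<lambda>r. qt (hW G p A r)) (emb_phi p G A 2)"
    unfolding e by (rule C.phi_spec_the)
  show "kphi (qt A) (qt (pmul G p A)) (qt {\<one>}) (emb_phi p G A 2)"
  proof (rule C.kphiI[OF qt_partition[OF A] qt_partition[OF subgroup_hW[OF A]] _ _ s])
    show "conjp (qt (hW G p A (m - 1))) (Suc m) \<le> conjp (qt A) m" if "1 \<le> m" for m
      using conjp_hW_le[OF A, of "m - 1"] that by simp
    show "tail (qt (hW G p A (Suc r))) 0 + conjp (qt A) (Suc r) \<le> tail (qt (hW G p A r)) 0 + conjp (qt (pmul G p A)) (Suc r)" for r
      using lg_hW_le[OF A pA, of r] tail_qt_0[OF subgroup_hW[OF A], of r] tail_qt_0[OF subgroup_hW[OF A], of "Suc r"]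
      by linarith
  qed
qed

text \<open>Both partitions are unchanged if A is replaced by p^l A and p^(l+1) A is divided out;
  the subgroup is then killed by p, and \<open>hstrip_qt\<close> applies.\<close>

lemma hstrip_emb_gamma:
  assumes A: "subgroup A G" shows "hstrip (emb_gamma p G A l) (emb_gamma p G A (Suc l))"
proof -
  let ?A = "pmul G (p ^ l) A" let ?N = "pmul G p ?A"
  have sA: "subgroup ?A G" and N: "subgroup ?N G" by (intro pmul_subgroup A)+
  interpret S: fin_p_surj G "G Mod ?N" p "\<lambda>x. ?N #> x" by (rule fin_p_surj_Mod[OF N])
  have K: "S.K = ?N" by (rule kernel_Mod[OF N])
  let ?B = "(\<lambda>x. ?N #> x) ` ?A"
  have sB: "subgroup ?B (G Mod ?N)" by (rule S.h.subgroup_img_is_subgroup[OF sA])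
  have "pmul (G Mod ?N) p ?B = (\<lambda>x. ?N #> x) ` ?N" using S.h.image_pmul[OF subgroup.subset[OF sA], of p] by simp
  also have "\<dots> = {\<one>\<^bsub>G Mod ?N\<^esub>}" using K subgroup.one_closed[OF N] unfolding kernel_def by (auto simp: image_iff)
  finally have pB: "pmul (G Mod ?N) p ?B = {\<one>\<^bsub>G Mod ?N\<^esub>}" .
  have "emb_gamma p (G Mod ?N) ?B i = emb_gamma p G ?A i" if "i \<le> 1" for i
    using S.emb_image(1)[OF sA, of 1 i] K that by simp
  from this[of 0] this[of 1] have "emb_gamma p (G Mod ?N) ?B 0 = emb_gamma p G A l" "emb_gamma p (G Mod ?N) ?B 1 = emb_gamma p G A (Suc l)"
    unfolding emb_gamma_shift[OF A] by simp_all
  moreover have "hstrip (S.H.qt ?B) (S.H.qt {\<one>\<^bsub>G Mod ?N\<^esub>})" by (rule S.H.hstrip_qt[OF sB pB])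
  ultimately show ?thesis unfolding S.H.emb_gamma_qt using pB subgroup.subset[OF sB] by simp
qed

text \<open>The same reduction one step further: p^l A modulo p^(l+2) A is killed by p^2 and has the
  same three partitions and the same subscripts.\<close>

lemma kphi_emb:
  assumes A: "subgroup A G"
  shows "kphi (emb_gamma p G A l) (emb_gamma p G A (l + 1)) (emb_gamma p G A (l + 2)) (emb_phi p G A (l + 2))"
proof -
  let ?A = "pmul G (p ^ l) A" let ?N = "pmul G (p ^ 2) ?A"
  have sA: "subgroup ?A G" and N: "subgroup ?N G" by (intro pmul_subgroup A)+
  interpret S: fin_p_surj G "G Mod ?N" p "\<lambda>x. ?N #> x" by (rule fin_p_surj_Mod[OF N])
  have K: "S.K = ?N" by (rule kernel_Mod[OF N])
  let ?B = "(\<lambda>x. ?N #> x) ` ?A"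
  have sB: "subgroup ?B (G Mod ?N)" by (rule S.h.subgroup_img_is_subgroup[OF sA])
  have "pmul (G Mod ?N) (p ^ 2) ?B = (\<lambda>x. ?N #> x) ` ?N" using S.h.image_pmul[OF subgroup.subset[OF sA], of "p ^ 2"] by simp
  also have "\<dots> = {\<one>\<^bsub>G Mod ?N\<^esub>}" using K subgroup.one_closed[OF N] unfolding kernel_def by (auto simp: image_iff)
  finally have pB: "pmul (G Mod ?N) (p ^ 2) ?B = {\<one>\<^bsub>G Mod ?N\<^esub>}" .
  have g: "emb_gamma p (G Mod ?N) ?B i = emb_gamma p G A (l + i)" if "i \<le> 2" for i
    using S.emb_image(1)[OF sA, of 2 i] K that emb_gamma_shift[OF A, of l i] by simp
  have "emb_phi p (G Mod ?N) ?B 2 = emb_phi p G A (l + 2)"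
    using S.emb_image(2)[OF sA, of 2] K emb_phi_shift[OF A, of 2 l] by simp
  then show ?thesis using S.H.emb_square_zero(7)[OF sB pB] g[of 0] g[of 1] g[of 2] S.H.emb_square_zero(1-3)[OF sB pB] by simp
qed

theorem klein_tableau_emb:
  assumes A: "subgroup A G" shows "klein_tableau (emb_tableau p n G A)"
  unfolding emb_tableau_def
proof (rule klein_tableauI)
  show "is_partition (map (emb_gamma p G A) [0..<n + 1] ! 0)"
    using hstrip_emb_gamma[OF A, of 0] by (simp add: hstrip_def nth_append del: upt_Suc)
  fix l
  show "hstrip (map (emb_gamma p G A) [0..<n + 1] ! (l - 1)) (map (emb_gamma p G A) [0..<n + 1] ! l)"
    if "1 \<le> l" "l < length (map (emb_gamma p G A) [0..<n + 1])"
    using that hstrip_emb_gamma[OF A, of "l - 1"] by (simp del: upt_Suc)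
  show "kphi (map (emb_gamma p G A) [0..<n + 1] ! (l - 2)) (map (emb_gamma p G A) [0..<n + 1] ! (l - 1)) 
      (map (emb_gamma p G A) [0..<n + 1] ! l) (map (emb_phi p G A) [2..<n + 1] ! (l - 2))"
    if l: "2 \<le> l" "l < length (map (emb_gamma p G A) [0..<n + 1])"
  proof -
    define j where "j = l - 2"
    then have "l = j + 2" using l(1) by simp
    then show ?thesis using l(2) kphi_emb[OF A, of j] by (simp del: upt_Suc)
  qed
qed auto

end

section \<open>Existence of embeddings with bounded exponent two\<close>

lemma tail_part: "length la \<le> n \<Longrightarrow> tail la k = (\<Sum>i<n. part la (Suc i) - k)"
proof -
  assume n: "length la \<le> n"
  have "tail la k = (\<Sum>i<length la. la ! i - k)" unfolding tail_def by (simp add: sum_list_sum_nth atLeast0LessThan)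
  also have "\<dots> = (\<Sum>i<length la. part la (Suc i) - k)" by (intro sum.cong) (auto simp: part_def)
  also have "\<dots> = (\<Sum>i<n. part la (Suc i) - k)" using n by (intro sum.mono_neutral_left) (auto simp: part_def)
  finally show ?thesis .
qed

text \<open>A column of the strip gains a single box, in row \<open>part mu (Suc i)\<close>, and it
  counts for the boxes below row k exactly if k is smaller than that row.\<close>

lemma hstrip_tail:
  assumes h: "hstrip la mu" and n: "length mu \<le> n"
  shows "tail mu k = tail la k + card {i. Suc i \<in> strip_cols la mu \<and> k < part mu (Suc i)}"
proof -
  let ?D = "{i. Suc i \<in> strip_cols la mu \<and> k < part mu (Suc i)}"
  have D: "?D \<subseteq> {..<n}" using strip_cols_subset[of la mu] n by fastforce
  have "part mu (Suc i) - k = (part la (Suc i) - k) + (if i \<in> ?D then 1 else 0)" for i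
  proof -
    have "part la (Suc i) \<le> part mu (Suc i)" "part mu (Suc i) \<le> part la (Suc i) + 1"
      using h unfolding hstrip_def by blast+
    then show ?thesis unfolding strip_cols_def by auto
  qed
  then have "tail mu k = (\<Sum>i<n. (part la (Suc i) - k) + (if i \<in> ?D then 1 else 0))"
    using tail_part[OF n, of k] by simp
  also have "\<dots> = tail la k + (\<Sum>i<n. if i \<in> ?D then 1 else 0)"
    using tail_part[of la n k] hstrip_length[OF h] n by (simp add: sum.distrib)
  also have "(\<Sum>i<n. if i \<in> ?D then 1 else 0) = card ?D"
    using D by (simp add: sum.If_cases Int_absorb1)
  finally show ?thesis .
qed

text \<open>The matching \<open>t\<close> pairs each box labelled 2 and with subscript \<open>r\<close> with a box labelled 1 in
  row \<open>r\<close>. A pair lying in a single column yields a cyclic summand of order \<open>p\<^sup>2\<close> embedded in a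
  cyclic group, a pair in two columns a cyclic group of order \<open>p\<^sup>2\<close> embedded diagonally in the
  sum of two cyclic groups. Columns are numbered from 0 here, to agree with the indexing of \<open>Mgrp\<close>.\<close>

locale square_zero_model =
  fixes p :: nat and g0 g1 g2 :: "nat list" and ph :: "nat \<times> nat \<Rightarrow> nat" and t :: "nat \<Rightarrow> nat"
    and n :: nat and B C f :: "nat \<Rightarrow> nat" and I1 I2 :: "nat set"
  assumes prime: "Factorial_Ring.prime p"
    and h1: "hstrip g0 g1" and h2: "hstrip g1 g2" and kphi: "kphi g0 g1 g2 ph"
  defines "n \<equiv> length g2" and "B \<equiv> \<lambda>i. part g2 (Suc i)" and "C \<equiv> \<lambda>i. part g1 (Suc i)"
    and "f \<equiv> \<lambda>i. ph (Suc i, part g2 (Suc i))"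
    and "I1 \<equiv> {i. Suc i \<in> strip_cols g0 g1}" and "I2 \<equiv> {i. Suc i \<in> strip_cols g1 g2}"
  assumes t_inj: "inj_on t I2" and t_I1: "t ` I2 \<subseteq> I1" and t_fix: "\<And>i. i \<in> I1 \<Longrightarrow> i \<in> I2 \<Longrightarrow> t i = i"
    and t_row: "\<And>i. i \<in> I2 \<Longrightarrow> C (t i) = f i"
begin

lemma I2_sub: "I2 \<subseteq> {..<n}"
  unfolding I2_def n_def using strip_cols_subset[of g1 g2] by fastforce

lemma I1_sub: "I1 \<subseteq> {..<n}"
  unfolding I1_def n_def using strip_cols_subset[of g0 g1] hstrip_length[OF h2] by fastforce

lemma B_nth: "i < n \<Longrightarrow> g2 ! i = B i"
  unfolding B_def n_def by (simp add: part_def)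

lemma B_I2: "i \<in> I2 \<Longrightarrow> B i = Suc (C i)"
  unfolding B_def C_def I2_def strip_cols_def by simp

lemma B_not_I2: "i \<notin> I2 \<Longrightarrow> B i = C i"
proof -
  assume i: "i \<notin> I2"
  have "part g1 (Suc i) \<le> part g2 (Suc i)" "part g2 (Suc i) \<le> part g1 (Suc i) + 1"
    using h2 unfolding hstrip_def by blast+
  then show ?thesis using i unfolding B_def C_def I2_def strip_cols_def by auto
qed

lemma f_I2: "i \<in> I2 \<Longrightarrow> 1 \<le> f i" "i \<in> I2 \<Longrightarrow> f i < B i"
  using kphiD(2)[OF kphi] kphiD(4)[OF kphi] skew_strip[OF h2] unfolding I2_def f_def B_def by auto

lemma C_I1: "i \<in> I1 \<Longrightarrow> 1 \<le> C i"
  unfolding I1_def C_def strip_cols_def by simp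

lemma B_I1: "i \<in> I1 \<Longrightarrow> 1 \<le> B i"
  using C_I1[of i] B_I2[of i] B_not_I2[of i] by (cases "i \<in> I2") auto

abbreviation "M \<equiv> Mgrp p g2"
abbreviation "q i \<equiv> int p ^ B i"

sublocale M: fin_p_group M p by (rule fin_p_group_Mgrp[OF prime])

lemma q_pos: "q i > 0" using prime_gt_0_nat[OF prime] by simp

lemma carrier_M: "carrier M = (\<Pi>\<^sub>E i\<in>{..<n}. {0..<q i})"
  unfolding carrier_Mgrp[OF prime] n_def[symmetric] by (intro PiE_cong) (simp add: B_nth)

lemma carrier_M_D: 
  assumes "b \<in> carrier M" "i < n" shows "0 \<le> b i" "b i < q i" "b i mod q i = b i"
proof -
  have "b i \<in> {0..<q i}" using assms(1) unfolding carrier_M by (rule PiE_mem) (use assms(2) in simp)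
  then show "0 \<le> b i" "b i < q i" "b i mod q i = b i" by simp_all
qed

lemma P_M: "M.P k = (\<Pi>\<^sub>E i\<in>{..<n}. {y \<in> {0..<q i}. int p ^ min k (B i) dvd y})"
  unfolding pmul_Mgrp[OF prime] n_def[symmetric] by (intro PiE_cong) (simp add: B_nth)

lemma P_M_iff: "x \<in> carrier M \<Longrightarrow> x \<in> M.P k \<longleftrightarrow> (\<forall>i<n. int p ^ min k (B i) dvd x i)"
proof -
  assume "x \<in> carrier M"
  then have x: "x \<in> (\<Pi>\<^sub>E i\<in>{..<n}. {0..<q i})" by (simp only: carrier_M)
  show ?thesis unfolding P_M using x by (auto simp: PiE_def Pi_def)
qed

lemma mult_M: "x \<otimes>\<^bsub>M\<^esub> y = (\<lambda>i\<in>{..<n}. (x i + y i) mod q i)"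
  unfolding mult_Mgrp[OF prime] n_def[symmetric] by (intro restrict_ext) (simp add: B_nth)

lemma one_M: "\<one>\<^bsub>M\<^esub> = (\<lambda>i\<in>{..<n}. 0)"
  unfolding one_Mgrp[OF prime] n_def ..

lemma inv_M: "x \<in> carrier M \<Longrightarrow> inv\<^bsub>M\<^esub> x = (\<lambda>i\<in>{..<n}. (- x i) mod q i)"
  unfolding inv_Mgrp[OF prime] n_def[symmetric] by (intro restrict_ext) (simp add: B_nth)

lemma pow_M: "x \<in> carrier M \<Longrightarrow> x [^]\<^bsub>M\<^esub> (m::nat) = (\<lambda>i\<in>{..<n}. (int m * x i) mod q i)"
  unfolding pow_Mgrp[OF prime] n_def[symmetric] by (intro restrict_ext) (simp add: B_nth)

text \<open>Each j in I1 carries one generator, with coefficient \<open>a j\<close>. It has an entry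
  of order p^2 in the column of I2 matched with j, if there is one, and an entry of order p in
  column j itself unless j lies in I2. For j in both sets the matching fixes j, and only the entry
  of order p^2 remains.\<close>

definition e :: "(nat \<Rightarrow> int) \<Rightarrow> nat \<Rightarrow> int" where
  "e a i = (if i \<in> I2 then a (t i) * int p ^ (B i - 2) else if i \<in> I1 then a i * int p ^ (B i - 1) else 0)"

text \<open>Coefficients are arbitrary integers, not representatives modulo powers of p; so theta is
  additive and its range is a subgroup without any reduction of coefficients.\<close>

definition theta :: "(nat \<Rightarrow> int) \<Rightarrow> nat \<Rightarrow> int" where
  "theta a = (\<lambda>i\<in>{..<n}. e a i mod q i)"

abbreviation "A \<equiv> range theta"

lemma e_add: "e (\<lambda>i. a i + b i) i = e a i + e b i"
  unfolding e_def by (simp add: distrib_right)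

lemma e_mult: "e (\<lambda>i. c * a i) i = c * e a i"
  unfolding e_def by simp

lemma e_minus: "e (\<lambda>i. - a i) i = - e a i"
  unfolding e_def by simp

lemma theta_closed: "theta a \<in> carrier M"
  unfolding carrier_M theta_def using q_pos by (auto simp del: zero_less_power)

lemma theta_pow: "theta a [^]\<^bsub>M\<^esub> (m::nat) = theta (\<lambda>i. int m * a i)"
  unfolding pow_M[OF theta_closed] unfolding theta_def by (intro restrict_ext) (simp add: e_mult mod_mult_right_eq)

lemma theta_pow_nth: "i < n \<Longrightarrow> (theta a [^]\<^bsub>M\<^esub> (m::nat)) i = e (\<lambda>i. int m * a i) i mod q i"
  by (simp only: theta_pow) (simp add: theta_def)

lemma theta_extensional: "\<not> i < n \<Longrightarrow> theta a i = undefined"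
  by (simp add: theta_def)

lemma carrier_extensional: "b \<in> carrier M \<Longrightarrow> \<not> i < n \<Longrightarrow> b i = undefined"
  unfolding carrier_M by (auto simp: PiE_def extensional_def)

lemma subgroup_A: "subgroup A M"
proof (rule M.subgroupI)
  show "A \<subseteq> carrier M" using theta_closed by auto
  show "inv\<^bsub>M\<^esub> x \<in> A" if "x \<in> A" for x
  proof -
    obtain a where x: "x = theta a" using \<open>x \<in> A\<close> by auto
    have "inv\<^bsub>M\<^esub> x = theta (\<lambda>i. - a i)"
      unfolding x inv_M[OF theta_closed] unfolding theta_def by (intro restrict_ext) (simp add: e_minus mod_minus_eq)
    then show ?thesis by blast
  qed
  show "x \<otimes>\<^bsub>M\<^esub> y \<in> A" if xyA: "x \<in> A" "y \<in> A" for x y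
  proof -
    obtain a b where xy: "x = theta a" "y = theta b" using xyA by auto
    have "x \<otimes>\<^bsub>M\<^esub> y = theta (\<lambda>i. a i + b i)"
      unfolding xy mult_M theta_def by (intro restrict_ext) (simp add: e_add mod_add_eq)
    then show ?thesis by blast
  qed
qed auto

text \<open>For a set D of column indices this is the socle of the sum of the cyclic summands
  indexed by D. All subgroups whose orders are needed below are of this kind or are built from two
  such groups.\<close>

definition box :: "nat set \<Rightarrow> (nat \<Rightarrow> int) set" where
  "box D = {b \<in> carrier M. \<forall>i<n. if i \<in> D then int p ^ (B i - 1) dvd b i else b i = 0}"

text \<open>A nonzero element of the socle of the i-th summand is divisible by p^k exactly if k < B
  i.\<close>

lemma box_P: "box D \<inter> M.P k = box {i \<in> D. k < B i}"
proof (intro equalityI subsetI)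
  fix b assume b: "b \<in> box D \<inter> M.P k"
  then have bc: "b \<in> carrier M" unfolding box_def by auto
  have "b i = 0" if "i < n" "i \<in> D" "\<not> k < B i" for i
  proof -
    have "int p ^ min k (B i) dvd b i" using b P_M_iff[OF bc] that by auto
    then have "q i dvd b i" using that by (simp add: min_absorb2)
    moreover have "0 \<le> b i" "b i < q i" using carrier_M_D[OF bc] that by blast+
    ultimately show ?thesis using zdvd_not_zless[of "b i" "q i"] by (metis order_le_less)
  qed
  moreover have "if i \<in> D then int p ^ (B i - 1) dvd b i else b i = 0" if "i < n" for i
    using b that unfolding box_def by blast
  ultimately show "b \<in> box {i \<in> D. k < B i}" using bc unfolding box_def by (smt (verit) mem_Collect_eq)
next
  fix b assume b: "b \<in> box {i \<in> D. k < B i}"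
  then have bc: "b \<in> carrier M" unfolding box_def by auto
  have "int p ^ min k (B i) dvd b i" if "i < n" for i
  proof (cases "i \<in> D \<and> k < B i")
    case True
    then have "int p ^ (B i - 1) dvd b i" using b that unfolding box_def by auto
    moreover have "int p ^ min k (B i) dvd int p ^ (B i - 1)" using True by (intro le_imp_power_dvd) auto
    ultimately show ?thesis by (rule dvd_trans[rotated])
  next
    case False
    then have "b i = 0" using b that unfolding box_def by auto
    then show ?thesis by simp
  qed
  then have "b \<in> M.P k" using P_M_iff[OF bc] by blast
  then show "b \<in> box D \<inter> M.P k" using b unfolding box_def by (auto split: if_splits)
qed

lemma card_box:
  assumes D: "D \<subseteq> {..<n}" "\<And>i. i \<in> D \<Longrightarrow> 1 \<le> B i" shows "card (box D) = p ^ card D"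
proof -
  have "box D = (\<Pi>\<^sub>E i\<in>{..<n}. if i \<in> D then {y \<in> {0..<q i}. int p ^ min (B i - 1) (B i) dvd y} else {0})"
    (is "_ = PiE _ ?F")
  proof (intro equalityI subsetI)
    fix b assume b: "b \<in> box D"
    then have bc: "b \<in> carrier M" unfolding box_def by simp
    show "b \<in> PiE {..<n} ?F"
    proof (rule PiE_I)
      fix i assume "i \<in> {..<n}"
      then have i: "i < n" by simp
      have "if i \<in> D then int p ^ (B i - 1) dvd b i else b i = 0" using b i unfolding box_def by blast
      then show "b i \<in> ?F i" using carrier_M_D[OF bc i] by (cases "i \<in> D") (simp_all add: min_absorb1)
    qed (use carrier_extensional[OF bc] in simp)
  next
    fix b assume b: "b \<in> PiE {..<n} ?F"
    have bF: "b i \<in> ?F i" if "i < n" for i using PiE_mem[OF b] that by simp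
    have "b \<in> carrier M" unfolding carrier_M
    proof (rule PiE_I)
      fix i assume "i \<in> {..<n}"
      then show "b i \<in> {0..<q i}" using bF[of i] q_pos[of i] by (cases "i \<in> D") (simp_all del: zero_less_power)
    qed (use PiE_arb[OF b] in simp)
    moreover have "if i \<in> D then int p ^ (B i - 1) dvd b i else b i = 0" if "i < n" for i
      using bF[OF that] by (cases "i \<in> D") (simp_all add: min_absorb1)
    ultimately show "b \<in> box D" unfolding box_def by blast
  qed
  then have "card (box D) = (\<Prod>i<n. card (if i \<in> D then {y \<in> {0..<q i}. int p ^ min (B i - 1) (B i) dvd y} else {0}))"
    by (simp only: card_PiE[OF finite_lessThan])
  also have "\<dots> = (\<Prod>i<n. if i \<in> D then p else 1)"
  proof (intro prod.cong refl)
    fix i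
    show "card (if i \<in> D then {y \<in> {0..<q i}. int p ^ min (B i - 1) (B i) dvd y} else {0}) = (if i \<in> D then p else 1)"
    proof (cases "i \<in> D")
      case True
      then have "B i - (B i - 1) = 1" using D(2) by fastforce
      then show ?thesis using True card_multiples[OF prime, where k = "B i - 1" and l = "B i"] by (simp only: if_True power_one_right)
    qed simp
  qed
  also have "\<dots> = p ^ card D" using D(1) by (simp add: prod.If_cases Int_absorb1)
  finally show ?thesis .
qed

lemma lg_box: "D \<subseteq> I1 \<union> I2 \<Longrightarrow> plog p (box D) = card D"
proof -
  assume D: "D \<subseteq> I1 \<union> I2"
  have "D \<subseteq> {..<n}" using D I1_sub I2_sub by blast
  moreover have "1 \<le> B i" if "i \<in> D" for i using that D B_I1[of i] B_I2[of i] by auto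
  ultimately show ?thesis using plog_eqI[OF prime card_box] by blast
qed

lemma dvd_pow_iff:
  assumes "j \<le> b" 
  shows "int p ^ min r b dvd x * int p ^ (b - j) \<longleftrightarrow> int p ^ (min r b - (b - j)) dvd x"
proof (cases "min r b \<le> b - j")
  case True
  then have "int p ^ min r b dvd int p ^ (b - j)" by (rule le_imp_power_dvd)
  then show ?thesis using True by simp
next
  case False
  then have "int p ^ min r b = int p ^ (min r b - (b - j)) * int p ^ (b - j)" by (simp flip: power_add)
  then show ?thesis using prime_gt_0_nat[OF prime] by simp
qed

lemma theta_P_iff:
  "theta a \<in> M.P r \<longleftrightarrow> (\<forall>i\<in>I2. int p ^ (min r (B i) - (B i - 2)) dvd a (t i)) \<and>
    (\<forall>i\<in>I1 - I2. int p ^ (min r (B i) - (B i - 1)) dvd a i)"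
proof -
  have "theta a \<in> M.P r \<longleftrightarrow> (\<forall>i<n. int p ^ min r (B i) dvd theta a i)" by (rule P_M_iff[OF theta_closed])
  also have "\<dots> \<longleftrightarrow> (\<forall>i<n. int p ^ min r (B i) dvd e a i)"
  proof -
    have "int p ^ min r (B i) dvd e a i mod q i \<longleftrightarrow> int p ^ min r (B i) dvd e a i" for i
      by (intro dvd_mod_iff le_imp_power_dvd) simp
    then show ?thesis unfolding theta_def by simp
  qed
  also have "\<dots> \<longleftrightarrow> (\<forall>i\<in>I2. int p ^ (min r (B i) - (B i - 2)) dvd a (t i)) \<and>
    (\<forall>i\<in>I1 - I2. int p ^ (min r (B i) - (B i - 1)) dvd a i)"
  proof -
    have 2: "int p ^ min r (B i) dvd e a i \<longleftrightarrow> int p ^ (min r (B i) - (B i - 2)) dvd a (t i)" if "i \<in> I2" for i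
    proof -
      have "2 \<le> B i" using f_I2[OF that] by linarith
      then show ?thesis using dvd_pow_iff[of 2 "B i" r "a (t i)"] that unfolding e_def by simp
    qed
    have 1: "int p ^ min r (B i) dvd e a i \<longleftrightarrow> int p ^ (min r (B i) - (B i - 1)) dvd a i" if "i \<in> I1 - I2" for i
      using dvd_pow_iff[of 1 "B i" r "a i"] that B_I1[of i] unfolding e_def by simp
    have 0: "e a i = 0" if "i \<notin> I1" "i \<notin> I2" for i using that unfolding e_def by simp
    show ?thesis
    proof (intro iffI conjI ballI allI impI)
      fix i assume a: "\<forall>i<n. int p ^ min r (B i) dvd e a i" and "i \<in> I2"
      then show "int p ^ (min r (B i) - (B i - 2)) dvd a (t i)" using 2[of i] I2_sub by auto
    next
      fix i assume a: "\<forall>i<n. int p ^ min r (B i) dvd e a i" and "i \<in> I1 - I2"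
      then show "int p ^ (min r (B i) - (B i - 1)) dvd a i" using 1[of i] I1_sub by auto
    next
      fix i assume a: "(\<forall>i\<in>I2. int p ^ (min r (B i) - (B i - 2)) dvd a (t i)) \<and>
        (\<forall>i\<in>I1 - I2. int p ^ (min r (B i) - (B i - 1)) dvd a i)"
      show "int p ^ min r (B i) dvd e a i"
        using 0[of i] 1[of i] 2[of i] a by (cases "i \<in> I2"; cases "i \<in> I1") auto
    qed
  qed
  finally show ?thesis .
qed

text \<open>If t i lies in I2, then t fixes t i, and injectivity gives t i = i. So a pair of matched
  boxes either occupies one column or joins i to a column outside I2, which then ends in row f
  i.\<close>

lemma t_cases:
  assumes "i \<in> I2" obtains "t i \<in> I1 - I2" "B (t i) = f i" | "t i = i" "B i = Suc (f i)"
proof (cases "t i \<in> I2")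
  case True
  have "t i \<in> I1" using t_I1 assms by auto
  then have "t (t i) = t i" using t_fix True by simp
  then have "t i = i" using t_inj True assms by (auto dest: inj_onD)
  then show ?thesis using that(2) B_I2[OF assms] t_row[OF assms] by simp
next
  case False
  then show ?thesis using that(1) t_I1 assms B_not_I2[OF False] t_row[OF assms] by auto
qed

text \<open>Multiplication by p kills the entries of order p and turns the entries of order p^2 into
  entries in the socle.\<close>

lemma e_p: "i < n \<Longrightarrow> e (\<lambda>i. int p * a i) i mod q i = (if i \<in> I2 then (a (t i) * int p ^ (B i - 1)) mod q i else 0)"
proof -
  assume "i < n"
  have 1: "int p * (x * int p ^ (B i - 1)) = x * q i" if "i \<in> I1" for x
  proof -
    have "q i = int p * int p ^ (B i - 1)" using B_I1[OF that] by (simp flip: power_Suc)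
    then show ?thesis by simp
  qed
  have 2: "int p * (x * int p ^ (B i - 2)) = x * int p ^ (B i - 1)" if "i \<in> I2" for x
  proof -
    have "B i - 1 = Suc (B i - 2)" using f_I2[OF that] by linarith
    then show ?thesis by simp
  qed
  show ?thesis
  proof (cases "i \<in> I2")
    case True
    then have "int p * e a i = a (t i) * int p ^ (B i - 1)" using 2[OF True, of "a (t i)"] by (simp only: e_def if_True)
    then show ?thesis unfolding e_mult using True by (simp only: if_True)
  next
    case False
    show ?thesis
    proof (cases "i \<in> I1")
      case True
      then have "int p * e a i = a i * q i" using 1[OF True, of "a i"] False by (simp only: e_def if_True if_False)
      then show ?thesis unfolding e_mult using False by simp
    qed (use False in \<open>simp add: e_def\<close>)
  qed
qed

text \<open>Membership of \<open>theta a\<close> in \<open>M.P r\<close> leaves the coefficient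
  \<open>a (t i)\<close> unrestricted by the columns i and t i if r < f i, and forces p to divide it
  if f i \<le> r. After multiplication by p this coefficient appears in column i at the level of the
  socle, hence survives only in the first case.\<close>

lemma hW_box: "hW M p A r = box {i \<in> I2. r < f i}"
proof (intro equalityI subsetI)
  fix b assume "b \<in> hW M p A r"
  then obtain a where a: "theta a \<in> M.P r" "b = theta a [^]\<^bsub>M\<^esub> p" unfolding hW_def pmul_def by auto
  have bt: "b = theta (\<lambda>i. int p * a i)" using a(2) theta_pow by simp
  have bi: "b i = (if i \<in> I2 then (a (t i) * int p ^ (B i - 1)) mod q i else 0)" if "i < n" for i
    unfolding a(2) using theta_pow_nth[OF that, of a p] e_p[OF that, of a] by simp
  show "b \<in> box {i \<in> I2. r < f i}"
    unfolding box_def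
  proof (intro CollectI conjI allI impI)
    show "b \<in> carrier M" unfolding bt by (rule theta_closed)
    fix i assume i: "i < n"
    show "if i \<in> {i \<in> I2. r < f i} then int p ^ (B i - 1) dvd b i else b i = 0"
    proof (cases "i \<in> I2")
      case True
      have d: "int p ^ (B i - 1) dvd q i" by (intro le_imp_power_dvd) simp
      have "b i = 0" if "\<not> r < f i"
      proof -
        have "int p dvd a (t i)"
        using True
        proof (cases rule: t_cases)
          case 1
          then have "int p ^ (min r (B (t i)) - (B (t i) - 1)) dvd a (t i)" using a(1) theta_P_iff by blast
          moreover have "min r (B (t i)) - (B (t i) - 1) = 1" using 1 that f_I2(1)[OF True] by simp
          ultimately show ?thesis by simp
        next
          case 2
          then have "int p ^ (min r (B i) - (B i - 2)) dvd a (t i)" using a(1) theta_P_iff True by blast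
          moreover have "1 \<le> min r (B i) - (B i - 2)" using 2 that f_I2(1)[OF True] by simp
          ultimately show ?thesis by (metis dvd_trans le_imp_power_dvd power_one_right)
        qed
        then obtain c where "a (t i) = int p * c" by auto
        then have "a (t i) * int p ^ (B i - 1) = c * int p ^ Suc (B i - 1)" by simp
        also have "Suc (B i - 1) = B i" using f_I2[OF True] by simp
        finally show ?thesis using bi[OF i] True by simp
      qed
      moreover have "int p ^ (B i - 1) dvd b i" using bi[OF i] True d by (simp add: dvd_mod)
      ultimately show ?thesis using True by auto
    qed (use bi[OF i] in simp)
  qed
next
  fix b assume b: "b \<in> box {i \<in> I2. r < f i}"
  then have bc: "b \<in> carrier M" unfolding box_def by auto
  \<comment> \<open>The coefficients are recovered from b by dividing column i by p^(B i - 1) and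
    carrying the result to t i; generators without a partner get coefficient 0.\<close>
  define a where "a j = (if j \<in> t ` I2 then b (inv_into I2 t j) div int p ^ (B (inv_into I2 t j) - 1) else 0)" for j
  have at: "a (t i) = b i div int p ^ (B i - 1)" if "i \<in> I2" for i
    unfolding a_def using that inv_into_f_f[OF t_inj that] by simp
  have b0: "b i = 0" if "i < n" "\<not> (i \<in> I2 \<and> r < f i)" for i using b that unfolding box_def by auto
  have "theta a \<in> M.P r"
    unfolding theta_P_iff
  proof (intro conjI ballI)
    fix i assume i: "i \<in> I2"
    show "int p ^ (min r (B i) - (B i - 2)) dvd a (t i)"
    proof (cases "r < f i")
      case True
      then have "min r (B i) - (B i - 2) = 0" using f_I2[OF i] by linarith
      then show ?thesis by simp
    qed (use at[OF i] b0[of i] i I2_sub in auto)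
  next
    fix i assume i: "i \<in> I1 - I2"
    show "int p ^ (min r (B i) - (B i - 1)) dvd a i"
    proof (cases "i \<in> t ` I2")
      case True
      then obtain k where k: "k \<in> I2" "i = t k" by auto
      show ?thesis
      proof (cases "r < f k")
        case True
        then have "r < B i" using t_row[OF k(1)] B_not_I2[of i] i k by simp
        then have "min r (B i) - (B i - 1) = 0" by linarith
        then show ?thesis by simp
      qed (use at[OF k(1)] b0[of k] k I2_sub in auto)
    qed (simp add: a_def)
  qed
  moreover have "b = theta a [^]\<^bsub>M\<^esub> p"
  proof
    fix i
    show "b i = (theta a [^]\<^bsub>M\<^esub> p) i"
    proof (cases "i < n")
      case True
      have "(theta a [^]\<^bsub>M\<^esub> p) i = (if i \<in> I2 then (a (t i) * int p ^ (B i - 1)) mod q i else 0)"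
        using theta_pow_nth[OF True, of a p] e_p[OF True, of a] by simp
      also have "\<dots> = b i"
      proof (cases "i \<in> I2")
        case i2: True
        have "int p ^ (B i - 1) dvd b i" using b True b0[of i] i2 unfolding box_def by (cases "r < f i") auto
        moreover have "b i mod q i = b i" by (rule carrier_M_D(3)[OF bc True])
        ultimately show ?thesis using i2 at[OF i2] by simp
      next
        case False
        then have "b i = 0" using b0[of i] True by simp
        then show ?thesis using False by simp
      qed
      finally show ?thesis by simp
    next
      case False
      then show ?thesis using carrier_extensional[OF bc] theta_extensional unfolding theta_pow by simp
    qed
  qed
  ultimately show "b \<in> hW M p A r" unfolding hW_def pmul_def by blast
qed

text \<open>An element of A is killed by p exactly if p divides the coefficients of all matched
  generators. These then contribute only to the socles of the columns in I2, while the unmatched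
  generators contribute the socles of their own columns.\<close>

lemma soc_box: "{x \<in> A \<inter> M.P r. x [^]\<^bsub>M\<^esub> p = \<one>\<^bsub>M\<^esub>} = box {i \<in> I2 \<union> (I1 - t ` I2). r < B i}"
proof -
  have I: "i \<in> I1 - t ` I2 \<Longrightarrow> i \<notin> I2" for i using t_fix[of i] by force
  have "{x \<in> A. x [^]\<^bsub>M\<^esub> p = \<one>\<^bsub>M\<^esub>} = box (I2 \<union> (I1 - t ` I2))"
  proof (intro equalityI subsetI)
    fix b assume "b \<in> {x \<in> A. x [^]\<^bsub>M\<^esub> p = \<one>\<^bsub>M\<^esub>}"
    then obtain a where a: "theta a [^]\<^bsub>M\<^esub> p = \<one>\<^bsub>M\<^esub>" "b = theta a" by auto
    have pa: "int p dvd a (t i)" if i: "i \<in> I2" for i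
    proof -
      have "i < n" using i I2_sub by auto
      then have "(a (t i) * int p ^ (B i - 1)) mod q i = (theta a [^]\<^bsub>M\<^esub> p) i"
        using theta_pow_nth[of i a p] e_p[of i a] i by simp
      also have "\<dots> = 0" unfolding a(1) one_M using \<open>i < n\<close> by simp
      finally have "q i dvd a (t i) * int p ^ (B i - 1)" by (rule mod_0_imp_dvd)
      moreover have "q i = int p * int p ^ (B i - 1)" using f_I2[OF i] by (simp flip: power_Suc)
      ultimately show ?thesis using prime_gt_0_nat[OF prime] by simp
    qed
    show "b \<in> box (I2 \<union> (I1 - t ` I2))" unfolding box_def
    proof (intro CollectI conjI allI impI)
      show "b \<in> carrier M" unfolding a(2) by (rule theta_closed)
      fix i assume i: "i < n"
      then have bi: "b i = e a i mod q i" unfolding a(2) theta_def by simp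
      have d: "int p ^ (B i - 1) dvd q i" by (intro le_imp_power_dvd) simp
      show "if i \<in> I2 \<union> (I1 - t ` I2) then int p ^ (B i - 1) dvd b i else b i = 0"
      proof (cases "i \<in> I2")
        case True
        obtain c where "a (t i) = int p * c" using pa[OF True] by auto
        then have "e a i = c * int p ^ Suc (B i - 2)" using True unfolding e_def by simp
        also have "Suc (B i - 2) = B i - 1" using f_I2[OF True] by linarith
        finally have "int p ^ (B i - 1) dvd b i" unfolding bi using d by (intro dvd_mod) auto
        then show ?thesis using True by simp
      next
        case i2: False
        show ?thesis
        proof (cases "i \<in> I1")
          case True
          then have ei: "e a i = a i * int p ^ (B i - 1)" using i2 unfolding e_def by simp
          show ?thesis
          proof (cases "i \<in> t ` I2")
            case True
            then obtain c where "a i = int p * c" using pa by auto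
            then have "e a i = c * int p ^ Suc (B i - 1)" using ei by simp
            also have "Suc (B i - 1) = B i" using B_I1[OF \<open>i \<in> I1\<close>] by simp
            finally show ?thesis using True i2 bi by simp
          next
            case False
            have "int p ^ (B i - 1) dvd b i" unfolding bi ei using d by (intro dvd_mod) auto
            then show ?thesis using False True by simp
          qed
        qed (use i2 bi in \<open>simp add: e_def\<close>)
      qed
    qed
  next
    fix b assume b: "b \<in> box (I2 \<union> (I1 - t ` I2))"
    then have bc: "b \<in> carrier M" unfolding box_def by auto
    \<comment> \<open>The factor p at matched generators makes up for the exponent B i - 2 in
      \<open>e\<close> and kills the entry of order p in the partner column.\<close>
    define a where "a j = (if j \<in> t ` I2 then int p * (b (inv_into I2 t j) div int p ^ (B (inv_into I2 t j) - 1))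
      else b j div int p ^ (B j - 1))" for j
    have at: "a (t i) = int p * (b i div int p ^ (B i - 1))" if "i \<in> I2" for i
      unfolding a_def using that inv_into_f_f[OF t_inj that] by simp
    have bm: "b i mod q i = b i" if "i < n" for i by (rule carrier_M_D(3)[OF bc that])
    have "b = theta a"
    proof
      fix i
      show "b i = theta a i"
      proof (cases "i < n")
        case True
        have "e a i mod q i = b i"
        proof (cases "i \<in> I2")
          case i2: True
          then have "int p ^ (B i - 1) dvd b i" using b True unfolding box_def by auto
          moreover have "B i - 1 = Suc (B i - 2)" using f_I2[OF i2] by linarith
          then have "e a i = (b i div int p ^ (B i - 1)) * int p ^ (B i - 1)" using at[OF i2] i2 unfolding e_def by simp
          ultimately have "e a i = b i" by simp
          then show ?thesis using bm[OF True] by simp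
        next
          case i2: False
          show ?thesis
          proof (cases "i \<in> t ` I2")
            case it: True
            then have "i \<in> I1" using t_I1 by auto
            then have "q i = int p * int p ^ (B i - 1)" using B_I1[of i] by (simp flip: power_Suc)
            moreover have "b i = 0" using b True i2 it unfolding box_def by auto
            ultimately show ?thesis using it i2 \<open>i \<in> I1\<close> at unfolding e_def by auto
          next
            case it: False
            show ?thesis
            proof (cases "i \<in> I1")
              case i1: True
              then have "int p ^ (B i - 1) dvd b i" using b True it unfolding box_def by auto
              then show ?thesis using i1 i2 it bm[OF True] unfolding e_def a_def by simp
            next
              case False
              then have "b i = 0" using b True i2 unfolding box_def by auto
              then show ?thesis using False i2 unfolding e_def by simp
            qed
          qed
        qed
        then show ?thesis unfolding theta_def using True by simp
      next
        case False
        then show ?thesis using carrier_extensional[OF bc] theta_extensional by simp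
      qed
    qed
    moreover have "theta a [^]\<^bsub>M\<^esub> p = \<one>\<^bsub>M\<^esub>"
      unfolding theta_pow one_M unfolding theta_def
    proof (intro restrict_ext)
      fix i assume "i \<in> {..<n}"
      then have i: "i < n" by simp
      have "(a (t i) * int p ^ (B i - 1)) mod q i = 0" if i2: "i \<in> I2"
      proof -
        have "q i = int p * int p ^ (B i - 1)" using f_I2[OF i2] by (simp flip: power_Suc)
        then show ?thesis using at[OF i2] by simp
      qed
      then show "e (\<lambda>i. int p * a i) i mod q i = 0" using e_p[OF i, of a] by simp
    qed
    ultimately show "b \<in> {x \<in> A. x [^]\<^bsub>M\<^esub> p = \<one>\<^bsub>M\<^esub>}" by blast
  qed
  then have "{x \<in> A \<inter> M.P r. x [^]\<^bsub>M\<^esub> p = \<one>\<^bsub>M\<^esub>} = box (I2 \<union> (I1 - t ` I2)) \<inter> M.P r" by blast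
  then show ?thesis by (simp only: box_P)
qed

end

section \<open>The tableau of the constructed embedding\<close>

context square_zero_model
begin

lemma pmul_A: "pmul M p A = box I2"
proof -
  have "{i \<in> I2. 0 < f i} = I2" using f_I2(1) by fastforce
  then show ?thesis using hW_box[of 0] M.hW_0[OF subgroup_A] by simp
qed

lemma pmul_box: "pmul M p (box I2) = {\<one>\<^bsub>M\<^esub>}"
proof -
  have "b [^]\<^bsub>M\<^esub> p = \<one>\<^bsub>M\<^esub>" if b: "b \<in> box I2" for b
  proof -
    have bc: "b \<in> carrier M" using b unfolding box_def by simp
    show ?thesis unfolding pow_M[OF bc] one_M
    proof (intro restrict_ext)
      fix i assume "i \<in> {..<n}"
      then have i: "i < n" by simp
      have bi: "if i \<in> I2 then int p ^ (B i - 1) dvd b i else b i = 0" using b i unfolding box_def by blast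
      show "int p * b i mod q i = 0"
      proof (cases "i \<in> I2")
        case True
        then obtain c where "b i = int p ^ (B i - 1) * c" using bi by auto
        moreover have "q i = int p * int p ^ (B i - 1)" using f_I2[OF True] by (simp flip: power_Suc)
        ultimately show ?thesis by simp
      qed (use bi in simp)
    qed
  qed
  moreover have "\<one>\<^bsub>M\<^esub> i = 0" if "i < n" for i using that by (simp add: one_M)
  then have "\<one>\<^bsub>M\<^esub> \<in> box I2" unfolding box_def using M.one_closed by simp
  ultimately show ?thesis unfolding pmul_def by (auto intro!: image_eqI)
qed

lemma pmul2_A: "pmul M (p ^ 2) A = {\<one>\<^bsub>M\<^esub>}"
proof -
  have "pmul M (p ^ 2) A = pmul M p (pmul M p A)"
    using M.pmul_pmul[OF subgroup.subset[OF subgroup_A], of p p] by (simp add: power2_eq_square)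
  then show ?thesis unfolding pmul_A pmul_box .
qed

lemma fin: "finite I1" "finite I2"
  using I1_sub I2_sub finite_subset by blast+

lemma lg_P: "plog p (M.P k) = tail g2 k"
  by (rule M.tail_Mgrp)

lemma tail_g2: "tail g2 k = tail g1 k + card {i \<in> I2. k < B i}"
  using hstrip_tail[OF h2 order_refl, of k] unfolding I2_def B_def by simp

lemma tail_g1: "tail g1 k = tail g0 k + card {i \<in> I1. k < C i}"
  using hstrip_tail[OF h1 order_refl, of k] unfolding I1_def C_def by simp

lemma parts: "is_partition g0" "is_partition g1" "is_partition g2"
  using h1 h2 unfolding hstrip_def by auto

lemma lg_hW_P: "plog p (hW M p A r \<inter> M.P k) = card {i \<in> I2. r < f i \<and> k < B i}"
proof -
  have "{i \<in> {i \<in> I2. r < f i}. k < B i} = {i \<in> I2. r < f i \<and> k < B i}" by auto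
  then show ?thesis unfolding hW_box box_P by (subst lg_box) auto
qed

text \<open>By \<open>lg_soc\<close> the order splits into those of p(A \<inter> p^k M) and of the
  socle. The matching carries the I2 columns with k < f i to the matched I1 columns with k < C i, so
  together with the unmatched ones they give the count over I1.\<close>

lemma lg_A_P: "plog p (A \<inter> M.P k) = card {i \<in> I2. k < B i} + card {i \<in> I1. k < C i}"
proof -
  have "{i \<in> {i \<in> I2. k < f i}. 0 < B i} = {i \<in> I2. k < f i}" using B_I2 by auto
  then have "plog p (hW M p A k) = card {i \<in> I2. k < f i}" unfolding hW_box by (subst lg_box) auto
  then have "plog p (A \<inter> M.P k) = card {i \<in> I2. k < f i} + card {i \<in> I2 \<union> (I1 - t ` I2). k < B i}"
    using M.lg_soc[OF M.subgroup_Int_P[OF subgroup_A]] lg_box[of "{i \<in> I2 \<union> (I1 - t ` I2). k < B i}"]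
    unfolding soc_box hW_def by auto
  moreover have "{i \<in> I2 \<union> (I1 - t ` I2). k < B i} = {i \<in> I2. k < B i} \<union> {i \<in> I1 - t ` I2. k < B i}" by auto
  moreover have I: "i \<notin> I2" if "i \<in> I1 - t ` I2" for i using that t_fix[of i] by force
  then have "card ({i \<in> I2. k < B i} \<union> {i \<in> I1 - t ` I2. k < B i}) = card {i \<in> I2. k < B i} + card {i \<in> I1 - t ` I2. k < B i}"
    using fin by (intro card_Un_disjoint) auto
  moreover have "{i \<in> I1. k < C i} = t ` {i \<in> I2. k < f i} \<union> {i \<in> I1 - t ` I2. k < B i}"
  proof (intro equalityI subsetI)
    fix i assume i: "i \<in> {i \<in> I1. k < C i}"
    show "i \<in> t ` {i \<in> I2. k < f i} \<union> {i \<in> I1 - t ` I2. k < B i}"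
    proof (cases "i \<in> t ` I2")
      case True
      then show ?thesis using i t_row by auto
    next
      case False
      then show ?thesis using i I[of i] B_not_I2[of i] by auto
    qed
  next
    fix i assume i: "i \<in> t ` {i \<in> I2. k < f i} \<union> {i \<in> I1 - t ` I2. k < B i}"
    then show "i \<in> {i \<in> I1. k < C i}" using t_I1 t_row I[of i] B_not_I2[of i] by auto
  qed
  moreover have "card (t ` {i \<in> I2. k < f i} \<union> {i \<in> I1 - t ` I2. k < B i}) = card {i \<in> I2. k < f i} + card {i \<in> I1 - t ` I2. k < B i}"
  proof -
    have "card (t ` {i \<in> I2. k < f i}) = card {i \<in> I2. k < f i}"
      by (rule card_image, rule inj_on_subset[OF t_inj]) auto
    then show ?thesis using fin by (subst card_Un_disjoint) auto
  qed
  ultimately show ?thesis by simp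
qed

lemma qt_A: "M.qt A = g0"
  by (rule M.qt_eqI[OF subgroup_A parts(1)]) (simp only: lg_P lg_A_P tail_g2 tail_g1 add.assoc add.commute add.left_commute)

lemma qt_pA: "M.qt (pmul M p A) = g1"
proof (rule M.qt_eqI[OF M.pmul_subgroup[OF subgroup_A] parts(2)])
  fix k
  have "plog p (pmul M p A \<inter> M.P k) = card {i \<in> I2. k < B i}" unfolding pmul_A box_P by (rule lg_box) auto
  then show "plog p (M.P k) = tail g1 k + plog p (pmul M p A \<inter> M.P k)" using tail_g2[of k] lg_P[of k] by simp
qed

lemma qt_one: "M.qt {\<one>\<^bsub>M\<^esub>} = g2"
proof (rule M.qt_eqI[OF M.triv_subgroup parts(3)])
  fix k
  have "{\<one>\<^bsub>M\<^esub>} \<inter> M.P k = {\<one>\<^bsub>M\<^esub>}" using subgroup.one_closed[OF M.subgroup_P] by auto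
  then show "plog p (M.P k) = tail g2 k + plog p ({\<one>\<^bsub>M\<^esub>} \<inter> M.P k)" using lg_P[of k] by (simp only: M.lg_one)
qed

lemma emb_phi_A: "emb_phi p M A 2 = ph"
proof -
  interpret S: subscript_chain g1 g2 "\<lambda>r. M.qt (hW M p A r)"
    using M.subscript_chain_hW[OF subgroup_A] unfolding qt_pA qt_one .
  have "phi_spec (skew g2 g1) (\<lambda>r. M.qt (hW M p A r)) ph"
    unfolding phi_spec_def
  proof (intro conjI allI impI ballI)
    fix m r :: nat assume "1 \<le> m \<and> 1 \<le> r"
    then obtain k s where ks: "m = Suc k" "r = Suc s" by (metis Suc_le_D One_nat_def)
    \<comment> \<open>By \<open>lg_hW_P\<close> the number \<open>u r k\<close> is the logarithm of
      the order of \<open>hW M p A r \<inter> M.P k\<close>. The difference of rows m for r and r -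
      1 becomes a mixed second difference of u in r and k, which counts the columns of I2 with
      subscript r and bottom row m.\<close>
    define u where "u r k = card {i \<in> I2. r < f i \<and> k < B i}" for r k
    define w where "w k = card {i \<in> I2. f i = r \<and> k < B i}" for k
    have c: "conjp (M.qt (hW M p A r)) (Suc k) + tail g2 (Suc k) + u r k = tail g2 k + u r (Suc k)" for r
      using M.conjp_qt[OF M.subgroup_hW[OF subgroup_A], of r k] unfolding lg_hW_P lg_P u_def by simp
    have u: "u s j = u r j + w j" for j
    proof -
      have "{i \<in> I2. s < f i \<and> j < B i} = {i \<in> I2. r < f i \<and> j < B i} \<union> {i \<in> I2. f i = r \<and> j < B i}"
        unfolding ks by auto
      moreover have "card ({i \<in> I2. r < f i \<and> j < B i} \<union> {i \<in> I2. f i = r \<and> j < B i}) =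
          card {i \<in> I2. r < f i \<and> j < B i} + card {i \<in> I2. f i = r \<and> j < B i}"
        by (rule card_Un_disjoint) (use fin in auto)
      ultimately show ?thesis unfolding u_def w_def by simp
    qed
    have w: "w k = w (Suc k) + card {i \<in> I2. f i = r \<and> B i = m}"
    proof -
      have "{i \<in> I2. f i = r \<and> k < B i} = {i \<in> I2. f i = r \<and> Suc k < B i} \<union> {i \<in> I2. f i = r \<and> B i = m}"
        unfolding ks by auto
      moreover have "card ({i \<in> I2. f i = r \<and> Suc k < B i} \<union> {i \<in> I2. f i = r \<and> B i = m}) =
          card {i \<in> I2. f i = r \<and> Suc k < B i} + card {i \<in> I2. f i = r \<and> B i = m}"
      proof (rule card_Un_disjoint)
        show "{i \<in> I2. f i = r \<and> Suc k < B i} \<inter> {i \<in> I2. f i = r \<and> B i = m} = {}" unfolding ks(1) by auto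
      qed (rule finite_subset[OF _ fin(2)], blast)+
      ultimately show ?thesis unfolding w_def by simp
    qed
    have "{b \<in> skew g2 g1. snd b = m \<and> ph b = r} = (\<lambda>i. (Suc i, m)) ` {i \<in> I2. f i = r \<and> B i = m}"
    proof (intro equalityI subsetI)
      fix b assume "b \<in> {b \<in> skew g2 g1. snd b = m \<and> ph b = r}"
      then obtain i where i: "b = (i, m)" "i \<in> strip_cols g1 g2" "m = part g2 i" "ph (i, m) = r"
        using skew_strip[OF h2] by (cases b) auto
      then have "1 \<le> i" unfolding strip_cols_def by simp
      then obtain j where "i = Suc j" by (cases i) auto
      then show "b \<in> (\<lambda>i. (Suc i, m)) ` {i \<in> I2. f i = r \<and> B i = m}"
        using i unfolding I2_def f_def B_def by auto
    next
      fix b assume "b \<in> (\<lambda>i. (Suc i, m)) ` {i \<in> I2. f i = r \<and> B i = m}"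
      then show "b \<in> {b \<in> skew g2 g1. snd b = m \<and> ph b = r}"
        using skew_strip[OF h2] unfolding I2_def f_def B_def by auto
    qed
    then have "card {b \<in> skew g2 g1. snd b = m \<and> ph b = r} = card {i \<in> I2. f i = r \<and> B i = m}"
      by (simp add: card_image inj_on_def)
    then show "int (card {b \<in> skew g2 g1. snd b = m \<and> ph b = r}) =
        int (conjp (M.qt (hW M p A r)) m) - int (conjp (M.qt (hW M p A (r - 1))) m)"
      using c[of r] c[of s] u[of k] u[of "Suc k"] w unfolding ks by simp
  qed (use kphiD(1-3)[OF kphi] in auto)
  then show ?thesis unfolding M.emb_square_zero(5)[OF subgroup_A pmul2_A] qt_pA qt_one
    using S.phi_spec_unique by (intro the_equality) auto
qed

end

theorem ex_square_zero_embedding: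
  assumes prime: "Factorial_Ring.prime p" and h1: "hstrip g0 g1" and h2: "hstrip g1 g2" and k: "kphi g0 g1 g2 ph"
  shows "\<exists>A. subgroup A (Mgrp p g2) \<and> emb_tableau p 2 (Mgrp p g2) A = ([g0, g1, g2], [ph])"
proof -
  obtain s where s: "inj_on s (strip_cols g1 g2)" "s ` strip_cols g1 g2 \<subseteq> strip_cols g0 g1"
    "\<And>j. j \<in> strip_cols g0 g1 \<Longrightarrow> j \<in> strip_cols g1 g2 \<Longrightarrow> s j = j"
    "\<And>j. j \<in> strip_cols g1 g2 \<Longrightarrow> part g1 (s j) = ph (j, part g2 j)"
    using ex_matching[OF h1 h2 k] by blast
  \<comment> \<open>Columns are numbered from 1 in \<open>strip_cols\<close> and from 0 in the
    model; positivity makes the shift by one lossless.\<close>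
  have pos: "1 \<le> s j" if "j \<in> strip_cols g1 g2" for j using s(2) that unfolding strip_cols_def by auto
  interpret square_zero_model p g0 g1 g2 ph "\<lambda>i. s (Suc i) - 1" "length g2" "\<lambda>i. part g2 (Suc i)" "\<lambda>i. part g1 (Suc i)"
    "\<lambda>i. ph (Suc i, part g2 (Suc i))" "{i. Suc i \<in> strip_cols g0 g1}" "{i. Suc i \<in> strip_cols g1 g2}"
  proof (unfold_locales)
    show "inj_on (\<lambda>i. s (Suc i) - 1) {i. Suc i \<in> strip_cols g1 g2}"
    proof (rule inj_onI)
      fix i j assume "i \<in> {i. Suc i \<in> strip_cols g1 g2}" "j \<in> {i. Suc i \<in> strip_cols g1 g2}" "s (Suc i) - 1 = s (Suc j) - 1"
      then have "s (Suc i) = s (Suc j)" "Suc i \<in> strip_cols g1 g2" "Suc j \<in> strip_cols g1 g2"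
        using pos[of "Suc i"] pos[of "Suc j"] by auto
      then show "i = j" using inj_onD[OF s(1)] by blast
    qed
    show "(\<lambda>i. s (Suc i) - 1) ` {i. Suc i \<in> strip_cols g1 g2} \<subseteq> {i. Suc i \<in> strip_cols g0 g1}"
      using s(2) pos by fastforce
    show "part g1 (Suc (s (Suc i) - 1)) = ph (Suc i, part g2 (Suc i))" if "i \<in> {i. Suc i \<in> strip_cols g1 g2}" for i
      using that pos[of "Suc i"] s(4)[of "Suc i"] by simp
  qed (use s(3) h1 h2 k prime in auto)
  have "emb_tableau p 2 M A = ([g0, g1, g2], [ph])"
    unfolding emb_tableau_def
    using M.emb_square_zero(1-3)[OF subgroup_A pmul2_A] qt_A qt_pA qt_one emb_phi_A
    by (simp add: upt_rec[of _ "Suc _"] numeral_2_eq_2)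
  then show ?thesis using subgroup_A by blast
qed

section \<open>Uniqueness of embeddings of bounded exponent two\<close>

context fin_p_group_pair
begin

lemma card_Int_P_eqI:
  assumes A: "subgroup A G" and B: "subgroup B H" and eq: "G.qt A = H.qt B"
    and P: "\<And>k. plog p (G.P k) = plog p (H.P k)"
  shows "card (A \<inter> G.P k) = card (B \<inter> H.P k)"
proof -
  have "plog p (A \<inter> G.P k) = plog p (B \<inter> H.P k)"
    using G.qt_tail[OF A, of k] H.qt_tail[OF B, of k] eq P[of k] by simp
  then show ?thesis using G.card_subgroup[OF G.subgroup_Int_P[OF A]] H.card_subgroup[OF H.subgroup_Int_P[OF B]] by simp
qed

lemma lg_P_eqI: "G.qt {\<one>\<^bsub>G\<^esub>} = H.qt {\<one>\<^bsub>H\<^esub>} \<Longrightarrow> plog p (G.P k) = plog p (H.P k)"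
proof -
  assume "G.qt {\<one>\<^bsub>G\<^esub>} = H.qt {\<one>\<^bsub>H\<^esub>}"
  moreover have "{\<one>\<^bsub>G\<^esub>} \<inter> G.P k = {\<one>\<^bsub>G\<^esub>}" "{\<one>\<^bsub>H\<^esub>} \<inter> H.P k = {\<one>\<^bsub>H\<^esub>}"
    using subgroup.one_closed[OF G.subgroup_P] subgroup.one_closed[OF H.subgroup_P] by auto
  ultimately show ?thesis using G.qt_tail[OF G.triv_subgroup, of k] H.qt_tail[OF H.triv_subgroup, of k] by simp
qed

text \<open>The types of the quotients by \<open>hW G p A s\<close> are recovered by induction on s:
  they start with the quotient by pA, and the number of boxes with subscript s + 1 in each row gives
  the next one. With \<open>qt_tail\<close> this yields all orders required by
  \<open>ex_iso_mapping\<close>.\<close>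

theorem square_zero_iso:
  assumes A: "subgroup A G" and B: "subgroup B H"
    and kA: "pmul G (p ^ 2) A = {\<one>\<^bsub>G\<^esub>}" and kB: "pmul H (p ^ 2) B = {\<one>\<^bsub>H\<^esub>}"
    and q0: "G.qt A = H.qt B" and q1: "G.qt (pmul G p A) = H.qt (pmul H p B)"
    and q2: "G.qt {\<one>\<^bsub>G\<^esub>} = H.qt {\<one>\<^bsub>H\<^esub>}" and ph: "emb_phi p G A 2 = emb_phi p H B 2"
  shows "\<exists>f. f \<in> iso G H \<and> f ` A = B"
proof (rule ex_iso_mapping[OF A B kA kB])
  have P: "plog p (G.P k) = plog p (H.P k)" for k by (rule lg_P_eqI[OF q2])
  show "card (G.P k) = card (H.P k)" for k
    using P G.card_subgroup[OF G.subgroup_P] H.card_subgroup[OF H.subgroup_P] by simp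
  show "card (A \<inter> G.P k) = card (B \<inter> H.P k)" for k by (rule card_Int_P_eqI[OF A B q0 P])
  note sG = G.emb_square_zero(6)[OF A kA] and sH = H.emb_square_zero(6)[OF B kB, folded ph q1 q2]
  have "G.qt (hW G p A s) = H.qt (hW H p B s)" for s
  proof (induction s)
    case 0
    then show ?case unfolding G.hW_0[OF A] H.hW_0[OF B] by (rule q1)
  next
    case (Suc s)
    show ?case
    proof (rule partition_eqI[OF G.qt_partition[OF G.subgroup_hW[OF A]] H.qt_partition[OF H.subgroup_hW[OF B]]])
      fix m :: nat assume m: "1 \<le> m"
      show "conjp (G.qt (hW G p A (Suc s))) m = conjp (H.qt (hW H p B (Suc s))) m"
        using phi_specD(4)[OF sG m, of "Suc s"] phi_specD(4)[OF sH m, of "Suc s"] Suc by simp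
    qed
  qed
  then show "card (hW G p A s \<inter> G.P k) = card (hW H p B s \<inter> H.P k)" for s k
    by (intro card_Int_P_eqI G.subgroup_hW A H.subgroup_hW B P)
qed

text \<open>If A is killed by p, all the groups \<open>hW\<close> are trivial and no subscripts are
  needed.\<close>

theorem elementary_iso:
  assumes A: "subgroup A G" and B: "subgroup B H"
    and kA: "pmul G p A = {\<one>\<^bsub>G\<^esub>}" and kB: "pmul H p B = {\<one>\<^bsub>H\<^esub>}"
    and q0: "G.qt A = H.qt B" and q1: "G.qt {\<one>\<^bsub>G\<^esub>} = H.qt {\<one>\<^bsub>H\<^esub>}"
  shows "\<exists>f. f \<in> iso G H \<and> f ` A = B"
proof (rule ex_iso_mapping[OF A B])
  have P: "plog p (G.P k) = plog p (H.P k)" for k by (rule lg_P_eqI[OF q1])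
  show "card (G.P k) = card (H.P k)" for k
    using P G.card_subgroup[OF G.subgroup_P] H.card_subgroup[OF H.subgroup_P] by simp
  show "card (A \<inter> G.P k) = card (B \<inter> H.P k)" for k by (rule card_Int_P_eqI[OF A B q0 P])
  have oG: "hW G p A s = {\<one>\<^bsub>G\<^esub>}" for s
    using G.hW_antimono[of 0 s A] subgroup.one_closed[OF G.subgroup_hW[OF A]] G.hW_0[OF A] kA by blast
  have oH: "hW H p B s = {\<one>\<^bsub>H\<^esub>}" for s
    using H.hW_antimono[of 0 s B] subgroup.one_closed[OF H.subgroup_hW[OF B]] H.hW_0[OF B] kB by blast
  show "card (hW G p A s \<inter> G.P k) = card (hW H p B s \<inter> H.P k)" for s k
    unfolding oG oH by (rule card_Int_P_eqI[OF G.triv_subgroup H.triv_subgroup q1 P])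
  have "pmul G (p ^ 2) A = pmul G p (pmul G p A)" "pmul H (p ^ 2) B = pmul H p (pmul H p B)"
    using G.pmul_pmul[OF subgroup.subset[OF A]] H.pmul_pmul[OF subgroup.subset[OF B]] by (simp_all add: power2_eq_square)
  then show "pmul G (p ^ 2) A = {\<one>\<^bsub>G\<^esub>}" "pmul H (p ^ 2) B = {\<one>\<^bsub>H\<^esub>}" unfolding kA kB by (simp_all add: pmul_def)
qed

end

section \<open>Counting with automorphism groups\<close>

text \<open>As in \<open>autS\<close>, maps are taken extensional, so that each automorphism is
  counted once.\<close>

definition autG :: "('a, 'b) monoid_scheme \<Rightarrow> ('a \<Rightarrow> 'a) set" where
  "autG G = {f. f \<in> iso G G \<and> f \<in> extensional (carrier G)}"

context group
begin

lemma restrict_iso: assumes "f \<in> iso G G" shows "restrict f (carrier G) \<in> iso G G"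
proof -
  have "restrict f (carrier G) \<in> hom G G" using assms by (auto simp: iso_def hom_def Pi_def)
  moreover have "bij_betw (restrict f (carrier G)) (carrier G) (carrier G)"
    using assms by (simp add: iso_def cong: bij_betw_cong)
  ultimately show ?thesis by (simp add: iso_def)
qed

lemma compose_autG:
  assumes "f \<in> iso G G" "g \<in> iso G G" shows "compose (carrier G) g f \<in> autG G"
proof -
  have "restrict (g \<circ> f) (carrier G) \<in> iso G G" by (rule restrict_iso[OF iso_set_trans[OF assms]])
  moreover have "restrict (g \<circ> f) (carrier G) = compose (carrier G) g f" by (auto simp: compose_def)
  ultimately show ?thesis by (simp add: autG_def)
qed

lemma iso_closed: "f \<in> iso G G \<Longrightarrow> x \<in> carrier G \<Longrightarrow> f x \<in> carrier G"
  by (auto simp: iso_def hom_def)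

lemma iso_inj: "f \<in> iso G G \<Longrightarrow> inj_on f (carrier G)"
  by (simp add: iso_def bij_betw_def)

lemma iso_surj: "f \<in> iso G G \<Longrightarrow> f ` carrier G = carrier G"
  by (simp add: iso_def bij_betw_def)

lemma finite_autG: assumes "finite (carrier G)" shows "finite (autG G)"
proof (rule finite_subset)
  show "autG G \<subseteq> (carrier G \<rightarrow>\<^sub>E carrier G)" using iso_closed unfolding autG_def by (auto simp: PiE_def)
qed (use assms in \<open>simp add: finite_PiE\<close>)

text \<open>Orbit and stabilizer: the automorphisms taking A to B form the coset of
  \<open>autS G A\<close> given by any single one of them.\<close>

lemma card_autG_orbit:
  assumes fin: "finite (carrier G)" and sub: "\<And>A. A \<in> \<Omega> \<Longrightarrow> A \<subseteq> carrier G"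
    and closed: "\<And>f A. f \<in> iso G G \<Longrightarrow> A \<in> \<Omega> \<Longrightarrow> f ` A \<in> \<Omega>"
    and trans: "\<And>A B. A \<in> \<Omega> \<Longrightarrow> B \<in> \<Omega> \<Longrightarrow> \<exists>f. f \<in> iso G G \<and> f ` A = B"
    and A: "A \<in> \<Omega>"
  shows "card (autG G) = card \<Omega> * card (autS G A)"
proof -
  have "card {f \<in> autG G. f ` A = B} = card (autS G A)" if "B \<in> \<Omega>" for B
  proof -
    obtain g where g: "g \<in> iso G G" "g ` A = B" using trans[OF A \<open>B \<in> \<Omega>\<close>] by blast
    define g' where "g' = inv_into (carrier G) g"
    have g': "g' \<in> iso G G" unfolding g'_def by (rule iso_set_sym[OF g(1)])
    have gg': "g (g' x) = x" if "x \<in> carrier G" for x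
      unfolding g'_def using f_inv_into_f[of x g "carrier G"] iso_surj[OF g(1)] that by simp
    have g'g: "g' (g x) = x" if "x \<in> carrier G" for x
      unfolding g'_def using inv_into_f_f[OF iso_inj[OF g(1)] that] .
    have Ac: "A \<subseteq> carrier G" by (rule sub[OF A])
    have "bij_betw (\<lambda>f. compose (carrier G) g f) (autS G A) {f \<in> autG G. f ` A = B}"
    proof (rule bij_betw_byWitness[where f' = "\<lambda>f. compose (carrier G) g' f"])
      show "\<forall>f\<in>autS G A. compose (carrier G) g' (compose (carrier G) g f) = f"
        using g'g iso_closed by (auto simp: autS_def compose_def fun_eq_iff extensional_def)
      show "\<forall>f\<in>{f \<in> autG G. f ` A = B}. compose (carrier G) g (compose (carrier G) g' f) = f"
        using gg' iso_closed by (auto simp: autG_def compose_def fun_eq_iff extensional_def)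
      show "(\<lambda>f. compose (carrier G) g f) ` autS G A \<subseteq> {f \<in> autG G. f ` A = B}"
      proof clarify
        fix f assume f: "f \<in> autS G A"
        have "compose (carrier G) g f ` A = g ` (f ` A)" using Ac by (auto simp: compose_def image_iff subset_iff)
        then show "compose (carrier G) g f \<in> autG G \<and> compose (carrier G) g f ` A = B"
          using compose_autG[OF _ g(1), of f] f g(2) unfolding autS_def by simp
      qed
      show "(\<lambda>f. compose (carrier G) g' f) ` {f \<in> autG G. f ` A = B} \<subseteq> autS G A"
      proof clarify
        fix f assume f: "f \<in> autG G" "B = f ` A"
        have "compose (carrier G) g' f ` A = g' ` (f ` A)" using Ac by (auto simp: compose_def image_iff subset_iff)
        also have "\<dots> = g' ` g ` A" using f g(2) by simp
        also have "\<dots> = A" using g'g Ac by (auto simp: image_iff subset_iff)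
        finally show "compose (carrier G) g' f \<in> autS G A"
          using compose_autG[OF _ g', of f] f(1) unfolding autS_def autG_def by simp
      qed
    qed
    then show ?thesis by (simp add: bij_betw_same_card)
  qed
  then have "(\<Sum>B\<in>\<Omega>. card {f \<in> autG G. f ` A = B}) = card \<Omega> * card (autS G A)" by simp
  moreover have "(\<lambda>f. f ` A) ` autG G = \<Omega>"
  proof
    show "(\<lambda>f. f ` A) ` autG G \<subseteq> \<Omega>" using closed[OF _ A] unfolding autG_def by auto
    show "\<Omega> \<subseteq> (\<lambda>f. f ` A) ` autG G"
    proof
      fix B assume "B \<in> \<Omega>"
      then obtain g where g: "g \<in> iso G G" "g ` A = B" using trans[OF A] by blast
      have "restrict g (carrier G) \<in> autG G" using restrict_iso[OF g(1)] by (simp add: autG_def)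
      moreover have "restrict g (carrier G) ` A = B" using g(2) sub[OF A] by (auto simp: image_iff subset_iff)
      ultimately show "B \<in> (\<lambda>f. f ` A) ` autG G" by blast
    qed
  qed
  then have "card (autG G) = (\<Sum>B\<in>\<Omega>. card {f \<in> autG G. f ` A = B})"
    using card_eq_sum[of "autG G"] sum.image_gen[OF finite_autG[OF fin], of "\<lambda>_. 1::nat" "\<lambda>f. f ` A"] by simp
  ultimately show ?thesis by simp
qed

text \<open>An equivariant map between two transitive sets has fibres of equal size.\<close>

lemma card_fibre_stabilizers:
  assumes fin: "finite (carrier G)"
    and sub1: "\<And>A. A \<in> \<Omega>1 \<Longrightarrow> A \<subseteq> carrier G"
    and closed1: "\<And>f A. f \<in> iso G G \<Longrightarrow> A \<in> \<Omega>1 \<Longrightarrow> f ` A \<in> \<Omega>1"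
    and trans1: "\<And>A B. A \<in> \<Omega>1 \<Longrightarrow> B \<in> \<Omega>1 \<Longrightarrow> \<exists>f. f \<in> iso G G \<and> f ` A = B"
    and sub2: "\<And>A. A \<in> \<Omega>2 \<Longrightarrow> A \<subseteq> carrier G"
    and closed2: "\<And>f A. f \<in> iso G G \<Longrightarrow> A \<in> \<Omega>2 \<Longrightarrow> f ` A \<in> \<Omega>2"
    and trans2: "\<And>A B. A \<in> \<Omega>2 \<Longrightarrow> B \<in> \<Omega>2 \<Longrightarrow> \<exists>f. f \<in> iso G G \<and> f ` A = B"
    and m: "\<And>A. A \<in> \<Omega>2 \<Longrightarrow> m A \<in> \<Omega>1"
    and equiv: "\<And>f A. f \<in> iso G G \<Longrightarrow> A \<in> \<Omega>2 \<Longrightarrow> f ` m A = m (f ` A)"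
    and A: "A \<in> \<Omega>2" and U0: "U0 \<in> \<Omega>1" and U: "U \<in> \<Omega>1"
  shows "card {A \<in> \<Omega>2. m A = U} * card (autS G A) = card (autS G U0)" "0 < card (autS G U0)"
proof -
  have fO: "finite \<Omega>1" "finite \<Omega>2" using finite_subset[of _ "Pow (carrier G)"] fin sub1 sub2 by blast+
  have le: "card {A \<in> \<Omega>2. m A = U} \<le> card {A \<in> \<Omega>2. m A = V}" if UV: "U \<in> \<Omega>1" "V \<in> \<Omega>1" for U V
  proof -
    obtain g where g: "g \<in> iso G G" "g ` U = V" using trans1[OF UV] by blast
    have "inj_on (\<lambda>A. g ` A) {A \<in> \<Omega>2. m A = U}"
      by (rule inj_on_subset[OF inj_on_image_Pow[OF iso_inj[OF g(1)]]]) (use sub2 in blast)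
    moreover have "(\<lambda>A. g ` A) ` {A \<in> \<Omega>2. m A = U} \<subseteq> {A \<in> \<Omega>2. m A = V}"
      using closed2[OF g(1)] equiv[OF g(1)] g(2) by auto
    ultimately show ?thesis using fO(2) by (intro card_inj_on_le) auto
  qed
  then have "card {A \<in> \<Omega>2. m A = V} = card {A \<in> \<Omega>2. m A = U}" if "V \<in> \<Omega>1" for V
    using le[OF U that] le[OF that U] by simp
  then have "(\<Sum>V\<in>\<Omega>1. card {A \<in> \<Omega>2. m A = V}) = card \<Omega>1 * card {A \<in> \<Omega>2. m A = U}" by simp
  moreover have "card \<Omega>2 = (\<Sum>V\<in>\<Omega>1. card {A \<in> \<Omega>2. m A = V})"
    using card_eq_sum[of \<Omega>2] sum.group[OF fO(2) fO(1), of m "\<lambda>_. 1::nat"] m by (simp add: image_subset_iff)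
  ultimately have c: "card \<Omega>2 = card \<Omega>1 * card {A \<in> \<Omega>2. m A = U}" by simp
  have 1: "card (autG G) = card \<Omega>1 * card (autS G U0)"
    by (rule card_autG_orbit[OF fin sub1 closed1 trans1 U0])
  have 2: "card (autG G) = card \<Omega>2 * card (autS G A)"
    by (rule card_autG_orbit[OF fin sub2 closed2 trans2 A])
  have "\<Omega>1 \<noteq> {}" using U by auto
  then have pos: "card \<Omega>1 > 0" using fO(1) by (simp add: card_gt_0_iff)
  have "card \<Omega>1 * (card {A \<in> \<Omega>2. m A = U} * card (autS G A)) = card \<Omega>1 * card (autS G U0)"
    using 1 2 c by (simp add: mult.assoc)
  then show "card {A \<in> \<Omega>2. m A = U} * card (autS G A) = card (autS G U0)" using pos by simp
  have "id \<in> iso G G" by (simp add: iso_def hom_def)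
  then have "restrict id (carrier G) \<in> autG G" using restrict_iso by (simp add: autG_def)
  then have "card (autG G) > 0" using finite_autG[OF fin] by (auto simp: card_gt_0_iff)
  then show "0 < card (autS G U0)" using 1 by simp
qed

end

section \<open>Tableaux and counting in the groups M(g2)\<close>

context fin_p_group
begin

lemma is_iso_iff_grp_type: "is_partition la \<Longrightarrow> G \<cong> Mgrp p la \<longleftrightarrow> grp_type p G = la"
  using is_iso_Mgrp_iff grp_type(2) grp_type_eqI by auto

lemma eq_one_if_qt: "subgroup N G \<Longrightarrow> qt N = qt {\<one>} \<Longrightarrow> N = {\<one>}"
  using tail_qt_0[of N] tail_qt_0[OF triv_subgroup] lg_eq_0_iff[of N] by simp

lemma pmul_one: "pmul G n {\<one>} = {\<one>}"
  by (simp add: pmul_def)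

lemma pmul_square: "subgroup A G \<Longrightarrow> pmul G (p ^ 2) A = pmul G p (pmul G p A)"
  using pmul_pmul[of A p p] subgroup.subset[of A G] by (simp add: power2_eq_square)

lemma emb_tableau_1_iff: "subgroup A G \<Longrightarrow> emb_tableau p 1 G A = ([g1, g2], []) \<longleftrightarrow> qt A = g1 \<and> qt (pmul G p A) = g2"
  unfolding emb_tableau_def emb_gamma_qt using subgroup.subset[of A G] by auto

lemma emb_tableau_2_iff: "subgroup A G \<Longrightarrow> emb_tableau p 2 G A = ([g0, g1, g2], [ph]) \<longleftrightarrow>
    qt A = g0 \<and> qt (pmul G p A) = g1 \<and> qt (pmul G (p ^ 2) A) = g2 \<and> emb_phi p G A 2 = ph"
  unfolding emb_tableau_def emb_gamma_qt using subgroup.subset[of A G]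
  by (simp add: upt_rec[of _ "Suc _"] numeral_2_eq_2) 

lemma fin_p_surj_iso: "f \<in> iso G G \<Longrightarrow> fin_p_surj G G p f"
  by unfold_locales (auto simp: iso_def bij_betw_def)

lemma kernel_iso: assumes "f \<in> iso G G" shows "kernel G G f = {\<one>}"
proof -
  have f1: "f \<one> = \<one>" using assms hom_one[OF _ is_group is_group] by (simp add: iso_def)
  have "x = \<one>" if "x \<in> carrier G" "f x = \<one>" for x
    using inj_onD[OF iso_inj[OF assms] _ that(1) one_closed] that(2) f1 by simp
  then show ?thesis using f1 by (auto simp: kernel_def)
qed

lemma emb_tableau_iso:
  assumes f: "f \<in> iso G G" and A: "subgroup A G"
  shows "subgroup (f ` A) G" "emb_tableau p 1 G (f ` A) = emb_tableau p 1 G A" "emb_tableau p 2 G (f ` A) = emb_tableau p 2 G A"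
    "f ` pmul G p A = pmul G p (f ` A)"
proof -
  interpret f: fin_p_surj G G p f by (rule fin_p_surj_iso[OF f])
  have K: "kernel G G f \<subseteq> pmul G (p ^ n) A" for n
    unfolding kernel_iso[OF f] using subgroup.one_closed[OF pmul_subgroup[OF A]] by simp
  show "subgroup (f ` A) G" by (rule f.h.subgroup_img_is_subgroup[OF A])
  show "f ` pmul G p A = pmul G p (f ` A)" by (rule f.h.image_pmul[OF subgroup.subset[OF A]])
  have "emb_gamma p G (f ` A) i = emb_gamma p G A i" for i using f.emb_image(1)[OF A K[of i], of i] by simp
  moreover have "emb_phi p G (f ` A) 2 = emb_phi p G A 2" by (rule f.emb_image(2)[OF A K[of 2] refl])
  ultimately show "emb_tableau p 1 G (f ` A) = emb_tableau p 1 G A" "emb_tableau p 2 G (f ` A) = emb_tableau p 2 G A"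
    unfolding emb_tableau_def by (simp_all add: upt_rec[of _ "Suc _"] numeral_2_eq_2)
qed

end

text \<open>The automorphism group acts transitively on the subgroups with either tableau. Both sets
  are nonempty, by \<open>ex_square_zero_embedding\<close> and because of U, so the embeddings
  chosen in \<open>E_aut\<close> belong to them. A product instead of a quotient is stated because
  it shows together with the second claim that the denominator is nonzero.\<close>

lemma card_fibre_E_aut:
  assumes prime: "Factorial_Ring.prime p" and h1: "hstrip g0 g1" and h2: "hstrip g1 g2" and k: "kphi g0 g1 g2 ph"
    and U: "subgroup U (Mgrp p g2)" "emb_tableau p 1 (Mgrp p g2) U = ([g1, g2], [])"
  shows "card {A. (subgroup A (Mgrp p g2) \<and> emb_tableau p 2 (Mgrp p g2) A = ([g0, g1, g2], [ph])) \<and> pmul (Mgrp p g2) p A = U} *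
    E_aut p ([g0, g1, g2], [ph]) = E_aut p ([g1, g2], [])" and "0 < E_aut p ([g1, g2], [])"
proof -
  let ?M = "Mgrp p g2"
  interpret M: fin_p_group ?M p by (rule fin_p_group_Mgrp[OF prime])
  interpret MM: fin_p_group_pair ?M ?M p ..
  have qt1: "M.qt {\<one>\<^bsub>?M\<^esub>} = g2"
  proof (rule M.qt_eqI[OF M.triv_subgroup])
    show "is_partition g2" using h2 by (simp add: hstrip_def)
    fix k
    have "{\<one>\<^bsub>?M\<^esub>} \<inter> M.P k = {\<one>\<^bsub>?M\<^esub>}" using subgroup.one_closed[OF M.subgroup_P] by auto
    then show "M.lg (M.P k) = tail g2 k + M.lg ({\<one>\<^bsub>?M\<^esub>} \<inter> M.P k)" using M.tail_Mgrp[of g2 k] by (simp only: M.lg_one)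
  qed
  define O1 where "O1 = {U. subgroup U ?M \<and> emb_tableau p 1 ?M U = ([g1, g2], [])}"
  define O2 where "O2 = {A. subgroup A ?M \<and> emb_tableau p 2 ?M A = ([g0, g1, g2], [ph])}"
  \<comment> \<open>The last partition is the type of the whole group, so a subgroup whose quotient
    has this type is trivial.\<close>
  have k1: "pmul ?M p V = {\<one>\<^bsub>?M\<^esub>}" if "V \<in> O1" for V
  proof -
    have V: "subgroup V ?M" "M.qt (pmul ?M p V) = g2" using that M.emb_tableau_1_iff[of V g1 g2] unfolding O1_def by blast+
    then show ?thesis using M.eq_one_if_qt[OF M.pmul_subgroup[OF V(1)]] qt1 by simp
  qed
  have k2: "pmul ?M (p ^ 2) A = {\<one>\<^bsub>?M\<^esub>}" if "A \<in> O2" for A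
  proof -
    have A: "subgroup A ?M" "M.qt (pmul ?M (p ^ 2) A) = g2"
      using that M.emb_tableau_2_iff[of A g0 g1 g2 ph] unfolding O2_def by blast+
    then show ?thesis using M.eq_one_if_qt[OF M.pmul_subgroup[OF A(1)]] qt1 by simp
  qed
  have t1: "\<exists>f. f \<in> iso ?M ?M \<and> f ` V = W" if "V \<in> O1" "W \<in> O1" for V W
    using MM.elementary_iso[OF _ _ k1[OF that(1)] k1[OF that(2)]] that M.emb_tableau_1_iff unfolding O1_def by auto
  have t2: "\<exists>f. f \<in> iso ?M ?M \<and> f ` V = W" if "V \<in> O2" "W \<in> O2" for V W
    using MM.square_zero_iso[OF _ _ k2[OF that(1)] k2[OF that(2)]] that M.emb_tableau_2_iff unfolding O2_def by auto
  have "\<exists>A. A \<in> O2" using ex_square_zero_embedding[OF prime h1 h2 k] unfolding O2_def by blast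
  then have A0: "(SOME A. subgroup A ?M \<and> emb_tableau p 2 ?M A = ([g0, g1, g2], [ph])) \<in> O2" (is "?A0 \<in> _")
    unfolding O2_def by (auto intro: someI2)
  have U0: "(SOME A. subgroup A ?M \<and> emb_tableau p 1 ?M A = ([g1, g2], [])) \<in> O1" (is "?U0 \<in> _")
    using U unfolding O1_def by (auto intro: someI2)
  have e: "E_aut p ([g0, g1, g2], [ph]) = card (autS ?M ?A0)" "E_aut p ([g1, g2], []) = card (autS ?M ?U0)"
    unfolding E_aut_def tab_e_def Let_def by (simp_all add: numeral_2_eq_2)
  have m: "pmul ?M p A \<in> O1" if "A \<in> O2" for A
  proof -
    have A: "subgroup A ?M" "M.qt (pmul ?M p A) = g1" "M.qt (pmul ?M (p ^ 2) A) = g2"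
      using that M.emb_tableau_2_iff unfolding O2_def by auto
    have pA: "subgroup (pmul ?M p A) ?M" by (rule M.pmul_subgroup[OF A(1)])
    have "emb_tableau p 1 ?M (pmul ?M p A) = ([g1, g2], [])"
      unfolding M.emb_tableau_1_iff[OF pA] using A(2,3) M.pmul_square[OF A(1)] by simp
    then show ?thesis unfolding O1_def using pA by blast
  qed
  have i1: "f ` V \<in> O1" if "f \<in> iso ?M ?M" "V \<in> O1" for f V
    using that M.emb_tableau_iso[OF that(1)] unfolding O1_def by auto
  have i2: "f ` V \<in> O2" if "f \<in> iso ?M ?M" "V \<in> O2" for f V
    using that M.emb_tableau_iso[OF that(1)] unfolding O2_def by auto
  have i3: "f ` pmul ?M p A = pmul ?M p (f ` A)" if "f \<in> iso ?M ?M" "A \<in> O2" for f A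
    using that M.emb_tableau_iso(4)[OF that(1)] unfolding O2_def by auto
  have s1: "V \<subseteq> carrier ?M" if "V \<in> O1" for V using that subgroup.subset unfolding O1_def by blast
  have s2: "V \<subseteq> carrier ?M" if "V \<in> O2" for V using that subgroup.subset unfolding O2_def by blast
  have UO: "U \<in> O1" using U unfolding O1_def by simp
  have eq: "{A. (subgroup A ?M \<and> emb_tableau p 2 ?M A = ([g0, g1, g2], [ph])) \<and> pmul ?M p A = U} = {A \<in> O2. pmul ?M p A = U}"
    unfolding O2_def by simp
  note F = M.card_fibre_stabilizers[where ?\<Omega>1.0 = O1 and ?\<Omega>2.0 = O2 and m = "pmul ?M p", OF M.finite_carrier s1 i1 t1 s2 i2 t2 m i3 A0 U0 UO]
  show "card {A. (subgroup A ?M \<and> emb_tableau p 2 ?M A = ([g0, g1, g2], [ph])) \<and> pmul ?M p A = U} *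
    E_aut p ([g0, g1, g2], [ph]) = E_aut p ([g1, g2], [])" "0 < E_aut p ([g1, g2], [])"
    unfolding eq e using F by blast+
qed

context fin_p_surj
begin

lemma image_subset_cancel:
  assumes S: "subgroup S G" and T: "subgroup T G" and "K \<subseteq> T" and "h ` S \<subseteq> h ` T" shows "S \<subseteq> T"
proof
  fix s assume s: "s \<in> S"
  then obtain t where t: "t \<in> T" "h s = h t" using assms(4) by blast
  have c: "s \<in> carrier G" "t \<in> carrier G" using s t subgroup.mem_carrier S T by metis+
  then have "inv\<^bsub>G\<^esub> t \<otimes>\<^bsub>G\<^esub> s \<in> K" unfolding kernel_def using t(2) by simp
  then have "t \<otimes>\<^bsub>G\<^esub> (inv\<^bsub>G\<^esub> t \<otimes>\<^bsub>G\<^esub> s) \<in> T" using assms(3) t(1) subgroup.m_closed[OF T] by blast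
  then show "s \<in> T" using c by (simp add: G.m_assoc[symmetric])
qed

lemma subgroup_vimage:
  assumes "subgroup T H" shows "subgroup {x \<in> carrier G. h x \<in> T} G"
  by (rule G.subgroupI)
     (use subgroup.one_closed[OF assms] subgroup.m_closed[OF assms] subgroup.m_inv_closed[OF assms] in \<open>auto intro!: exI[of _ "\<one>\<^bsub>G\<^esub>"]\<close>)

text \<open>A lift of a subgroup along the quotient by \<open>pY\<close> has the right multiple
  \<open>pA = Y\<close> already if this holds modulo \<open>pY\<close>, by Nakayama's lemma.\<close>

lemma card_lifts:
  assumes Y: "subgroup Y G" and K: "K = pmul G p Y" and g2: "G.qt (pmul G p Y) = g2" and g1: "G.qt Y = g1"
  shows "card {A. subgroup A G \<and> pmul G p A = Y \<and> G.qt A = g0 \<and> emb_phi p G A 2 = ph} =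
    card {A. (subgroup A H \<and> emb_tableau p 2 H A = ([g0, g1, g2], [ph])) \<and> pmul H p A = h ` Y}"
    (is "card ?L = card ?R")
proof -
  have tab: "emb_tableau p 2 H (h ` A) = ([g0, g1, g2], [ph]) \<longleftrightarrow> G.qt A = g0 \<and> emb_phi p G A 2 = ph"
    and pimg: "pmul H p (h ` A) = h ` Y" if A: "subgroup A G" "pmul G p A = Y" for A
  proof -
    have KA: "K \<subseteq> pmul G (p ^ 2) A" using K G.pmul_square[OF A(1)] A(2) by simp
    note hA = h.subgroup_img_is_subgroup[OF A(1)]
    show "pmul H p (h ` A) = h ` Y" using h.image_pmul[OF subgroup.subset[OF A(1)]] A(2) by metis
    have "H.qt (pmul H (p ^ i) (h ` A)) = G.qt (pmul G (p ^ i) A)" if "i \<le> 2" for i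
      using emb_image(1)[OF A(1) KA that] unfolding G.emb_gamma_qt H.emb_gamma_qt .
    from this[of 0] this[of 1] this[of 2]
    have "H.qt (h ` A) = G.qt A" "H.qt (pmul H p (h ` A)) = g1" "H.qt (pmul H (p ^ 2) (h ` A)) = g2"
      using A(2) g1 g2 G.pmul_square[OF A(1)] subgroup.subset[OF A(1)] subgroup.subset[OF hA] by simp_all
    then show "emb_tableau p 2 H (h ` A) = ([g0, g1, g2], [ph]) \<longleftrightarrow> G.qt A = g0 \<and> emb_phi p G A 2 = ph"
      using emb_image(2)[OF A(1) KA] H.emb_tableau_2_iff[OF hA] by auto
  qed
  have KA: "K \<subseteq> A" if "subgroup A G" "pmul G p A = Y" for A
    using K G.pmul_subset[OF Y] G.pmul_subset[OF that(1)] that(2) by blast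
  have "bij_betw (\<lambda>A. h ` A) ?L ?R"
    unfolding bij_betw_def
  proof
    show "inj_on (\<lambda>A. h ` A) ?L"
    proof (rule inj_onI)
      fix A B assume "A \<in> ?L" "B \<in> ?L" and eq: "h ` A = h ` B"
      then have s: "subgroup A G" "pmul G p A = Y" "subgroup B G" "pmul G p B = Y" by auto
      show "A = B"
        using image_subset_cancel[OF s(1,3) KA[OF s(3,4)]] image_subset_cancel[OF s(3,1) KA[OF s(1,2)]] eq by blast
    qed
    show "(\<lambda>A. h ` A) ` ?L = ?R"
    proof (intro equalityI subsetI)
      fix A' assume "A' \<in> (\<lambda>A. h ` A) ` ?L"
      then obtain A where "A' = h ` A" "subgroup A G" "pmul G p A = Y" "G.qt A = g0" "emb_phi p G A 2 = ph" by auto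
      then show "A' \<in> ?R" using tab pimg h.subgroup_img_is_subgroup by auto
    next
      fix A' assume A': "A' \<in> ?R"
      define A where "A = {x \<in> carrier G. h x \<in> A'}"
      have A: "subgroup A G" unfolding A_def using A' by (intro subgroup_vimage) simp
      have hA: "h ` A = A'" 
      proof
        show "A' \<subseteq> h ` A"
        proof
          fix y assume y: "y \<in> A'"
          then have "y \<in> carrier H" using A' subgroup.mem_carrier by fastforce
          then obtain x where "x \<in> carrier G" "y = h x" using surj by blast
          then show "y \<in> h ` A" using y unfolding A_def by blast
        qed
      qed (auto simp: A_def)
      have sp: "subgroup (pmul G p A) G" "subgroup (pmul G p Y) G" by (intro G.pmul_subgroup A Y)+
      have s: "subgroup (pmul G p A <#>\<^bsub>G\<^esub> pmul G p Y) G" by (intro G.mult_subgroups sp)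
      have Ks: "K \<subseteq> pmul G p A <#>\<^bsub>G\<^esub> pmul G p Y"
        unfolding K by (rule G.set_mult_right_subset[OF sp(1) subgroup.subset[OF sp(2)]])
      have KY: "K \<subseteq> Y" using K G.pmul_subset[OF Y] by simp
      have hpY: "h ` pmul G p Y = {\<one>\<^bsub>H\<^esub>}"
        using K subgroup.one_closed[OF sp(2)] unfolding kernel_def by (auto intro!: image_eqI[of _ _ "\<one>\<^bsub>G\<^esub>"] h.hom_one[symmetric])
      have "h ` (pmul G p A <#>\<^bsub>G\<^esub> pmul G p Y) = h ` pmul G p A <#>\<^bsub>H\<^esub> {\<one>\<^bsub>H\<^esub>}"
        using image_set_mult[OF subgroup.subset[OF sp(1)] subgroup.subset[OF sp(2)]] hpY by simp
      also have "\<dots> = h ` pmul G p A" by (rule H.set_mult_one_right[OF h.subgroup_img_is_subgroup[OF sp(1)]])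
      also have "\<dots> = h ` Y" using h.image_pmul[OF subgroup.subset[OF A]] hA A' by simp
      finally have "h ` (pmul G p A <#>\<^bsub>G\<^esub> pmul G p Y) = h ` Y" .
      then have "pmul G p A <#>\<^bsub>G\<^esub> pmul G p Y = Y"
        using image_subset_cancel[OF s Y KY] image_subset_cancel[OF Y s Ks] by blast
      then have "pmul G p A = Y" by (rule G.nakayama[OF sp(1) Y])
      then have "A \<in> ?L" using tab[OF A] A A' hA by auto
      then show "A' \<in> (\<lambda>A. h ` A) ` ?L" using hA by blast
    qed
  qed
  then show ?thesis by (rule bij_betw_same_card)
qed

end

section \<open>The product formula\<close>

text \<open>The continuation beyond e agrees with the padding in \<open>restr\<close>, so the factor
  l = e + 1 is treated like all others.\<close>

definition tab_g :: "tableau \<Rightarrow> nat \<Rightarrow> nat list" where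
  "tab_g T j = (if j < length (fst T) then fst T ! j else last (fst T))"

definition tab_ph :: "tableau \<Rightarrow> nat \<Rightarrow> nat \<times> nat \<Rightarrow> nat" where
  "tab_ph T j = (if 2 \<le> j \<and> j < length (fst T) then snd T ! (j - 2) else (\<lambda>_. 0))"

lemma tab_g_eq:
  "fst T \<noteq> [] \<Longrightarrow> (if j \<le> length (fst T) - 1 then fst T ! j else fst T ! (length (fst T) - 1)) = tab_g T j"
  unfolding tab_g_def by (cases "fst T" rule: rev_cases) (auto simp: last_conv_nth)

lemma tab_ph_eq:
  "fst T \<noteq> [] \<Longrightarrow> (if 2 \<le> j \<and> j \<le> length (fst T) - 1 then snd T ! (j - 2) else (\<lambda>_. 0)) = tab_ph T j"
  unfolding tab_ph_def by (cases "fst T" rule: rev_cases) auto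

lemma restr_eq:
  assumes "fst T \<noteq> []"
  shows "restr T u l = (map (\<lambda>j. tab_g T (l - u + j)) [0..<u + 1], map (\<lambda>j. tab_ph T (l - u + j)) [2..<u + 1])"
  unfolding restr_def Let_def tab_g_eq[OF assms] tab_ph_eq[OF assms] ..

lemma restr_1: "fst T \<noteq> [] \<Longrightarrow> restr T 1 (j + 2) = ([tab_g T (j + 1), tab_g T (j + 2)], [])"
  by (simp add: restr_eq)

lemma restr_2: "fst T \<noteq> [] \<Longrightarrow> restr T 2 (j + 2) = ([tab_g T j, tab_g T (j + 1), tab_g T (j + 2)], [tab_ph T (j + 2)])"
  by (simp add: restr_eq upt_rec[of _ "Suc _"] numeral_2_eq_2)

lemma hstrip_refl: "is_partition la \<Longrightarrow> hstrip la la"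
  by (simp add: hstrip_def)

lemma skew_same: "skew la la = {}"
  by (auto simp: skew_def)

lemma kphi_zero: "kphi g0 g1 g1 (\<lambda>_. 0)"
  by (simp add: kphi_def skew_same)

text \<open>If j + 2 = e + 1, the third partition is the padding, the upper stripe is empty, and the
  zero function satisfies its conditions.\<close>

lemma klein_tab_step:
  assumes "klein_tableau T" "j < tab_e T"
  shows "hstrip (tab_g T j) (tab_g T (j + 1))" "hstrip (tab_g T (j + 1)) (tab_g T (j + 2))"
    "kphi (tab_g T j) (tab_g T (j + 1)) (tab_g T (j + 2)) (tab_ph T (j + 2))"
proof -
  obtain gs phs where T: "T = (gs, phs)" by (cases T)
  note K = klein_tableauD[OF assms(1)[unfolded T]]
  have j: "Suc j < length gs" using assms(2) unfolding T tab_e_def by simp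
  show "hstrip (tab_g T j) (tab_g T (j + 1))" using K(4)[of "Suc j"] j unfolding T tab_g_def by simp
  show "hstrip (tab_g T (j + 1)) (tab_g T (j + 2))"
  proof (cases "j + 2 < length gs")
    case True
    then show ?thesis using K(4)[of "j + 2"] unfolding T tab_g_def by simp
  next
    case False
    then have "length gs = Suc (Suc j)" using j by arith
    then have "last gs = gs ! Suc j" using K(1) by (simp add: last_conv_nth)
    then show ?thesis using False j hstrip_refl[OF K(3)[OF j]] unfolding T tab_g_def by simp
  qed
  show "kphi (tab_g T j) (tab_g T (j + 1)) (tab_g T (j + 2)) (tab_ph T (j + 2))"
  proof (cases "j + 2 < length gs")
    case True
    then show ?thesis using K(5)[of "j + 2"] unfolding T tab_g_def tab_ph_def by simp
  next
    case False
    then have "length gs = Suc (Suc j)" using j by arith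
    then have "last gs = gs ! Suc j" using K(1) by (simp add: last_conv_nth)
    then show ?thesis using False j kphi_zero unfolding T tab_g_def tab_ph_def by simp
  qed
qed

lemma list_eq_map_upt_iff: "xs = map f [a..<b] \<longleftrightarrow> length xs = b - a \<and> (\<forall>i. a \<le> i \<and> i < b \<longrightarrow> xs ! (i - a) = f i)"
proof
  assume r: "length xs = b - a \<and> (\<forall>i. a \<le> i \<and> i < b \<longrightarrow> xs ! (i - a) = f i)"
  show "xs = map f [a..<b]"
  proof (rule nth_equalityI)
    fix i assume "i < length xs"
    then show "xs ! i = map f [a..<b] ! i" using conjunct2[OF r, THEN spec, of "a + i"] r by simp
  qed (use r in simp)
qed auto

context fin_p_group
begin

lemma emb_phi_zero:
  assumes A: "subgroup A G" and "pmul G p A = {\<one>}" shows "emb_phi p G A 2 = (\<lambda>_. 0)"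
proof
  fix b
  have "pmul G (p ^ 2) A = {\<one>}" unfolding pmul_square[OF A] assms(2) by (rule pmul_one)
  from phi_specD(1)[OF emb_square_zero(6)[OF A this]] show "emb_phi p G A 2 b = 0"
    unfolding assms(2) skew_same by simp
qed

text \<open>One factor of the product. The quotient by pY has type g2 and is identified with
  \<open>Mgrp p g2\<close>, because \<open>E_aut\<close> refers to embeddings into that
  group.\<close>

lemma card_extensions:
  assumes Y: "subgroup Y G" and qY: "qt Y = g1" and qpY: "qt (pmul G p Y) = g2"
    and h1: "hstrip g0 g1" and h2: "hstrip g1 g2" and k: "kphi g0 g1 g2 ph"
  shows "real (card {A. subgroup A G \<and> pmul G p A = Y \<and> qt A = g0 \<and> emb_phi p G A 2 = ph}) =
    real (E_aut p ([g1, g2], [])) / real (E_aut p ([g0, g1, g2], [ph]))" (is "real (card ?L) = _")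
    and "0 < card {A. subgroup A G \<and> pmul G p A = Y \<and> qt A = g0 \<and> emb_phi p G A 2 = ph}"
proof -
  let ?N = "pmul G p Y" and ?M = "Mgrp p g2"
  have N: "subgroup ?N G" by (rule pmul_subgroup[OF Y])
  interpret M: fin_p_group ?M p by (rule fin_p_group_Mgrp[OF prime])
  interpret Q: fin_p_surj G "G Mod ?N" p "\<lambda>x. ?N #> x" by (rule fin_p_surj_Mod[OF N])
  have "is_partition g2" using h2 by (simp add: hstrip_def)
  then have "G Mod ?N \<cong> ?M" using Q.H.is_iso_iff_grp_type qpY by simp
  then obtain f where f: "f \<in> iso (G Mod ?N) ?M" by (auto simp: is_iso_def)
  define h where "h x = f (?N #> x)" for x
  have fh: "f \<in> hom (G Mod ?N) ?M" and fb: "bij_betw f (carrier (G Mod ?N)) (carrier ?M)" using f by (auto simp: iso_def)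
  have hh: "h \<in> hom G ?M" using Q.hom fh unfolding h_def hom_def by (auto simp: Pi_iff)
  have hs: "h ` carrier G = carrier ?M"
    using Q.surj fb unfolding h_def bij_betw_def by (metis image_image)
  interpret S: fin_p_surj G ?M p h by unfold_locales (rule hh, rule hs)
  interpret F: group_hom "G Mod ?N" ?M f by unfold_locales (rule fh)
  have K: "kernel G ?M h = ?N"
  proof -
    have "f z = \<one>\<^bsub>?M\<^esub> \<longleftrightarrow> z = \<one>\<^bsub>G Mod ?N\<^esub>" if "z \<in> carrier (G Mod ?N)" for z
      using F.hom_one inj_onD[OF bij_betw_imp_inj_on[OF fb], of z "\<one>\<^bsub>G Mod ?N\<^esub>"] that Q.H.one_closed by auto
    then have "kernel G ?M h = kernel G (G Mod ?N) (\<lambda>x. ?N #> x)"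
      unfolding kernel_def h_def using Q.h.hom_closed by blast
    then show ?thesis using kernel_Mod[OF N] by simp
  qed
  have hY: "subgroup (h ` Y) ?M" by (rule S.h.subgroup_img_is_subgroup[OF Y])
  have "emb_tableau p 1 ?M (h ` Y) = ([g1, g2], [])"
  proof -
    have "M.qt (h ` Y) = g1" using S.qt_image[OF Y] K pmul_subset[OF Y] qY by simp
    moreover have "M.qt (pmul ?M p (h ` Y)) = g2"
      using S.qt_image[OF N] K qpY S.h.image_pmul[OF subgroup.subset[OF Y]] by simp
    ultimately show ?thesis using M.emb_tableau_1_iff[OF hY] by simp
  qed
  note E = card_fibre_E_aut[OF prime h1 h2 k hY this]
  define c x y where "c = card ?L" and "x = E_aut p ([g0, g1, g2], [ph])" and "y = E_aut p ([g1, g2], [])"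
  \<comment> \<open>Since the product is positive, so are both factors; this gives the existence of
    an extension and the nonzero denominator at once.\<close>
  have L: "c * x = y" unfolding c_def x_def y_def S.card_lifts[OF Y K qpY qY] by (rule E(1))
  have y: "0 < y" unfolding y_def by (rule E(2))
  have "0 < c" using L y by (cases c) auto
  then show "0 < card ?L" unfolding c_def .
  have "0 < x" using L y by (cases x) auto
  moreover have "real c * real x = real y" using L by (simp flip: of_nat_mult)
  ultimately have "real c = real y / real x" by (simp add: field_simps)
  then show "real (card ?L) = real (E_aut p ([g1, g2], [])) / real (E_aut p ([g0, g1, g2], [ph]))"
    unfolding c_def x_def y_def .
qed

lemma emb_tableau_eq_iff:
  assumes len: "length (fst T) = n + 1" "length (snd T) = n - 1"
  shows "emb_tableau p n G A = T \<longleftrightarrow>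
    (\<forall>i\<le>n. emb_gamma p G A i = tab_g T i) \<and> (\<forall>i. 2 \<le> i \<and> i \<le> n \<longrightarrow> emb_phi p G A i = tab_ph T i)"
proof -
  have "emb_tableau p n G A = T \<longleftrightarrow> fst T = map (emb_gamma p G A) [0..<n + 1] \<and> snd T = map (emb_phi p G A) [2..<n + 1]"
    unfolding emb_tableau_def by (cases T) auto
  also have "\<dots> \<longleftrightarrow> (\<forall>i. 0 \<le> i \<and> i < n + 1 \<longrightarrow> fst T ! (i - 0) = emb_gamma p G A i) \<and>
      (\<forall>i. 2 \<le> i \<and> i < n + 1 \<longrightarrow> snd T ! (i - 2) = emb_phi p G A i)"
    unfolding list_eq_map_upt_iff using len by auto
  also have "\<dots> \<longleftrightarrow> (\<forall>i\<le>n. emb_gamma p G A i = tab_g T i) \<and> (\<forall>i. 2 \<le> i \<and> i \<le> n \<longrightarrow> emb_phi p G A i = tab_ph T i)"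
    using len by (auto simp: tab_g_def tab_ph_def less_Suc_eq_le)
  finally show ?thesis .
qed

text \<open>The subgroups that can occur as \<open>p\<^sup>j U\<close> for a subgroup \<open>U\<close> with tableau \<open>T\<close>. The
  product formula is obtained by peeling off the factor for the step from \<open>p\<^sup>j\<^sup>+\<^sup>1 U\<close> to \<open>p\<^sup>j U\<close>.\<close>

definition tails :: "tableau \<Rightarrow> nat \<Rightarrow> 'a set set" where
  "tails T j = {Y. subgroup Y G \<and> (\<forall>i. j \<le> i \<and> i \<le> tab_e T \<longrightarrow> emb_gamma p G Y (i - j) = tab_g T i) \<and>
    (\<forall>i. j + 2 \<le> i \<and> i \<le> tab_e T \<longrightarrow> emb_phi p G Y (i - j) = tab_ph T i)}"

lemma tails_last:
  assumes "qt {\<one>} = tab_g T (tab_e T)" shows "tails T (tab_e T) = {{\<one>}}"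
proof (intro equalityI subsetI)
  fix Y assume "Y \<in> tails T (tab_e T)"
  then have Y: "subgroup Y G" "emb_gamma p G Y 0 = tab_g T (tab_e T)" unfolding tails_def by auto
  then have "qt Y = qt {\<one>}" using assms subgroup.subset[OF Y(1)] unfolding emb_gamma_qt by simp
  then show "Y \<in> {{\<one>}}" using eq_one_if_qt[OF Y(1)] by simp
next
  fix Y assume "Y \<in> {{\<one>}}"
  then show "Y \<in> tails T (tab_e T)" using assms triv_subgroup pmul_one unfolding tails_def emb_gamma_qt by (auto dest: le_antisym)
qed

text \<open>Passing from A to pA shifts all indices by one, so beyond the condition on pA only the
  type of G/A and the subscripts of the second stripe of A remain to be prescribed.\<close>

lemma tails_step:
  assumes K: "klein_tableau T" and q: "qt {\<one>} = tab_g T (tab_e T)" and j: "j < tab_e T"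
  shows "A \<in> tails T j \<longleftrightarrow>
    (\<exists>Y\<in>tails T (Suc j). A \<in> {A. subgroup A G \<and> pmul G p A = Y \<and> qt A = tab_g T j \<and> emb_phi p G A 2 = tab_ph T (j + 2)})"
proof -
  have main: "A \<in> tails T j \<longleftrightarrow> pmul G p A \<in> tails T (Suc j) \<and> qt A = tab_g T j \<and> emb_phi p G A 2 = tab_ph T (j + 2)"
    if A: "subgroup A G"
  proof -
    have Ac: "A \<subseteq> carrier G" by (rule subgroup.subset[OF A])
    have g: "emb_gamma p G (pmul G p A) i = emb_gamma p G A (Suc i)" for i using emb_gamma_shift[OF A, of 1 i] by simp
    have f: "emb_phi p G (pmul G p A) i = emb_phi p G A (Suc i)" if "2 \<le> i" for i using emb_phi_shift[OF A that, of 1] by simp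
    have g0: "emb_gamma p G A 0 = qt A" unfolding emb_gamma_qt using Ac by simp
    have G: "(\<forall>i. j \<le> i \<and> i \<le> tab_e T \<longrightarrow> emb_gamma p G A (i - j) = tab_g T i) \<longleftrightarrow>
      qt A = tab_g T j \<and> (\<forall>i. Suc j \<le> i \<and> i \<le> tab_e T \<longrightarrow> emb_gamma p G (pmul G p A) (i - Suc j) = tab_g T i)" (is "?l \<longleftrightarrow> ?r")
    proof
      assume l: ?l
      show ?r
      proof (intro conjI allI impI)
        show "qt A = tab_g T j" using l[rule_format, of j] j g0 by simp
        fix i assume i: "Suc j \<le> i \<and> i \<le> tab_e T"
        then have "Suc (i - Suc j) = i - j" by arith
        then show "emb_gamma p G (pmul G p A) (i - Suc j) = tab_g T i" using l[rule_format, of i] g[of "i - Suc j"] i by simp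
      qed
    next
      assume r: ?r
      show ?l
      proof (intro allI impI)
        fix i assume i: "j \<le> i \<and> i \<le> tab_e T"
        show "emb_gamma p G A (i - j) = tab_g T i"
        proof (cases "i = j")
          case True
          then show ?thesis using r g0 by simp
        next
          case False
          then have "Suc (i - Suc j) = i - j" "Suc j \<le> i" using i by arith+
          then show ?thesis using conjunct2[OF r, rule_format, of i] g[of "i - Suc j"] i by simp
        qed
      qed
    qed
    have F: "(\<forall>i. j + 2 \<le> i \<and> i \<le> tab_e T \<longrightarrow> emb_phi p G A (i - j) = tab_ph T i) \<longleftrightarrow>
      (j + 2 \<le> tab_e T \<longrightarrow> emb_phi p G A 2 = tab_ph T (j + 2)) \<and>
      (\<forall>i. Suc j + 2 \<le> i \<and> i \<le> tab_e T \<longrightarrow> emb_phi p G (pmul G p A) (i - Suc j) = tab_ph T i)" (is "?l \<longleftrightarrow> ?r")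
    proof
      assume l: ?l
      show ?r
      proof (intro conjI allI impI)
        show "emb_phi p G A 2 = tab_ph T (j + 2)" if "j + 2 \<le> tab_e T" using l[rule_format, of "j + 2"] that by simp
        fix i assume i: "Suc j + 2 \<le> i \<and> i \<le> tab_e T"
        then have "Suc (i - Suc j) = i - j" "2 \<le> i - Suc j" by arith+
        then show "emb_phi p G (pmul G p A) (i - Suc j) = tab_ph T i" using l[rule_format, of i] f[of "i - Suc j"] i by simp
      qed
    next
      assume r: ?r
      show ?l
      proof (intro allI impI)
        fix i assume i: "j + 2 \<le> i \<and> i \<le> tab_e T"
        show "emb_phi p G A (i - j) = tab_ph T i"
        proof (cases "i = j + 2")
          case True
          then show ?thesis using r i by simp
        next
          case False
          then have "Suc (i - Suc j) = i - j" "2 \<le> i - Suc j" "Suc j + 2 \<le> i" using i by arith+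
          then show ?thesis using conjunct2[OF r, rule_format, of i] f[of "i - Suc j"] i by simp
        qed
      qed
    qed
    \<comment> \<open>For j + 1 = e the definition of \<open>tails\<close> does not mention
      subscripts, while the fibre asks for the zero function; this holds automatically because pA is
      trivial.\<close>
    have Z: "emb_phi p G A 2 = tab_ph T (j + 2)" if "\<not> j + 2 \<le> tab_e T" and r: "pmul G p A \<in> tails T (Suc j)"
    proof -
      have "Suc j = tab_e T" using that(1) j by simp
      then have "pmul G p A = {\<one>}" using r tails_last[OF q] by simp
      moreover have "tab_ph T (j + 2) = (\<lambda>_. 0)" using that(1) unfolding tab_ph_def tab_e_def by auto
      ultimately show ?thesis using emb_phi_zero[OF A] by simp
    qed
    have pA: "subgroup (pmul G p A) G" by (rule pmul_subgroup[OF A])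
    have "A \<in> tails T j \<longleftrightarrow> pmul G p A \<in> tails T (Suc j) \<and> qt A = tab_g T j \<and>
      (j + 2 \<le> tab_e T \<longrightarrow> emb_phi p G A 2 = tab_ph T (j + 2))"
      unfolding tails_def mem_Collect_eq G F using A pA by blast
    then show ?thesis using Z by blast
  qed
  have "subgroup A G" if "A \<in> tails T j" using that unfolding tails_def by simp
  then show ?thesis using main by blast
qed

lemma finite_subgroups: "finite {A. subgroup A G}"
  by (rule finite_subset[of _ "Pow (carrier G)"]) (auto simp: finite_carrier dest: subgroup.subset)

text \<open>Positivity is carried through the induction: it shows that every Klein tableau ending in
  the type of G is realized by a subgroup of G.\<close>

lemma card_tails:
  assumes K: "klein_tableau T" and q: "qt {\<one>} = tab_g T (tab_e T)" and d: "d \<le> tab_e T"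
  shows "real (card (tails T (tab_e T - d))) =
      (\<Prod>j\<in>{tab_e T - d..<tab_e T}. real (E_aut p (restr T 1 (j + 2))) / real (E_aut p (restr T 2 (j + 2))))
    \<and> 0 < card (tails T (tab_e T - d))"
  using d
proof (induction d)
  case 0
  then show ?case by (simp add: tails_last[OF q])
next
  case (Suc d)
  define j where "j = tab_e T - Suc d"
  have j: "j < tab_e T" "Suc j = tab_e T - d" using Suc.prems unfolding j_def by auto
  have ne: "fst T \<noteq> []" using klein_tableauD(1)[of "fst T" "snd T"] K by simp
  let ?F = "\<lambda>Y. {A. subgroup A G \<and> pmul G p A = Y \<and> qt A = tab_g T j \<and> emb_phi p G A 2 = tab_ph T (j + 2)}"
  let ?r = "real (E_aut p (restr T 1 (j + 2))) / real (E_aut p (restr T 2 (j + 2)))"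
  have F: "real (card (?F Y)) = ?r \<and> 0 < card (?F Y)" if Y: "Y \<in> tails T (Suc j)" for Y
  proof -
    have sY: "subgroup Y G" and g: "\<And>i. Suc j \<le> i \<Longrightarrow> i \<le> tab_e T \<Longrightarrow> emb_gamma p G Y (i - Suc j) = tab_g T i"
      using Y unfolding tails_def by auto
    have Yc: "Y \<subseteq> carrier G" by (rule subgroup.subset[OF sY])
    have q1: "qt Y = tab_g T (j + 1)" using g[of "Suc j"] j Yc unfolding emb_gamma_qt by simp
    have q2: "qt (pmul G p Y) = tab_g T (j + 2)"
    proof (cases "j + 2 \<le> tab_e T")
      case True
      then show ?thesis using g[of "j + 2"] unfolding emb_gamma_qt by simp
    next
      case False
      then have e: "Suc j = tab_e T" using j by simp
      then have "Y = {\<one>}" using Y tails_last[OF q] by simp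
      moreover have "tab_g T (j + 2) = tab_g T (tab_e T)"
        using ne e unfolding tab_g_def tab_e_def by (auto simp: last_conv_nth)
      ultimately show ?thesis using q by (simp add: pmul_one)
    qed
    note S = klein_tab_step[OF K j(1)]
    show ?thesis unfolding restr_1[OF ne] restr_2[OF ne] using card_extensions[OF sY q1 q2 S] by simp
  qed
  have "tails T j = (\<Union>Y\<in>tails T (Suc j). ?F Y)" using tails_step[OF K q j(1)] by blast
  moreover have fin: "finite (tails T (Suc j))" by (rule finite_subset[OF _ finite_subgroups]) (auto simp: tails_def)
  moreover have "finite (?F Y)" for Y by (rule finite_subset[OF _ finite_subgroups]) auto
  ultimately have c: "card (tails T j) = (\<Sum>Y\<in>tails T (Suc j). card (?F Y))" by (simp only:) (rule card_UN_disjoint; auto)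
  then have "real (card (tails T j)) = (\<Sum>Y\<in>tails T (Suc j). real (card (?F Y)))" by simp
  also have "\<dots> = (\<Sum>Y\<in>tails T (Suc j). ?r)" using F by (intro sum.cong) auto
  also have "\<dots> = real (card (tails T (Suc j))) * ?r" by simp
  finally have 1: "real (card (tails T j)) = real (card (tails T (Suc j))) * ?r" .
  have IH: "real (card (tails T (Suc j))) = (\<Prod>j\<in>{Suc j..<tab_e T}. real (E_aut p (restr T 1 (j + 2))) / real (E_aut p (restr T 2 (j + 2))))"
    "0 < card (tails T (Suc j))" using Suc.IH Suc.prems unfolding j(2)[symmetric] by auto
  have "{j..<tab_e T} = insert j {Suc j..<tab_e T}" using j(1) by auto
  then have "real (card (tails T j)) = (\<Prod>j\<in>{j..<tab_e T}. real (E_aut p (restr T 1 (j + 2))) / real (E_aut p (restr T 2 (j + 2))))"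
    unfolding 1 IH(1) by (simp add: mult.commute)
  moreover obtain Y where "Y \<in> tails T (Suc j)" using IH(2) by (metis card.empty less_irrefl ex_in_conv)
  then have "0 < card (tails T j)" unfolding c using F fin by (intro sum_pos2[of _ Y]) auto
  ultimately show ?case unfolding j_def by simp
qed

lemma card_emb_tableau:
  assumes K: "klein_tableau T" and q: "qt {\<one>} = tab_g T (tab_e T)"
  shows "real (card {A. subgroup A G \<and> emb_tableau p (tab_e T) G A = T}) =
      (\<Prod>l\<in>{2..tab_e T + 1}. real (E_aut p (restr T 1 l)) / real (E_aut p (restr T 2 l)))"
    and "0 < card {A. subgroup A G \<and> emb_tableau p (tab_e T) G A = T}"
proof -
  have K': "klein_tableau (fst T, snd T)" using K by simp
  have len: "length (fst T) = tab_e T + 1" "length (snd T) = tab_e T - 1"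
    using klein_tableauD(1,2)[OF K'] unfolding tab_e_def by (simp_all add: Suc_diff_1)
  have eq: "{A. subgroup A G \<and> emb_tableau p (tab_e T) G A = T} = tails T 0"
    unfolding tails_def emb_tableau_eq_iff[OF len] by auto
  define F where "F l = real (E_aut p (restr T 1 l)) / real (E_aut p (restr T 2 l))" for l
  have ct: "real (card (tails T 0)) = (\<Prod>j\<in>{0..<tab_e T}. F (j + 2)) \<and> 0 < card (tails T 0)"
    using card_tails[OF K q order_refl] unfolding diff_self_eq_0 F_def .
  \<comment> \<open>The step from p^(j+1) U to p^j U corresponds to the factor l = j + 2.\<close>
  have "{0 + 2..<tab_e T + 2} = {2..tab_e T + 1}" by auto
  then have "(\<Prod>j\<in>{0..<tab_e T}. F (j + 2)) = (\<Prod>l\<in>{2..tab_e T + 1}. F l)"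
    using prod.shift_bounds_nat_ivl[of F 0 2 "tab_e T"] by (simp only:)
  then show "real (card {A. subgroup A G \<and> emb_tableau p (tab_e T) G A = T}) =
      (\<Prod>l\<in>{2..tab_e T + 1}. real (E_aut p (restr T 1 l)) / real (E_aut p (restr T 2 l)))"
    unfolding eq F_def[symmetric] using ct by (simp only:)
  show "0 < card {A. subgroup A G \<and> emb_tableau p (tab_e T) G A = T}"
    unfolding eq using ct by blast
qed

section \<open>The conditions in the Hall number in terms of orders\<close>

lemma subgroup_fin_p_group:
  assumes U: "subgroup U G" shows "fin_p_group (G\<lparr>carrier := U\<rparr>) p"
proof (intro fin_p_group.intro fin_p_group_axioms.intro prime)
  show "comm_group (G\<lparr>carrier := U\<rparr>)"
    by (rule group.group_comm_groupI[OF subgroup.subgroup_is_group[OF U is_group]])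
       (use subgroup.mem_carrier[OF U] m_comm in auto)
  show "finite (carrier (G\<lparr>carrier := U\<rparr>))" using finite_subgroup[OF U] by simp
  show "\<exists>n. order (G\<lparr>carrier := U\<rparr>) = p ^ n" using card_subgroup[OF U] by (auto simp: order_def)
qed

lemma subgroup_iso_Mgrp_iff:
  assumes U: "subgroup U G"
  shows "G\<lparr>carrier := U\<rparr> \<cong> Mgrp p la \<longleftrightarrow> (\<forall>k. lg (pmul G (p ^ k) U) = tail la k)"
proof -
  interpret U: fin_p_group "G\<lparr>carrier := U\<rparr>" p by (rule subgroup_fin_p_group[OF U])
  have "pmul (G\<lparr>carrier := U\<rparr>) n U = pmul G n U" for n unfolding pmul_def by (simp flip: nat_pow_consistent)
  then show ?thesis using U.is_iso_Mgrp_iff by simp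
qed

text \<open>The type of G/N has as many boxes as the logarithm of the order of G/N. This turns the
  condition on stripe sizes in \<open>has_type\<close> into one on the orders of the groups p^l
  A.\<close>

lemma card_skew_emb_gamma:
  assumes A: "subgroup A G" and "1 \<le> l"
  shows "card (skew (emb_gamma p G A l) (emb_gamma p G A (l - 1))) + lg (pmul G (p ^ l) A) = lg (pmul G (p ^ (l - 1)) A)"
proof -
  have s: "subgroup (pmul G (p ^ l) A) G" "subgroup (pmul G (p ^ (l - 1)) A) G" by (intro pmul_subgroup A)+
  have "pmul G (p ^ l) A = pmul G p (pmul G (p ^ (l - 1)) A)" using pmul_pow_Suc[OF A, of "l - 1"] assms(2) by simp
  then have sub: "pmul G (p ^ l) A \<subseteq> pmul G (p ^ (l - 1)) A" using pmul_subset[OF s(2)] by simp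
  have "card (skew (qt (pmul G (p ^ l) A)) (qt (pmul G (p ^ (l - 1)) A))) + tail (qt (pmul G (p ^ (l - 1)) A)) 0 = tail (qt (pmul G (p ^ l) A)) 0"
  proof (rule card_skew[OF qt_partition[OF s(2)] qt_partition[OF s(1)]])
    fix m :: nat assume "1 \<le> m"
    then show "conjp (qt (pmul G (p ^ (l - 1)) A)) m \<le> conjp (qt (pmul G (p ^ l) A)) m"
      using conjp_qt_mono[OF s sub, of "m - 1"] by simp
  qed
  then show ?thesis using tail_qt_0[OF s(1)] tail_qt_0[OF s(2)] unfolding emb_gamma_qt by linarith
qed

lemma qt_one_iff: "is_partition be \<Longrightarrow> G \<cong> Mgrp p be \<Longrightarrow> qt {\<one>} = be"
proof (rule qt_eqI[OF triv_subgroup], assumption)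
  fix k assume "G \<cong> Mgrp p be"
  moreover have "{\<one>} \<inter> P k = {\<one>}" using subgroup.one_closed[OF subgroup_P] by auto
  ultimately show "lg (P k) = tail be k + lg ({\<one>} \<inter> P k)" using is_iso_Mgrp_iff by (simp only: lg_one)
qed

end

lemma part_1_ge: "is_partition la \<Longrightarrow> x \<in> set la \<Longrightarrow> x \<le> part la 1"
  by (cases la) (auto simp: is_partition_def part_def)

lemma tail_part_1: "is_partition la \<Longrightarrow> part la 1 \<le> k \<Longrightarrow> tail la k = 0"
  unfolding tail_def using part_1_ge[of la] by (fastforce simp: sum_list_eq_0_iff)

theorem theorem1:
  fixes p :: nat and al be ga :: "nat list"
  assumes "Factorial_Ring.prime p" and "is_partition al" and "is_partition be" and "is_partition ga"
  shows "real (hall_number p al be ga) =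
    (\<Sum>T\<in>{T. klein_tableau T \<and> tab_e T = part al 1 \<and> has_type T al be ga}.
       \<Prod>l\<in>{2..part al 1 + 1}. real (E_aut p (restr T 1 l)) / real (E_aut p (restr T 2 l)))"
proof -
  let ?M = "Mgrp p be" and ?e = "part al 1"
  interpret M: fin_p_group ?M p by (rule fin_p_group_Mgrp[OF assms(1)])
  have qt1: "M.qt {\<one>\<^bsub>?M\<^esub>} = be" by (rule M.qt_one_iff[OF assms(3)]) (simp add: iso_refl)
  define I where "I = {T. klein_tableau T \<and> tab_e T = ?e \<and> has_type T al be ga}"
  define S where "S T = {U. subgroup U ?M \<and> emb_tableau p ?e ?M U = T}" for T
  define Hs where "Hs = {U. subgroup U ?M \<and> ?M\<lparr>carrier := U\<rparr> \<cong> Mgrp p al \<and> (?M Mod U) \<cong> Mgrp p ga}"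
  have Hs: "U \<in> Hs \<longleftrightarrow> emb_tableau p ?e ?M U \<in> I" if U: "subgroup U ?M" for U
  proof -
    interpret Q: fin_p_group "?M Mod U" p by (rule M.fin_p_group_Mod[OF U])
    let ?T = "emb_tableau p ?e ?M U"
    have kt: "klein_tableau ?T" by (rule M.klein_tableau_emb[OF U])
    have te: "tab_e ?T = ?e" unfolding tab_e_def emb_tableau_def by simp
    have nth: "fst ?T ! l = emb_gamma p ?M U l" if "l \<le> ?e" for l
      using that unfolding emb_tableau_def by (simp del: upt_Suc)
    have ht: "has_type ?T al be ga \<longleftrightarrow> M.qt (pmul ?M (p ^ ?e) U) = be \<and> M.qt U = ga \<and>
        (\<forall>l\<in>{1..?e}. conjp al l + M.lg (pmul ?M (p ^ l) U) = M.lg (pmul ?M (p ^ (l - 1)) U))"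
    proof -
      have "length (fst ?T) - 1 = ?e" unfolding emb_tableau_def by simp
      moreover have "emb_gamma p ?M U 0 = M.qt U" unfolding M.emb_gamma_qt using subgroup.subset[OF U] by simp
      moreover have "conjp al l = card (skew (fst ?T ! l) (fst ?T ! (l - 1))) \<longleftrightarrow>
          conjp al l + M.lg (pmul ?M (p ^ l) U) = M.lg (pmul ?M (p ^ (l - 1)) U)" if "l \<in> {1..?e}" for l
      proof -
        have "l \<le> ?e" "l - 1 \<le> ?e" "1 \<le> l" using that by auto
        then have "fst ?T ! l = emb_gamma p ?M U l" "fst ?T ! (l - 1) = emb_gamma p ?M U (l - 1)"
          using nth by blast+
        then show ?thesis using M.card_skew_emb_gamma[OF U \<open>1 \<le> l\<close>] by (metis add_right_cancel)
      qed
      ultimately show ?thesis unfolding has_type_def Let_def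
        using nth[of ?e] nth[of 0] by (simp add: M.emb_gamma_qt)
    qed
    \<comment> \<open>The left side says that U has type al. The right side gives only the quotients
      of consecutive orders up to e, but its first condition makes p^e U trivial, and
      \<open>tail_eqI\<close> then recovers all orders.\<close>
    have "(\<forall>k. M.lg (pmul ?M (p ^ k) U) = tail al k) \<longleftrightarrow> M.qt (pmul ?M (p ^ ?e) U) = be \<and>
        (\<forall>l\<in>{1..?e}. conjp al l + M.lg (pmul ?M (p ^ l) U) = M.lg (pmul ?M (p ^ (l - 1)) U))" (is "?l \<longleftrightarrow> ?r")
    proof
      assume l: ?l
      show ?r
      proof (intro conjI ballI)
        have "M.lg (pmul ?M (p ^ ?e) U) = 0" using l tail_part_1[OF assms(2)] by simp
        then have "pmul ?M (p ^ ?e) U = {\<one>\<^bsub>?M\<^esub>}" using M.lg_eq_0_iff[OF M.pmul_subgroup[OF U]] by blast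
        then show "M.qt (pmul ?M (p ^ ?e) U) = be" using qt1 by simp
        fix k assume "k \<in> {1..?e}"
        then show "conjp al k + M.lg (pmul ?M (p ^ k) U) = M.lg (pmul ?M (p ^ (k - 1)) U)"
          using l tail_Suc[of al "k - 1"] by simp
      qed
    next
      assume r: ?r
      have e1: "pmul ?M (p ^ ?e) U = {\<one>\<^bsub>?M\<^esub>}" using r qt1 M.eq_one_if_qt[OF M.pmul_subgroup[OF U]] by simp
      have z: "M.lg (pmul ?M (p ^ k) U) = 0" if "?e \<le> k" for k
      proof -
        have "pmul ?M (p ^ k) U = pmul ?M (p ^ (k - ?e)) (pmul ?M (p ^ ?e) U)"
          using that subgroup.subset[OF U] by (simp add: M.pmul_pmul power_add[symmetric])
        then show ?thesis unfolding e1 by (simp add: M.pmul_one)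
      qed
      show ?l
      proof
        fix k
        have "tail al k = M.lg (pmul ?M (p ^ k) U)"
        proof (rule tail_eqI[where n = ?e])
          show "M.lg (pmul ?M (p ^ ?e) U) = 0" using z by simp
          show "M.lg (pmul ?M (p ^ k) U) = conjp al (Suc k) + M.lg (pmul ?M (p ^ Suc k) U)" for k
          proof (cases "k < ?e")
            case True
            then show ?thesis using conjunct2[OF r, THEN bspec, of "Suc k"] by simp
          next
            case False
            then have "tail al k = 0" using tail_part_1[OF assms(2)] by simp
            then show ?thesis using z[of k] z[of "Suc k"] False tail_Suc[of al k] by simp
          qed
        qed
        then show "M.lg (pmul ?M (p ^ k) U) = tail al k" by simp
      qed
    qed
    then show ?thesis unfolding Hs_def I_def mem_Collect_eq ht
      using U kt te M.subgroup_iso_Mgrp_iff[OF U] Q.is_iso_iff_grp_type[OF assms(4)] by blast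
  qed
  have tg: "M.qt {\<one>\<^bsub>?M\<^esub>} = tab_g T (tab_e T)" if "T \<in> I" for T
  proof -
    have "fst T \<noteq> []" using that klein_tableauD(1)[of "fst T" "snd T"] unfolding I_def by simp
    then show ?thesis using that qt1 unfolding I_def has_type_def Let_def tab_g_def tab_e_def
      by (auto simp: last_conv_nth)
  qed
  have cS: "real (card (S T)) = (\<Prod>l\<in>{2..?e + 1}. real (E_aut p (restr T 1 l)) / real (E_aut p (restr T 2 l)))"
    "0 < card (S T)" if T: "T \<in> I" for T
    using M.card_emb_tableau[OF _ tg[OF T]] T unfolding I_def S_def by auto
  have finS: "finite (S T)" for T unfolding S_def by (rule finite_subset[OF _ M.finite_subgroups]) auto
  \<comment> \<open>Each tableau in \<open>I\<close> is realized by a subgroup of the finite group,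
    so \<open>I\<close> is finite and the fibres over it can be summed.\<close>
  have "I \<subseteq> (\<lambda>U. emb_tableau p ?e ?M U) ` {U. subgroup U ?M}"
  proof
    fix T assume "T \<in> I"
    then have "S T \<noteq> {}" using cS(2) by fastforce
    then show "T \<in> (\<lambda>U. emb_tableau p ?e ?M U) ` {U. subgroup U ?M}" unfolding S_def by blast
  qed
  then have finI: "finite I" using M.finite_subgroups finite_surj by blast
  have "Hs = (\<Union>T\<in>I. S T)"
  proof (intro equalityI subsetI)
    fix U assume U: "U \<in> Hs"
    then have "subgroup U ?M" unfolding Hs_def by simp
    then show "U \<in> (\<Union>T\<in>I. S T)" using Hs U unfolding S_def by blast
  next
    fix U assume "U \<in> (\<Union>T\<in>I. S T)"
    then show "U \<in> Hs" using Hs unfolding S_def by blast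
  qed
  then have "card Hs = (\<Sum>T\<in>I. card (S T))"
    by (simp only:) (rule card_UN_disjoint[OF finI]; use finS in \<open>auto simp: S_def\<close>)
  then have "real (card Hs) = (\<Sum>T\<in>I. real (card (S T)))" by simp
  also have "\<dots> = (\<Sum>T\<in>I. \<Prod>l\<in>{2..?e + 1}. real (E_aut p (restr T 1 l)) / real (E_aut p (restr T 2 l)))"
    using cS(1) by (intro sum.cong) auto
  finally show ?thesis unfolding hall_number_def I_def Hs_def .
qed

end
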